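(* Let $Q$ be a quiver. For a stability function $Z$ on $Q$ and $\alpha\in\Gamma_+(Q)$, let $f_Z(\alpha)$ be the motivic invariant of $Z$-semistable abelian representations of $Q(\alpha)$ defined in the context. Then the ordered product $$\prod_{l}^{\curvearrowright}\bigg(1+\sum_{\alpha\in\Gamma_+(Q)\setminus\{0\},\ Z(\alpha)\in l}f_Z(\alpha)\frac{x^\alpha}{\alpha!}\bigg)$$ in the quantum torus of $Q$, taken over all rays $l\subset\mathbb H_+$ in clockwise order, is independent of the stability function $Z$.
   Context: $\mathbb N=\{0,1,2,\dots\}$. $K_0(\mathrm{Var}_{\mathbb C})$ is the Grothendieck ring of complex varieties, $\mathbb L=[\mathbb A^1]$ is also denoted $q$, and $\mathcal V=K_0(\mathrm{Var}_{\mathbb C})\otimes_{\mathbb Z[\mathbb L]}\mathbb Q(\mathbb L^{1/2})$. $Q$ has vertex set $Q_0$ (possibly infinite) and arrow set $Q_1$, with finitely many arrows between any two vertices. $\Gamma(Q)$ is the group of finitely supported maps $Q_0\to\mathbb Z$, $\Gamma_+(Q)$ the submonoid of maps to $\mathbb N$; $i\in Q_0$ also denotes the corresponding basis vector. For $\alpha\in\Gamma_+(Q)$: $|\alpha|=\sum_i\alpha_i$, $\alpha!=\prod_i\alpha_i!$. Put $r(\alpha,\beta)=\sum_{(a:i\to j)\in Q_1}\alpha_i\beta_j$ and $\langle\alpha,\beta\rangle=r(\beta,\alpha)-r(\alpha,\beta)$. The quantum torus of $Q$ is $\mathcal V[[x_i,i\in Q_0]]$ with multiplication $x^\alpha\circ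 x^\beta=q^{\frac12\langle\alpha,\beta\rangle}x^{\alpha+\beta}$; infinite ordered products are taken coefficientwise. A stability function on $Q$ is a group homomorphism $Z:\Gamma(Q)\to\mathbb C$ with $Z(i)\in\mathbb H_+=\{re^{i\pi\varphi}:r>0,\,0<\varphi\le1\}$ for all $i\in Q_0$. Writing $Z=-d+\sqrt{-1}\,r_Z$ with real-valued $d,r_Z$, the slope is $\mu_Z(\alpha)=d(\alpha)/r_Z(\alpha)\in\mathbb R\cup\{\infty\}$ for nonzero $\alpha\in\Gamma_+(Q)$. A representation $M$ is $Z$-semistable if $\mu_Z(\underline{\dim}N)\le\mu_Z(\underline{\dim}M)$ for all proper nonzero subrepresentations $N$. Rays are sets $\mathbb R_{>0}v$, $v\in\mathbb H_+$; clockwise order means decreasing argument (decreasing slope) from left to right. For $\alpha\in\Gamma_+(Q)$ the quiver $Q(\alpha)$ has vertices $i_k$ with $i\in Q_0$, $1\le k\le\alpha_i$, and the number of arrows from $i_k$ to $j_{k'}$ equals the number of arrows from $i$ to $j$ in $Q$. It carries the induced stability function $Z(i_k)=Z(i)$. Abelian representations of $Q(\alpha)$ are representations over $\mathbb C$ with dimension one at every vertex; they form the affine space $\mathbb C^{Q(\alpha)_1}$, with $Z$-semistable locus $R_Z(Q(\alpha))$. Note $|Q(\alpha)_0|=|\alpha|$, $|Q(\alpha)_1|=r(\alpha,\alpha)$. Define $$f_Z(\alpha)=q^{\frac12(|\alpha|-r(\alpha,\alpha))}\frac{[R_Z(Q(\alpha))]}{(q-1)^{|\alpha|}}\in\mathcal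 V .$$ *)

theory Defs
  imports
    "HOL-Analysis.Analysis"
    "HOL-Library.Poly_Mapping"
    "HOL-Library.Multiset"
    "HOL-Computational_Algebra.Polynomial"
    "HOL-Computational_Algebra.Fraction_Field"
    "Graph_Theory.Digraph"
begin

section \<open>Complex varieties\<close>

text \<open>
  Varieties are taken in the sense of Serre: reduced separated schemes of finite type over the
  complex numbers, described by their closed points, the Zariski topology on these, and the sheaf
  of complex-valued regular functions. They need not be irreducible. A function on an open set
  \<open>U\<close> is represented by a total function whose values outside \<open>U\<close> are irrelevant; the field
  \<open>regular\<close> is meaningful on open sets only.
\<close>

record 'p fun_space =
  zariski :: "'p topology"
  regular :: "'p set \<Rightarrow> ('p \<Rightarrow> complex) set"

abbreviation points :: "'p fun_space \<Rightarrow> 'p set" where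
  "points X \<equiv> topspace (zariski X)"

definition function_sheaf :: "'p fun_space \<Rightarrow> bool" where
  "function_sheaf X \<longleftrightarrow>
     (\<forall>U f g. openin (zariski X) U \<and> f \<in> regular X U \<and> (\<forall>x\<in>U. g x = f x) \<longrightarrow> g \<in> regular X U) \<and>
     (\<forall>U V f. openin (zariski X) U \<and> openin (zariski X) V \<and> V \<subseteq> U \<and> f \<in> regular X U
        \<longrightarrow> f \<in> regular X V) \<and>
     (\<forall>U f. openin (zariski X) U \<and>
        (\<forall>x\<in>U. \<exists>V. openin (zariski X) V \<and> x \<in> V \<and> V \<subseteq> U \<and> f \<in> regular X V)
        \<longrightarrow> f \<in> regular X U)"

definition morphism :: "'p fun_space \<Rightarrow> 'q fun_space \<Rightarrow> ('p \<Rightarrow> 'q) \<Rightarrow> bool" where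
  "morphism X Y \<phi> \<longleftrightarrow> continuous_map (zariski X) (zariski Y) \<phi> \<and>
     (\<forall>V g. openin (zariski Y) V \<and> g \<in> regular Y V
        \<longrightarrow> g \<circ> \<phi> \<in> regular X {x \<in> points X. \<phi> x \<in> V})"

definition isomorphic :: "'p fun_space \<Rightarrow> 'q fun_space \<Rightarrow> bool" where
  "isomorphic X Y \<longleftrightarrow> (\<exists>\<phi> \<psi>. morphism X Y \<phi> \<and> morphism Y X \<psi> \<and>
     (\<forall>x\<in>points X. \<psi> (\<phi> x) = x) \<and> (\<forall>y\<in>points Y. \<phi> (\<psi> y) = y))"

text \<open>The structure induced on a locally closed subset \<open>S\<close> (reduced, if \<open>S\<close> is closed).\<close>

definition induced :: "'p fun_space \<Rightarrow> 'p set \<Rightarrow> 'p fun_space" where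
  "induced X S = \<lparr>
     zariski = subtopology (zariski X) S,
     regular = (\<lambda>U. {f. \<forall>x\<in>U. \<exists>W g. openin (zariski X) W \<and> x \<in> W \<and> g \<in> regular X W \<and>
                         (\<forall>y \<in> U \<inter> W. f y = g y)}) \<rparr>"

inductive_set poly_funs :: "(('i \<Rightarrow> complex) \<Rightarrow> complex) set" where
  const: "(\<lambda>x. c) \<in> poly_funs"
| coord: "(\<lambda>x. x i) \<in> poly_funs"
| add: "f \<in> poly_funs \<Longrightarrow> g \<in> poly_funs \<Longrightarrow> (\<lambda>x. f x + g x) \<in> poly_funs"
| mult: "f \<in> poly_funs \<Longrightarrow> g \<in> poly_funs \<Longrightarrow> (\<lambda>x. f x * g x) \<in> poly_funs"

text \<open>
  The affine space with coordinates indexed by the finite set \<open>I\<close>; coordinates outside \<open>I\<close> are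
  set to zero. Principal open sets are closed under intersection, so they form a basis.
\<close>

definition affine_points :: "'i set \<Rightarrow> ('i \<Rightarrow> complex) set" where
  "affine_points I = {x. \<forall>i. i \<notin> I \<longrightarrow> x i = 0}"

definition affine_space :: "'i set \<Rightarrow> ('i \<Rightarrow> complex) fun_space" where
  "affine_space I = \<lparr>
     zariski = topology_generated_by {{x \<in> affine_points I. h x \<noteq> 0} |h. h \<in> poly_funs},
     regular = (\<lambda>U. {f. \<forall>x\<in>U. \<exists>g\<in>poly_funs. \<exists>h\<in>poly_funs. h x \<noteq> 0 \<and>
                         (\<forall>y\<in>U. h y \<noteq> 0 \<longrightarrow> f y = g y / h y)}) \<rparr>"

definition affine_variety :: "'p fun_space \<Rightarrow> bool" where
  "affine_variety X \<longleftrightarrow> (\<exists>(n::nat) S. closedin (zariski (affine_space {..<n})) S \<and>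
     isomorphic X (induced (affine_space {..<n}) S))"

text \<open>
  Products: locally, regular functions on \<open>X \<times> Y\<close> are quotients of functions
  \<open>\<Sum>i. f i x * g i y\<close> with \<open>f i\<close> and \<open>g i\<close> regular, and the nonvanishing loci of such sums form a
  basis of the topology (finer than the product topology).
\<close>

definition tensor_funs ::
    "'p fun_space \<Rightarrow> 'q fun_space \<Rightarrow> 'p set \<Rightarrow> 'q set \<Rightarrow> ('p \<times> 'q \<Rightarrow> complex) set" where
  "tensor_funs X Y U V = {\<lambda>z. \<Sum>i<n. f i (fst z) * g i (snd z) |(n::nat) f g.
     \<forall>i<n. f i \<in> regular X U \<and> g i \<in> regular Y V}"

definition product_space :: "'p fun_space \<Rightarrow> 'q fun_space \<Rightarrow> ('p \<times> 'q) fun_space" where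
  "product_space X Y = \<lparr>
     zariski = topology_generated_by {{z \<in> U \<times> V. h z \<noteq> 0} |U V h.
       openin (zariski X) U \<and> openin (zariski Y) V \<and> h \<in> tensor_funs X Y U V},
     regular = (\<lambda>W. {f. \<forall>z\<in>W. \<exists>U V. openin (zariski X) U \<and> openin (zariski Y) V \<and> z \<in> U \<times> V \<and>
       (\<exists>g\<in>tensor_funs X Y U V. \<exists>h\<in>tensor_funs X Y U V. h z \<noteq> 0 \<and>
         (\<forall>w \<in> W \<inter> U \<times> V. h w \<noteq> 0 \<longrightarrow> f w = g w / h w))}) \<rparr>"

definition separated :: "'p fun_space \<Rightarrow> bool" where
  "separated X \<longleftrightarrow> closedin (zariski (product_space X X)) {(x, x) |x. x \<in> points X}"

definition variety :: "'p fun_space \<Rightarrow> bool" where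
  "variety X \<longleftrightarrow> function_sheaf X \<and>
     (\<exists>\<U>. finite \<U> \<and> \<Union>\<U> = points X \<and>
        (\<forall>U\<in>\<U>. openin (zariski X) U \<and> affine_variety (induced X U))) \<and>
     separated X"

section \<open>Commutative rings given by generators and relations\<close>

text \<open>
  The free commutative ring on \<open>'g\<close> is the monoid ring of the free commutative monoid on \<open>'g\<close>;
  relations are elements \<open>p\<close> standing for \<open>p = 0\<close>.
\<close>

type_synonym 'g free_ring = "'g multiset \<Rightarrow>\<^sub>0 int"

definition gen :: "'g \<Rightarrow> 'g free_ring" where
  "gen x = Poly_Mapping.single {#x#} 1"

definition ideal_generated :: "'r::comm_ring_1 set \<Rightarrow> 'r set" where
  "ideal_generated R = module.span (*) R"

definition cong_ideal :: "'r::comm_ring_1 set \<Rightarrow> 'r \<Rightarrow> 'r \<Rightarrow> bool" where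
  "cong_ideal R p q \<longleftrightarrow> p - q \<in> ideal_generated R"

lemma module_times: "module ((*) :: 'r::comm_ring_1 \<Rightarrow> 'r \<Rightarrow> 'r)"
  by unfold_locales (simp_all add: algebra_simps)

lemma equivp_cong_ideal: "equivp (cong_ideal R)"
proof (rule equivpI)
  interpret module "(*) :: 'a \<Rightarrow> 'a \<Rightarrow> 'a" by (rule module_times)
  show "reflp (cong_ideal R)"
    by (auto simp: reflp_def cong_ideal_def ideal_generated_def span_zero)
  show "symp (cong_ideal R)"
  proof (rule sympI)
    fix x y assume "cong_ideal R x y"
    then have "- (x - y) \<in> span R" unfolding cong_ideal_def ideal_generated_def by (rule span_neg)
    then show "cong_ideal R y x" by (simp add: cong_ideal_def ideal_generated_def)
  qed
  show "transp (cong_ideal R)"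
  proof (rule transpI)
    fix x y z assume "cong_ideal R x y" "cong_ideal R y z"
    then have "(x - y) + (y - z) \<in> span R"
      unfolding cong_ideal_def ideal_generated_def by (rule span_add)
    then show "cong_ideal R x z" by (simp add: cong_ideal_def ideal_generated_def)
  qed
qed

lemma cong_ideal_add:
  assumes "cong_ideal R p p'" "cong_ideal R q q'"
  shows "cong_ideal R (p + q) (p' + q')"
proof -
  interpret module "(*) :: 'a \<Rightarrow> 'a \<Rightarrow> 'a" by (rule module_times)
  have "(p - p') + (q - q') \<in> span R"
    using assms unfolding cong_ideal_def ideal_generated_def by (rule span_add)
  then show ?thesis by (simp add: cong_ideal_def ideal_generated_def algebra_simps)
qed

lemma cong_ideal_mult:
  assumes "cong_ideal R p p'" "cong_ideal R q q'"
  shows "cong_ideal R (p * q) (p' * q')"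
proof -
  interpret module "(*) :: 'a \<Rightarrow> 'a \<Rightarrow> 'a" by (rule module_times)
  have "q * (p - p') + p' * (q - q') \<in> span R"
    using assms unfolding cong_ideal_def ideal_generated_def by (intro span_add span_scale)
  then show ?thesis by (simp add: cong_ideal_def ideal_generated_def algebra_simps)
qed

lemma cong_ideal_uminus:
  assumes "cong_ideal R p p'"
  shows "cong_ideal R (- p) (- p')"
  using cong_ideal_mult[OF _ assms, of "-1" "-1"] equivp_reflp[OF equivp_cong_ideal, of R "-1"]
  by simp

section \<open>The Grothendieck ring of varieties\<close>

text \<open>
  Every complex variety has at most continuum many points, hence is isomorphic to one whose points
  form a subset of \<open>nat \<Rightarrow> complex\<close>. These varieties serve as generators.
\<close>

typedef cvariety = "{X :: (nat \<Rightarrow> complex) fun_space. variety X}"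
proof -
  let ?E = "\<lparr>zariski = discrete_topology {}, regular = (\<lambda>_. UNIV)\<rparr> :: (nat \<Rightarrow> complex) fun_space"
  have "variety ?E"
    unfolding variety_def function_sheaf_def separated_def by (auto intro!: exI[of _ "{}"])
  then show ?thesis by blast
qed

definition K0_relations :: "cvariety free_ring set" where
  "K0_relations =
     {gen X - gen Y |X Y. isomorphic (Rep_cvariety X) (Rep_cvariety Y)} \<union>
     {gen X - (gen Y + gen W) |X Y W. \<exists>S.
        closedin (zariski (Rep_cvariety X)) S \<and>
        isomorphic (Rep_cvariety Y) (induced (Rep_cvariety X) S) \<and>
        isomorphic (Rep_cvariety W) (induced (Rep_cvariety X) (points (Rep_cvariety X) - S))} \<union>
     {gen W - gen X * gen Y |X Y W.
        isomorphic (Rep_cvariety W) (product_space (Rep_cvariety X) (Rep_cvariety Y))} \<union>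
     {gen X - 1 |X. isomorphic (Rep_cvariety X) (affine_space ({} :: nat set))}"

quotient_type K0 = "cvariety free_ring" / "cong_ideal K0_relations"
  by (rule equivp_cong_ideal)

text \<open>
  Type class \<open>comm_ring_1\<close> includes \<open>0 \<noteq> 1\<close>, a nontrivial fact here which is not needed for the
  definitions.
\<close>

instantiation K0 :: "{comm_ring, comm_monoid_mult}"
begin

lift_definition zero_K0 :: K0 is 0 .
lift_definition one_K0 :: K0 is 1 .
lift_definition plus_K0 :: "K0 \<Rightarrow> K0 \<Rightarrow> K0" is "(+)" by (rule cong_ideal_add)
lift_definition times_K0 :: "K0 \<Rightarrow> K0 \<Rightarrow> K0" is "(*)" by (rule cong_ideal_mult)
lift_definition uminus_K0 :: "K0 \<Rightarrow> K0" is uminus by (rule cong_ideal_uminus)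
definition minus_K0 :: "K0 \<Rightarrow> K0 \<Rightarrow> K0" where "minus_K0 a b = a + - b"

instance
proof
  fix a b c :: K0
  show "a + b + c = a + (b + c)"
    by transfer (simp add: add.assoc equivp_reflp[OF equivp_cong_ideal])
  show "a + b = b + a"
    by transfer (simp add: add.commute equivp_reflp[OF equivp_cong_ideal])
  show "0 + a = a" by transfer (simp add: equivp_reflp[OF equivp_cong_ideal])
  show "- a + a = 0" by transfer (simp add: equivp_reflp[OF equivp_cong_ideal])
  show "a - b = a + - b" by (rule minus_K0_def)
  show "a * b * c = a * (b * c)"
    by transfer (simp add: mult.assoc equivp_reflp[OF equivp_cong_ideal])
  show "a * b = b * a"
    by transfer (simp add: mult.commute equivp_reflp[OF equivp_cong_ideal])
  show "1 * a = a" by transfer (simp add: equivp_reflp[OF equivp_cong_ideal])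
  show "(a + b) * c = a * c + b * c"
    by transfer (simp add: distrib_right equivp_reflp[OF equivp_cong_ideal])
qed

end

definition K0_class :: "'p fun_space \<Rightarrow> K0" where
  "K0_class X = abs_K0 (gen (SOME C. isomorphic X (Rep_cvariety C)))"

definition K0_L :: K0 where
  "K0_L = K0_class (affine_space {0::nat})"

section \<open>The coefficient ring\<close>

text \<open>The field of rational functions over the rationals, whose variable stands for the square root
  of the Lefschetz motive.\<close>

type_synonym ratfun = "rat poly fract"

definition sqrt_L :: ratfun where
  "sqrt_L = Fract [:0, 1:] 1"

text \<open>
  The tensor product of \<open>K0\<close> and \<open>ratfun\<close> as commutative rings, generated by the symbols
  \<open>a \<otimes> b\<close>. Given biadditivity, being balanced over the polynomial ring in the Lefschetz motive with
  integer coefficients amounts to being balanced with respect to its variable.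
\<close>

definition tensor_relations :: "(K0 \<times> ratfun) free_ring set" where
  "tensor_relations =
     {gen (a + a', b) - (gen (a, b) + gen (a', b)) |a a' b. True} \<union>
     {gen (a, b + b') - (gen (a, b) + gen (a, b')) |a b b'. True} \<union>
     {gen (K0_L * a, b) - gen (a, sqrt_L ^ 2 * b) |a b. True} \<union>
     {gen (a * a', b * b') - gen (a, b) * gen (a', b') |a a' b b'. True} \<union>
     {gen (1, 1) - 1}"

quotient_type mot = "(K0 \<times> ratfun) free_ring" / "cong_ideal tensor_relations"
  by (rule equivp_cong_ideal)

instantiation mot :: "{comm_ring, comm_monoid_mult}"
begin

lift_definition zero_mot :: mot is 0 .
lift_definition one_mot :: mot is 1 .
lift_definition plus_mot :: "mot \<Rightarrow> mot \<Rightarrow> mot" is "(+)" by (rule cong_ideal_add)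
lift_definition times_mot :: "mot \<Rightarrow> mot \<Rightarrow> mot" is "(*)" by (rule cong_ideal_mult)
lift_definition uminus_mot :: "mot \<Rightarrow> mot" is uminus by (rule cong_ideal_uminus)
definition minus_mot :: "mot \<Rightarrow> mot \<Rightarrow> mot" where "minus_mot a b = a + - b"

instance
proof
  fix a b c :: mot
  show "a + b + c = a + (b + c)"
    by transfer (simp add: add.assoc equivp_reflp[OF equivp_cong_ideal])
  show "a + b = b + a"
    by transfer (simp add: add.commute equivp_reflp[OF equivp_cong_ideal])
  show "0 + a = a" by transfer (simp add: equivp_reflp[OF equivp_cong_ideal])
  show "- a + a = 0" by transfer (simp add: equivp_reflp[OF equivp_cong_ideal])
  show "a - b = a + - b" by (rule minus_mot_def)
  show "a * b * c = a * (b * c)"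
    by transfer (simp add: mult.assoc equivp_reflp[OF equivp_cong_ideal])
  show "a * b = b * a"
    by transfer (simp add: mult.commute equivp_reflp[OF equivp_cong_ideal])
  show "1 * a = a" by transfer (simp add: equivp_reflp[OF equivp_cong_ideal])
  show "(a + b) * c = a * c + b * c"
    by transfer (simp add: distrib_right equivp_reflp[OF equivp_cong_ideal])
qed

end

definition mot_tensor :: "K0 \<Rightarrow> ratfun \<Rightarrow> mot" where
  "mot_tensor a b = abs_mot (gen (a, b))"

definition mot_class :: "'p fun_space \<Rightarrow> mot" where
  "mot_class X = mot_tensor (K0_class X) 1"

definition mot_scalar :: "ratfun \<Rightarrow> mot" where
  "mot_scalar c = mot_tensor 1 c"

section \<open>Quivers and dimension vectors\<close>

definition quiver :: "('v, 'e) pre_digraph \<Rightarrow> bool" where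
  "quiver Q \<longleftrightarrow> wf_digraph Q \<and>
     (\<forall>i\<in>verts Q. \<forall>j\<in>verts Q. finite {a \<in> arcs Q. tail Q a = i \<and> head Q a = j})"

definition Gamma_int :: "('v, 'e) pre_digraph \<Rightarrow> ('v \<Rightarrow>\<^sub>0 int) set" where
  "Gamma_int Q = {\<alpha>. Poly_Mapping.keys \<alpha> \<subseteq> verts Q}"

definition Gamma_plus :: "('v, 'e) pre_digraph \<Rightarrow> ('v \<Rightarrow>\<^sub>0 nat) set" where
  "Gamma_plus Q = {\<alpha>. Poly_Mapping.keys \<alpha> \<subseteq> verts Q}"

abbreviation to_Gamma_int :: "('v \<Rightarrow>\<^sub>0 nat) \<Rightarrow> ('v \<Rightarrow>\<^sub>0 int)" where
  "to_Gamma_int \<equiv> Poly_Mapping.map int"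

definition weight :: "('v \<Rightarrow>\<^sub>0 nat) \<Rightarrow> nat" where
  "weight \<alpha> = (\<Sum>i\<in>Poly_Mapping.keys \<alpha>. Poly_Mapping.lookup \<alpha> i)"

definition vfact :: "('v \<Rightarrow>\<^sub>0 nat) \<Rightarrow> nat" where
  "vfact \<alpha> = (\<Prod>i\<in>Poly_Mapping.keys \<alpha>. fact (Poly_Mapping.lookup \<alpha> i))"

definition rform :: "('v, 'e) pre_digraph \<Rightarrow> ('v \<Rightarrow>\<^sub>0 nat) \<Rightarrow> ('v \<Rightarrow>\<^sub>0 nat) \<Rightarrow> nat" where
  "rform Q \<alpha> \<beta> =
     (\<Sum>a | a \<in> arcs Q \<and> tail Q a \<in> Poly_Mapping.keys \<alpha> \<and> head Q a \<in> Poly_Mapping.keys \<beta>.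
        Poly_Mapping.lookup \<alpha> (tail Q a) * Poly_Mapping.lookup \<beta> (head Q a))"

definition skew_form :: "('v, 'e) pre_digraph \<Rightarrow> ('v \<Rightarrow>\<^sub>0 nat) \<Rightarrow> ('v \<Rightarrow>\<^sub>0 nat) \<Rightarrow> int" where
  "skew_form Q \<alpha> \<beta> = int (rform Q \<beta> \<alpha>) - int (rform Q \<alpha> \<beta>)"

section \<open>Stability\<close>

definition upper_half_plane :: "complex set" where
  "upper_half_plane = {complex_of_real r * cis (pi * \<phi>) |r \<phi>. 0 < r \<and> 0 < \<phi> \<and> \<phi> \<le> 1}"

definition stability :: "('v, 'e) pre_digraph \<Rightarrow> (('v \<Rightarrow>\<^sub>0 int) \<Rightarrow> complex) \<Rightarrow> bool" where
  "stability Q Z \<longleftrightarrow>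
     (\<forall>\<alpha>\<in>Gamma_int Q. \<forall>\<beta>\<in>Gamma_int Q. Z (\<alpha> + \<beta>) = Z \<alpha> + Z \<beta>) \<and>
     (\<forall>i\<in>verts Q. Z (Poly_Mapping.single i 1) \<in> upper_half_plane)"

definition slope :: "(('v \<Rightarrow>\<^sub>0 int) \<Rightarrow> complex) \<Rightarrow> ('v \<Rightarrow>\<^sub>0 nat) \<Rightarrow> ereal" where
  "slope Z \<alpha> =
     (let d = - Re (Z (to_Gamma_int \<alpha>)); r = Im (Z (to_Gamma_int \<alpha>))
      in if r = 0 then \<infinity> else ereal (d / r))"

text \<open>
  A finite-dimensional representation is given by finite-dimensional subspaces \<open>V i\<close> of an ambient
  complex vector space and linear maps \<open>M a\<close>, of which only the restriction to \<open>V (tail Q a)\<close>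
  matters.
\<close>

definition quiver_representation ::
    "(complex \<Rightarrow> 'w \<Rightarrow> 'w::ab_group_add) \<Rightarrow> ('v, 'e) pre_digraph \<Rightarrow>
     ('v \<Rightarrow> 'w set) \<Rightarrow> ('e \<Rightarrow> 'w \<Rightarrow> 'w) \<Rightarrow> bool" where
  "quiver_representation smul Q V M \<longleftrightarrow>
     (\<forall>i\<in>verts Q. module.subspace smul (V i) \<and> (\<exists>B. finite B \<and> V i = module.span smul B)) \<and>
     (\<forall>a\<in>arcs Q. Vector_Spaces.linear smul smul (M a) \<and> M a ` V (tail Q a) \<subseteq> V (head Q a))"

definition subrepresentation ::
    "(complex \<Rightarrow> 'w \<Rightarrow> 'w::ab_group_add) \<Rightarrow> ('v, 'e) pre_digraph \<Rightarrow>
     ('v \<Rightarrow> 'w set) \<Rightarrow> ('v \<Rightarrow> 'w set) \<Rightarrow> ('e \<Rightarrow> 'w \<Rightarrow> 'w) \<Rightarrow> bool" where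
  "subrepresentation smul Q N V M \<longleftrightarrow>
     (\<forall>i\<in>verts Q. module.subspace smul (N i) \<and> N i \<subseteq> V i) \<and>
     (\<forall>a\<in>arcs Q. M a ` N (tail Q a) \<subseteq> N (head Q a))"

definition dim_vector ::
    "(complex \<Rightarrow> 'w \<Rightarrow> 'w::ab_group_add) \<Rightarrow> ('v, 'e) pre_digraph \<Rightarrow> ('v \<Rightarrow> 'w set) \<Rightarrow> ('v \<Rightarrow>\<^sub>0 nat)"
  where
  "dim_vector smul Q V =
     Abs_poly_mapping (\<lambda>i. if i \<in> verts Q then vector_space.dim smul (V i) else 0)"

definition semistable ::
    "(complex \<Rightarrow> 'w \<Rightarrow> 'w::ab_group_add) \<Rightarrow> ('v, 'e) pre_digraph \<Rightarrow>
     (('v \<Rightarrow>\<^sub>0 int) \<Rightarrow> complex) \<Rightarrow> ('v \<Rightarrow> 'w set) \<Rightarrow> ('e \<Rightarrow> 'w \<Rightarrow> 'w) \<Rightarrow> bool" where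
  "semistable smul Q Z V M \<longleftrightarrow> quiver_representation smul Q V M \<and>
     (\<forall>N. subrepresentation smul Q N V M \<and>
          (\<exists>i\<in>verts Q. N i \<noteq> {0}) \<and> (\<exists>i\<in>verts Q. N i \<noteq> V i)
          \<longrightarrow> slope Z (dim_vector smul Q N) \<le> slope Z (dim_vector smul Q V))"

section \<open>Abelian representations\<close>

definition abelian_quiver ::
    "('v, 'e) pre_digraph \<Rightarrow> ('v \<Rightarrow>\<^sub>0 nat) \<Rightarrow> ('v \<times> nat, 'e \<times> nat \<times> nat) pre_digraph" where
  "abelian_quiver Q \<alpha> = \<lparr>
     verts = {(i, k). i \<in> verts Q \<and> 1 \<le> k \<and> k \<le> Poly_Mapping.lookup \<alpha> i},
     arcs = {(a, k, k'). a \<in> arcs Q \<and> 1 \<le> k \<and> k \<le> Poly_Mapping.lookup \<alpha> (tail Q a) \<and>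
                         1 \<le> k' \<and> k' \<le> Poly_Mapping.lookup \<alpha> (head Q a)},
     tail = (\<lambda>(a, k, k'). (tail Q a, k)),
     head = (\<lambda>(a, k, k'). (head Q a, k')) \<rparr>"

definition induced_stability ::
    "(('v \<Rightarrow>\<^sub>0 int) \<Rightarrow> complex) \<Rightarrow> (('v \<times> nat) \<Rightarrow>\<^sub>0 int) \<Rightarrow> complex" where
  "induced_stability Z \<beta> =
     (\<Sum>p\<in>Poly_Mapping.keys \<beta>. of_int (Poly_Mapping.lookup \<beta> p) * Z (Poly_Mapping.single (fst p) 1))"

definition semistable_locus ::
    "('v, 'e) pre_digraph \<Rightarrow> (('v \<Rightarrow>\<^sub>0 int) \<Rightarrow> complex) \<Rightarrow> ('v \<Rightarrow>\<^sub>0 nat) \<Rightarrow>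
     (('e \<times> nat \<times> nat) \<Rightarrow> complex) set" where
  "semistable_locus Q Z \<alpha> =
     {m \<in> affine_points (arcs (abelian_quiver Q \<alpha>)).
        semistable (*) (abelian_quiver Q \<alpha>) (induced_stability Z) (\<lambda>_. UNIV) (\<lambda>a v. m a * v)}"

definition R_Z ::
    "('v, 'e) pre_digraph \<Rightarrow> (('v \<Rightarrow>\<^sub>0 int) \<Rightarrow> complex) \<Rightarrow> ('v \<Rightarrow>\<^sub>0 nat) \<Rightarrow>
     (('e \<times> nat \<times> nat) \<Rightarrow> complex) fun_space" where
  "R_Z Q Z \<alpha> = induced (affine_space (arcs (abelian_quiver Q \<alpha>))) (semistable_locus Q Z \<alpha>)"

definition f_Z ::
    "('v, 'e) pre_digraph \<Rightarrow> (('v \<Rightarrow>\<^sub>0 int) \<Rightarrow> complex) \<Rightarrow> ('v \<Rightarrow>\<^sub>0 nat) \<Rightarrow> mot" where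
  "f_Z Q Z \<alpha> =
     mot_scalar (sqrt_L powi (int (weight \<alpha>) - int (rform Q \<alpha> \<alpha>)) / (sqrt_L ^ 2 - 1) ^ weight \<alpha>)
     * mot_class (R_Z Q Z \<alpha>)"

section \<open>The quantum torus\<close>

text \<open>A series is given by its coefficients; only those at elements of \<open>Gamma_plus Q\<close> matter.\<close>

type_synonym 'v series = "('v \<Rightarrow>\<^sub>0 nat) \<Rightarrow> mot"

definition qt_one :: "'v series" where
  "qt_one \<alpha> = (if \<alpha> = 0 then 1 else 0)"

definition qt_times :: "('v, 'e) pre_digraph \<Rightarrow> 'v series \<Rightarrow> 'v series \<Rightarrow> 'v series" where
  "qt_times Q F G \<gamma> =
     (\<Sum>(\<alpha>, \<beta>) | \<alpha> + \<beta> = \<gamma>. mot_scalar (sqrt_L powi skew_form Q \<alpha> \<beta>) * F \<alpha> * G \<beta>)"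

definition qt_prod_list :: "('v, 'e) pre_digraph \<Rightarrow> 'v series list \<Rightarrow> 'v series" where
  "qt_prod_list Q Fs = foldr (qt_times Q) Fs qt_one"

definition rays :: "complex set set" where
  "rays = {{complex_of_real t * v |t. 0 < t} |v. v \<in> upper_half_plane}"

text \<open>Strictly decreasing arguments from left to right; on the upper half plane \<open>Arg\<close> takes its
  values in \<open>{0<..pi}\<close>.\<close>

definition clockwise :: "complex set list \<Rightarrow> bool" where
  "clockwise ls \<longleftrightarrow> sorted_wrt (\<lambda>l l'. \<forall>v\<in>l. \<forall>v'\<in>l'. Arg v > Arg v') ls"

text \<open>
  Coefficientwise convergence: each coefficient of the products over finite sets of rays (in
  clockwise order) is eventually constant as the finite set grows.
\<close>

definition has_clockwise_product ::
    "('v, 'e) pre_digraph \<Rightarrow> (complex set \<Rightarrow> 'v series) \<Rightarrow> 'v series \<Rightarrow> bool" where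
  "has_clockwise_product Q F P \<longleftrightarrow>
     (\<forall>\<alpha>\<in>Gamma_plus Q. \<exists>L0. finite L0 \<and> L0 \<subseteq> rays \<and>
        (\<forall>ls. clockwise ls \<and> L0 \<subseteq> set ls \<and> set ls \<subseteq> rays
           \<longrightarrow> qt_prod_list Q (map F ls) \<alpha> = P \<alpha>))"

definition ray_factor ::
    "('v, 'e) pre_digraph \<Rightarrow> (('v \<Rightarrow>\<^sub>0 int) \<Rightarrow> complex) \<Rightarrow> complex set \<Rightarrow> 'v series" where
  "ray_factor Q Z l \<alpha> =
     (if \<alpha> = 0 then 1
      else if \<alpha> \<in> Gamma_plus Q \<and> Z (to_Gamma_int \<alpha>) \<in> l
      then mot_scalar (1 / of_nat (vfact \<alpha>)) * f_Z Q Z \<alpha>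
      else 0)"

end

theory Submission
  imports Defs
begin

text \<open>
  The ordered product is the generating series of all abelian representations, semistable or not,
  written out along Harder-Narasimhan filtrations. That series does not mention \<open>Z\<close>.

  Fix a finite set \<open>V\<close> of vertices \<open>(i, k)\<close>. A subrepresentation of an abelian representation on \<open>V\<close>
  is a set of vertices closed under the arrows that act by a nonzero number, so semistability is a
  condition on the set \<open>T\<close> of these arrows, the support. Each support determines a unique ordered
  partition of \<open>V\<close> into blocks that are semistable of strictly decreasing phase, such that no arrow
  of \<open>T\<close> runs from a block to a later one (lemmas \<open>hn_type_exists\<close> and \<open>hn_piece_unique\<close>). Conversely
  such a \<open>T\<close> is assembled from a semistable support in each block and arbitrary arrows from later
  blocks to earlier ones. With weight \<open>(q - 1) ^ card T\<close> the subsets of a set of \<open>n\<close> arrows add up to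
  \<open>q ^ n\<close>, which gives the recursion \<open>hn_sum_Cons\<close> over the list of phases. If all phases that occur
  are in the list, every support is counted, and the total is \<open>q\<close> to the number of arrows
  (lemma \<open>hn_sum_total\<close>).

  This recursion is multiplication in the quantum torus. The factor \<open>q\<close> to the number of arrows from
  the later to the earlier part, corrected by the normalization \<open>q powr ((|\<alpha>| - r(\<alpha>, \<alpha>)) / 2)\<close>, is the
  twist of the multiplication; and \<open>\<alpha>! / (\<beta>! \<gamma>!)\<close> is the number of ways to split \<open>V\<close> into parts of
  dimension vectors \<open>\<beta>\<close> and \<open>\<gamma>\<close> (lemmas \<open>normalization_factor_Diff\<close>, \<open>card_subsets_dimv\<close> and
  \<open>qt_times_dimv\<close>). So the coefficient of the product at \<open>\<alpha>\<close> is, for every stability function,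
  \<open>q powr ((|\<alpha>| + r(\<alpha>, \<alpha>)) / 2) / ((q - 1) ^ |\<alpha>| * \<alpha>!)\<close>.

  The motivic input is that the class of a semistable locus is the sum of \<open>(L - 1) ^ card T\<close> over the
  semistable supports \<open>T\<close> (lemma \<open>K0_class_support_locus\<close>). Enlarging \<open>T\<close> leaves fewer
  subrepresentations, so the semistable supports form an upward closed family and the locus is open.
  The torus of points with a minimal support is closed in the locus, and removing these tori one
  after the other gives the sum. The class of an \<open>n\<close>-dimensional torus is \<open>(L - 1) ^ n\<close>: applied to
  all of affine space, the same decomposition determines it from \<open>L ^ n\<close> by inclusion and exclusion.
\<close>

section \<open>Quasi-affine spaces of functions\<close>

text \<open>
  For open \<open>U\<close> both clauses describe the structure that affine space induces on \<open>S\<close>, without reference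
  to the affine space or to the chain of subsets through which it was induced. Two spaces with this
  property for the same \<open>S\<close> are isomorphic, which replaces all bookkeeping about induced structures.
\<close>

definition quasi_affine :: "('i \<Rightarrow> complex) fun_space \<Rightarrow> ('i \<Rightarrow> complex) set \<Rightarrow> bool" where
  "quasi_affine X S \<longleftrightarrow>
     (\<forall>U. openin (zariski X) U \<longleftrightarrow>
        U \<subseteq> S \<and> (\<forall>x\<in>U. \<exists>h\<in>poly_funs. h x \<noteq> 0 \<and> {y\<in>S. h y \<noteq> 0} \<subseteq> U)) \<and>
     (\<forall>U f. openin (zariski X) U \<longrightarrow> (f \<in> regular X U \<longleftrightarrow>
        (\<forall>x\<in>U. \<exists>g\<in>poly_funs. \<exists>h\<in>poly_funs. h x \<noteq> 0 \<and> (\<forall>y\<in>U. h y \<noteq> 0 \<longrightarrow> f y = g y / h y))))"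

lemma quasi_affine_openin:
  assumes "quasi_affine X S"
  shows "openin (zariski X) U \<longleftrightarrow>
    U \<subseteq> S \<and> (\<forall>x\<in>U. \<exists>h\<in>poly_funs. h x \<noteq> 0 \<and> {y\<in>S. h y \<noteq> 0} \<subseteq> U)"
  using assms unfolding quasi_affine_def by blast

lemma quasi_affine_regular:
  assumes "quasi_affine X S" "openin (zariski X) U"
  shows "f \<in> regular X U \<longleftrightarrow>
    (\<forall>x\<in>U. \<exists>g\<in>poly_funs. \<exists>h\<in>poly_funs. h x \<noteq> 0 \<and> (\<forall>y\<in>U. h y \<noteq> 0 \<longrightarrow> f y = g y / h y))"
  using assms unfolding quasi_affine_def by blast

lemma quasi_affine_points:
  assumes "quasi_affine X S"
  shows "points X = S"
proof
  show "points X \<subseteq> S" using quasi_affine_openin[OF assms, of "points X"] by blast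
  have "openin (zariski X) S"
    unfolding quasi_affine_openin[OF assms] by (auto intro!: bexI[of _ "\<lambda>_. 1"] poly_funs.const)
  then show "S \<subseteq> points X" by (rule openin_subset)
qed

lemma quasi_affine_open_self: "quasi_affine X S \<Longrightarrow> openin (zariski X) S"
  using quasi_affine_points by (metis openin_topspace)

lemma quasi_affine_principal_open:
  assumes "quasi_affine X S" "h \<in> poly_funs"
  shows "openin (zariski X) {y\<in>S. h y \<noteq> 0}"
  unfolding quasi_affine_openin[OF assms(1)] using assms(2) by blast

lemma quasi_affine_quotient_regular:
  assumes "quasi_affine X S" "openin (zariski X) U" "g \<in> poly_funs" "h \<in> poly_funs"
    and "\<And>x. x \<in> U \<Longrightarrow> h x \<noteq> 0"
  shows "(\<lambda>x. g x / h x) \<in> regular X U"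
  unfolding quasi_affine_regular[OF assms(1,2)] using assms by blast

lemma quasi_affine_polynomial_regular:
  assumes "quasi_affine X S" "openin (zariski X) U" "g \<in> poly_funs"
  shows "g \<in> regular X U"
  using quasi_affine_quotient_regular[OF assms poly_funs.const[of 1]] by simp

text \<open>
  Principal open sets are closed under finite intersections, so every set generated by them is a
  union of principal open sets.
\<close>

lemma quasi_affine_affine_space:
  "quasi_affine (affine_space I :: ('i \<Rightarrow> complex) fun_space) (affine_points I)"
proof -
  let ?S = "affine_points I :: ('i \<Rightarrow> complex) set"
  let ?B = "{{x \<in> ?S. h x \<noteq> 0} |h. h \<in> poly_funs}"
  have op: "openin (zariski (affine_space I)) U \<longleftrightarrow>
        U \<subseteq> ?S \<and> (\<forall>x\<in>U. \<exists>h\<in>poly_funs. h x \<noteq> 0 \<and> {y\<in>?S. h y \<noteq> 0} \<subseteq> U)" for U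
  proof
    assume "openin (zariski (affine_space I)) U"
    then have "generate_topology_on ?B U"
      by (simp add: affine_space_def openin_topology_generated_by)
    then show "U \<subseteq> ?S \<and> (\<forall>x\<in>U. \<exists>h\<in>poly_funs. h x \<noteq> 0 \<and> {y\<in>?S. h y \<noteq> 0} \<subseteq> U)"
    proof induction
      case (Int a b)
      have "\<exists>h\<in>poly_funs. h x \<noteq> 0 \<and> {y\<in>?S. h y \<noteq> 0} \<subseteq> a \<inter> b" if x: "x \<in> a \<inter> b" for x
      proof -
        from x Int.IH obtain h1 h2 where "h1\<in>poly_funs" "h1 x \<noteq> 0" "{y\<in>?S. h1 y \<noteq> 0} \<subseteq> a"
          "h2\<in>poly_funs" "h2 x \<noteq> 0" "{y\<in>?S. h2 y \<noteq> 0} \<subseteq> b" by blast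
        then show ?thesis
          by (intro bexI[of _ "\<lambda>x. h1 x * h2 x"]) (auto intro: poly_funs.mult)
      qed
      then show ?case using Int.IH by blast
    next
      case (UN K)
      have "\<exists>h\<in>poly_funs. h x \<noteq> 0 \<and> {y\<in>?S. h y \<noteq> 0} \<subseteq> \<Union>K" if x: "x \<in> \<Union>K" for x
      proof -
        from x UN.IH obtain k h where "k \<in> K" "h\<in>poly_funs" "h x \<noteq> 0" "{y\<in>?S. h y \<noteq> 0} \<subseteq> k"
          by blast
        then show ?thesis by blast
      qed
      then show ?case using UN.IH by blast
    qed auto
  next
    assume U: "U \<subseteq> ?S \<and> (\<forall>x\<in>U. \<exists>h\<in>poly_funs. h x \<noteq> 0 \<and> {y\<in>?S. h y \<noteq> 0} \<subseteq> U)"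
    have "\<exists>T. openin (zariski (affine_space I)) T \<and> x \<in> T \<and> T \<subseteq> U" if x: "x \<in> U" for x
    proof -
      from x U obtain h where h: "h\<in>poly_funs" "h x \<noteq> 0" "{y\<in>?S. h y \<noteq> 0} \<subseteq> U" by blast
      have "openin (zariski (affine_space I)) {y\<in>?S. h y \<noteq> 0}"
        using h(1) by (auto simp: affine_space_def intro!: topology_generated_by_Basis)
      with h x U show ?thesis by blast
    qed
    then show "openin (zariski (affine_space I)) U" by (subst openin_subopen) blast
  qed
  show ?thesis unfolding quasi_affine_def
    by (intro conjI allI impI op) (simp add: affine_space_def)
qed

text \<open>
  On a neighbourhood of a point a regular function of the subspace extends to a quotient \<open>g1 / h1\<close>
  on an open set of \<open>X\<close>. Multiplying numerator and denominator by a polynomial \<open>k\<close> whose principal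
  open set lies in that neighbourhood gives a formula that is valid wherever its denominator does
  not vanish, as the definition demands.
\<close>

lemma quasi_affine_induced:
  assumes X: "quasi_affine X S" and T: "T \<subseteq> S"
  shows "quasi_affine (induced X T) T"
proof -
  have op: "openin (zariski (induced X T)) U \<longleftrightarrow>
        U \<subseteq> T \<and> (\<forall>x\<in>U. \<exists>h\<in>poly_funs. h x \<noteq> 0 \<and> {y\<in>T. h y \<noteq> 0} \<subseteq> U)" for U
  proof
    assume "openin (zariski (induced X T)) U"
    then obtain W where W: "openin (zariski X) W" "U = W \<inter> T"
      by (auto simp: induced_def openin_subtopology)
    show "U \<subseteq> T \<and> (\<forall>x\<in>U. \<exists>h\<in>poly_funs. h x \<noteq> 0 \<and> {y\<in>T. h y \<noteq> 0} \<subseteq> U)"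
    proof (intro conjI ballI)
      fix x assume "x \<in> U"
      then obtain h where "h\<in>poly_funs" "h x \<noteq> 0" "{y\<in>S. h y \<noteq> 0} \<subseteq> W"
        using W unfolding quasi_affine_openin[OF X] by blast
      then show "\<exists>h\<in>poly_funs. h x \<noteq> 0 \<and> {y\<in>T. h y \<noteq> 0} \<subseteq> U" using W T by blast
    qed (use W in auto)
  next
    assume U: "U \<subseteq> T \<and> (\<forall>x\<in>U. \<exists>h\<in>poly_funs. h x \<noteq> 0 \<and> {y\<in>T. h y \<noteq> 0} \<subseteq> U)"
    let ?W = "\<Union>{{y\<in>S. h y \<noteq> 0} |h. h \<in> poly_funs \<and> {y\<in>T. h y \<noteq> 0} \<subseteq> U}"
    have "openin (zariski X) ?W"
      using quasi_affine_principal_open[OF X] by (intro openin_Union) auto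
    moreover have "U = ?W \<inter> T" using U T by blast
    ultimately show "openin (zariski (induced X T)) U"
      by (auto simp: induced_def openin_subtopology)
  qed
  have "f \<in> regular (induced X T) U \<longleftrightarrow>
    (\<forall>x\<in>U. \<exists>g\<in>poly_funs. \<exists>h\<in>poly_funs. h x \<noteq> 0 \<and> (\<forall>y\<in>U. h y \<noteq> 0 \<longrightarrow> f y = g y / h y))"
    if U: "openin (zariski (induced X T)) U" for U f
  proof
    assume f: "f \<in> regular (induced X T) U"
    show "\<forall>x\<in>U. \<exists>g\<in>poly_funs. \<exists>h\<in>poly_funs. h x \<noteq> 0 \<and> (\<forall>y\<in>U. h y \<noteq> 0 \<longrightarrow> f y = g y / h y)"
    proof
      fix x assume x: "x \<in> U"
      then obtain W g where W: "openin (zariski X) W" "x \<in> W" "g \<in> regular X W"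
        "\<forall>y \<in> U \<inter> W. f y = g y"
        using f by (auto simp: induced_def)
      obtain g1 h1 where g1: "g1\<in>poly_funs" "h1\<in>poly_funs" "h1 x \<noteq> 0"
        "\<forall>y\<in>W. h1 y \<noteq> 0 \<longrightarrow> g y = g1 y / h1 y"
        using W(2,3) unfolding quasi_affine_regular[OF X W(1)] by blast
      obtain k where k: "k\<in>poly_funs" "k x \<noteq> 0" "{y\<in>S. k y \<noteq> 0} \<subseteq> W"
        using W(1,2) unfolding quasi_affine_openin[OF X] by blast
      have US: "U \<subseteq> S" using U T unfolding op by blast
      show "\<exists>g\<in>poly_funs. \<exists>h\<in>poly_funs. h x \<noteq> 0 \<and> (\<forall>y\<in>U. h y \<noteq> 0 \<longrightarrow> f y = g y / h y)"
        using g1 k W(4) US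
        by (intro bexI[of _ "\<lambda>y. g1 y * k y"] bexI[of _ "\<lambda>y. h1 y * k y"])
          (auto intro: poly_funs.mult)
    qed
  next
    assume f: "\<forall>x\<in>U. \<exists>g\<in>poly_funs. \<exists>h\<in>poly_funs. h x \<noteq> 0 \<and>
      (\<forall>y\<in>U. h y \<noteq> 0 \<longrightarrow> f y = g y / h y)"
    have "\<exists>W g. openin (zariski X) W \<and> x \<in> W \<and> g \<in> regular X W \<and> (\<forall>y \<in> U \<inter> W. f y = g y)"
      if x: "x \<in> U" for x
    proof -
      obtain g h where gh: "g\<in>poly_funs" "h\<in>poly_funs" "h x \<noteq> 0"
        "\<forall>y\<in>U. h y \<noteq> 0 \<longrightarrow> f y = g y / h y" using f x by blast
      let ?W = "{y\<in>S. h y \<noteq> 0}"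
      have W: "openin (zariski X) ?W" by (rule quasi_affine_principal_open[OF X gh(2)])
      have "(\<lambda>y. g y / h y) \<in> regular X ?W"
        by (rule quasi_affine_quotient_regular[OF X W gh(1,2)]) simp
      moreover have "x \<in> ?W" using x U T gh(3) unfolding op by blast
      ultimately show ?thesis using W gh(4) by blast
    qed
    then show "f \<in> regular (induced X T) U" by (simp add: induced_def)
  qed
  then show ?thesis unfolding quasi_affine_def using op by blast
qed

lemma quasi_affine_induced_affine_space:
  "T \<subseteq> affine_points I \<Longrightarrow> quasi_affine (induced (affine_space I) T) T"
  by (rule quasi_affine_induced[OF quasi_affine_affine_space])

lemma quasi_affine_function_sheaf:
  assumes X: "quasi_affine X S"
  shows "function_sheaf X"
  unfolding function_sheaf_def
proof (intro conjI allI impI; elim conjE)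
  fix U f g assume U: "openin (zariski X) U" and f: "f \<in> regular X U" and eq: "\<forall>x\<in>U. g x = f x"
  show "g \<in> regular X U"
    using f eq unfolding quasi_affine_regular[OF X U] by simp
next
  fix U V f assume U: "openin (zariski X) U" and V: "openin (zariski X) V" and VU: "V \<subseteq> U"
    and f: "f \<in> regular X U"
  show "f \<in> regular X V"
    unfolding quasi_affine_regular[OF X V]
  proof
    fix x assume "x \<in> V"
    then obtain g h where "g\<in>poly_funs" "h\<in>poly_funs" "h x \<noteq> 0"
      "\<forall>y\<in>U. h y \<noteq> 0 \<longrightarrow> f y = g y / h y"
      using f VU unfolding quasi_affine_regular[OF X U] by blast
    then show "\<exists>g\<in>poly_funs. \<exists>h\<in>poly_funs. h x \<noteq> 0 \<and> (\<forall>y\<in>V. h y \<noteq> 0 \<longrightarrow> f y = g y / h y)"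
      using VU by blast
  qed
next
  fix U f assume U: "openin (zariski X) U"
    and loc: "\<forall>x\<in>U. \<exists>V. openin (zariski X) V \<and> x \<in> V \<and> V \<subseteq> U \<and> f \<in> regular X V"
  show "f \<in> regular X U"
    unfolding quasi_affine_regular[OF X U]
  proof
    fix x assume x: "x \<in> U"
    then obtain V where V: "openin (zariski X) V" "x \<in> V" "V \<subseteq> U" "f \<in> regular X V"
      using loc by blast
    obtain g h where gh: "g\<in>poly_funs" "h\<in>poly_funs" "h x \<noteq> 0"
      "\<forall>y\<in>V. h y \<noteq> 0 \<longrightarrow> f y = g y / h y"
      using V unfolding quasi_affine_regular[OF X V(1)] by blast
    obtain k where k: "k\<in>poly_funs" "k x \<noteq> 0" "{y\<in>S. k y \<noteq> 0} \<subseteq> V"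
      using V(1,2) unfolding quasi_affine_openin[OF X] by blast
    have "U \<subseteq> S" using U unfolding quasi_affine_openin[OF X] by blast
    then show "\<exists>g\<in>poly_funs. \<exists>h\<in>poly_funs. h x \<noteq> 0 \<and> (\<forall>y\<in>U. h y \<noteq> 0 \<longrightarrow> f y = g y / h y)"
      using gh k
      by (intro bexI[of _ "\<lambda>y. g y * k y"] bexI[of _ "\<lambda>y. h y * k y"])
        (auto intro: poly_funs.mult)
  qed
qed

lemma regular_restrict:
  assumes "function_sheaf X" "openin (zariski X) U" "openin (zariski X) V" "V \<subseteq> U" "f \<in> regular X U"
  shows "f \<in> regular X V"
  by (rule assms(1)[unfolded function_sheaf_def, THEN conjunct2, THEN conjunct1, rule_format, of U V f])
    (intro conjI assms)

lemma regular_cong: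
  assumes "function_sheaf X" "openin (zariski X) U" "f \<in> regular X U" "\<And>x. x \<in> U \<Longrightarrow> g x = f x"
  shows "g \<in> regular X U"
  by (rule assms(1)[unfolded function_sheaf_def, THEN conjunct1, rule_format, of U f])
    (intro conjI assms ballI; assumption)

lemma regular_local:
  assumes "function_sheaf X" "openin (zariski X) U"
    and "\<And>x. x \<in> U \<Longrightarrow> \<exists>V. openin (zariski X) V \<and> x \<in> V \<and> V \<subseteq> U \<and> f \<in> regular X V"
  shows "f \<in> regular X U"
  by (rule assms(1)[unfolded function_sheaf_def, THEN conjunct2, THEN conjunct2, rule_format])
    (intro conjI assms ballI; assumption)

section \<open>Regular functions and morphisms\<close>

lemma quasi_affine_regular_add:
  assumes X: "quasi_affine X S" and U: "openin (zariski X) U"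
    and f: "f1 \<in> regular X U" "f2 \<in> regular X U"
  shows "(\<lambda>x. f1 x + f2 x) \<in> regular X U"
  unfolding quasi_affine_regular[OF X U]
proof
  fix x assume x: "x \<in> U"
  from f x obtain g1 h1 g2 h2 where
    "g1\<in>poly_funs" "h1\<in>poly_funs" "h1 x \<noteq> 0" "\<forall>y\<in>U. h1 y \<noteq> 0 \<longrightarrow> f1 y = g1 y / h1 y"
    "g2\<in>poly_funs" "h2\<in>poly_funs" "h2 x \<noteq> 0" "\<forall>y\<in>U. h2 y \<noteq> 0 \<longrightarrow> f2 y = g2 y / h2 y"
    unfolding quasi_affine_regular[OF X U] by blast
  then show "\<exists>g\<in>poly_funs. \<exists>h\<in>poly_funs. h x \<noteq> 0 \<and> (\<forall>y\<in>U. h y \<noteq> 0 \<longrightarrow> f1 y + f2 y = g y / h y)"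
    by (intro bexI[of _ "\<lambda>y. g1 y * h2 y + g2 y * h1 y"] bexI[of _ "\<lambda>y. h1 y * h2 y"])
      (auto intro!: poly_funs.mult poly_funs.add simp: field_simps)
qed

lemma quasi_affine_regular_mult:
  assumes X: "quasi_affine X S" and U: "openin (zariski X) U"
    and f: "f1 \<in> regular X U" "f2 \<in> regular X U"
  shows "(\<lambda>x. f1 x * f2 x) \<in> regular X U"
  unfolding quasi_affine_regular[OF X U]
proof
  fix x assume x: "x \<in> U"
  from f x obtain g1 h1 g2 h2 where
    "g1\<in>poly_funs" "h1\<in>poly_funs" "h1 x \<noteq> 0" "\<forall>y\<in>U. h1 y \<noteq> 0 \<longrightarrow> f1 y = g1 y / h1 y"
    "g2\<in>poly_funs" "h2\<in>poly_funs" "h2 x \<noteq> 0" "\<forall>y\<in>U. h2 y \<noteq> 0 \<longrightarrow> f2 y = g2 y / h2 y"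
    unfolding quasi_affine_regular[OF X U] by blast
  then show "\<exists>g\<in>poly_funs. \<exists>h\<in>poly_funs. h x \<noteq> 0 \<and> (\<forall>y\<in>U. h y \<noteq> 0 \<longrightarrow> f1 y * f2 y = g y / h y)"
    by (intro bexI[of _ "\<lambda>y. g1 y * g2 y"] bexI[of _ "\<lambda>y. h1 y * h2 y"])
      (auto intro!: poly_funs.mult)
qed

lemma quasi_affine_regular_divide:
  assumes X: "quasi_affine X S" and U: "openin (zariski X) U"
    and f: "f1 \<in> regular X U" "f2 \<in> regular X U" and nz: "\<And>x. x \<in> U \<Longrightarrow> f2 x \<noteq> 0"
  shows "(\<lambda>x. f1 x / f2 x) \<in> regular X U"
  unfolding quasi_affine_regular[OF X U]
proof
  fix x assume x: "x \<in> U"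
  from f x obtain g1 h1 g2 h2 where
    "g1\<in>poly_funs" "h1\<in>poly_funs" "h1 x \<noteq> 0" "\<forall>y\<in>U. h1 y \<noteq> 0 \<longrightarrow> f1 y = g1 y / h1 y"
    "g2\<in>poly_funs" "h2\<in>poly_funs" "h2 x \<noteq> 0" "\<forall>y\<in>U. h2 y \<noteq> 0 \<longrightarrow> f2 y = g2 y / h2 y"
    unfolding quasi_affine_regular[OF X U] by blast
  moreover from this have "g2 x \<noteq> 0" using nz x by force
  ultimately show "\<exists>g\<in>poly_funs. \<exists>h\<in>poly_funs. h x \<noteq> 0 \<and>
      (\<forall>y\<in>U. h y \<noteq> 0 \<longrightarrow> f1 y / f2 y = g y / h y)"
    by (intro bexI[of _ "\<lambda>y. g1 y * h2 y * h2 y"] bexI[of _ "\<lambda>y. h1 y * g2 y * h2 y"])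
      (auto intro!: poly_funs.mult)
qed

lemma quasi_affine_regular_sum:
  assumes X: "quasi_affine X S" and U: "openin (zariski X) U"
    and f: "\<And>i. i \<in> I \<Longrightarrow> f i \<in> regular X U"
  shows "(\<lambda>x. \<Sum>i\<in>I. f i x) \<in> regular X U"
  using f
proof (induction I rule: infinite_finite_induct)
  case (insert i I)
  then show ?case using quasi_affine_regular_add[OF X U, of "f i"] by simp
qed (use quasi_affine_polynomial_regular[OF X U poly_funs.const] in auto)

lemma quasi_affine_nonvanishing_open:
  assumes X: "quasi_affine X S" and U: "openin (zariski X) U" and f: "f \<in> regular X U"
  shows "openin (zariski X) {x\<in>U. f x \<noteq> 0}"
  unfolding quasi_affine_openin[OF X]
proof (intro conjI ballI)
  show "{x \<in> U. f x \<noteq> 0} \<subseteq> S" using U unfolding quasi_affine_openin[OF X] by blast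
  fix x assume x: "x \<in> {x \<in> U. f x \<noteq> 0}"
  obtain g h where gh: "g\<in>poly_funs" "h\<in>poly_funs" "h x \<noteq> 0"
      "\<forall>y\<in>U. h y \<noteq> 0 \<longrightarrow> f y = g y / h y"
    using x f unfolding quasi_affine_regular[OF X U] by blast
  obtain k where k: "k\<in>poly_funs" "k x \<noteq> 0" "{y\<in>S. k y \<noteq> 0} \<subseteq> U"
    using x U unfolding quasi_affine_openin[OF X] by blast
  show "\<exists>h\<in>poly_funs. h x \<noteq> 0 \<and> {y \<in> S. h y \<noteq> 0} \<subseteq> {x \<in> U. f x \<noteq> 0}"
    using gh k x
    by (intro bexI[of _ "\<lambda>y. g y * h y * k y"]) (auto intro!: poly_funs.mult)
qed

lemma poly_funs_regular_comp:
  assumes X: "quasi_affine X S" and U: "openin (zariski X) U"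
    and \<phi>: "\<And>j. (\<lambda>x. \<phi> x j) \<in> regular X U" and p: "p \<in> poly_funs"
  shows "(\<lambda>x. p (\<phi> x)) \<in> regular X U"
  using p
proof induction
  case (const c)
  show ?case by (rule quasi_affine_polynomial_regular[OF X U poly_funs.const])
next
  case (coord i)
  show ?case by (rule \<phi>)
next
  case (add f g)
  show ?case by (rule quasi_affine_regular_add[OF X U add.IH])
next
  case (mult f g)
  show ?case by (rule quasi_affine_regular_mult[OF X U mult.IH])
qed

text \<open>
  Polynomials in regular functions are regular, and the locus where a regular function does not
  vanish is open; both facts together make regular coordinates sufficient.
\<close>

lemma quasi_affine_morphism:
  assumes X: "quasi_affine X S" and Y: "quasi_affine Y T"
    and maps: "\<And>x. x \<in> S \<Longrightarrow> \<phi> x \<in> T"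
    and coord: "\<And>j. (\<lambda>x. \<phi> x j) \<in> regular X S"
  shows "morphism X Y \<phi>"
proof -
  have S: "openin (zariski X) S" by (rule quasi_affine_open_self[OF X])
  note comp = poly_funs_regular_comp[OF X S, of \<phi>, OF coord]
  have open_pre: "openin (zariski X) {x \<in> S. \<phi> x \<in> V}" if V: "openin (zariski Y) V" for V
  proof (subst openin_subopen, intro ballI)
    fix x assume "x \<in> {x \<in> S. \<phi> x \<in> V}"
    moreover then obtain h where h: "h\<in>poly_funs" "h (\<phi> x) \<noteq> 0" "{y\<in>T. h y \<noteq> 0} \<subseteq> V"
      using V unfolding quasi_affine_openin[OF Y] by blast
    moreover have "openin (zariski X) {x\<in>S. h (\<phi> x) \<noteq> 0}"
      by (rule quasi_affine_nonvanishing_open[OF X S comp[OF h(1)]])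
    moreover have "{x\<in>S. h (\<phi> x) \<noteq> 0} \<subseteq> {x \<in> S. \<phi> x \<in> V}"
      using h(3) maps by blast
    ultimately show "\<exists>W. openin (zariski X) W \<and> x \<in> W \<and> W \<subseteq> {x \<in> S. \<phi> x \<in> V}" by blast
  qed
  have "continuous_map (zariski X) (zariski Y) \<phi>"
    unfolding continuous_map_def quasi_affine_points[OF X] quasi_affine_points[OF Y]
    using maps open_pre by blast
  moreover have "g \<circ> \<phi> \<in> regular X {x \<in> S. \<phi> x \<in> V}"
    if V: "openin (zariski Y) V" and g: "g \<in> regular Y V" for V g
  proof -
    note sh = quasi_affine_function_sheaf[OF X]
    let ?U = "{x \<in> S. \<phi> x \<in> V}"
    have "\<exists>W. openin (zariski X) W \<and> x \<in> W \<and> W \<subseteq> ?U \<and> g \<circ> \<phi> \<in> regular X W" if x: "x \<in> ?U" for x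
    proof -
      obtain g1 h1 where g1: "g1\<in>poly_funs" "h1\<in>poly_funs" "h1 (\<phi> x) \<noteq> 0"
        "\<forall>y\<in>V. h1 y \<noteq> 0 \<longrightarrow> g y = g1 y / h1 y"
        using g x unfolding quasi_affine_regular[OF Y V] by blast
      let ?W = "{x\<in>S. h1 (\<phi> x) \<noteq> 0} \<inter> ?U"
      have W: "openin (zariski X) ?W"
        by (intro openin_Int open_pre[OF V] quasi_affine_nonvanishing_open[OF X S comp[OF g1(2)]])
      have "g1 \<circ> \<phi> \<in> regular X ?W" "h1 \<circ> \<phi> \<in> regular X ?W"
        using comp[OF g1(1)] comp[OF g1(2)] regular_restrict[OF sh S W] by (auto simp: o_def)
      from quasi_affine_regular_divide[OF X W this]
      have "(\<lambda>x. (g1 \<circ> \<phi>) x / (h1 \<circ> \<phi>) x) \<in> regular X ?W" by auto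
      from regular_cong[OF sh W this, of "g \<circ> \<phi>"]
      have "g \<circ> \<phi> \<in> regular X ?W" using g1(4) by simp
      with W x g1(3) show ?thesis by blast
    qed
    then show ?thesis by (rule regular_local[OF sh open_pre[OF V]])
  qed
  ultimately show ?thesis unfolding morphism_def quasi_affine_points[OF X] by blast
qed

lemma isomorphicI:
  assumes "morphism X Y \<phi>" "morphism Y X \<psi>"
    and "\<And>x. x \<in> points X \<Longrightarrow> \<psi> (\<phi> x) = x" "\<And>y. y \<in> points Y \<Longrightarrow> \<phi> (\<psi> y) = y"
  shows "isomorphic X Y"
  unfolding isomorphic_def using assms by blast

lemma isomorphic_sym: "isomorphic X Y \<Longrightarrow> isomorphic Y X"
  unfolding isomorphic_def by blast

lemma morphism_compose:
  assumes f: "morphism X Y f" and g: "morphism Y Z g"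
  shows "morphism X Z (g \<circ> f)"
proof -
  have cf: "continuous_map (zariski X) (zariski Y) f" and cg: "continuous_map (zariski Y) (zariski Z) g"
    using f g unfolding morphism_def by blast+
  have "(h \<circ> g) \<circ> f \<in> regular X {x \<in> points X. g (f x) \<in> V}"
    if V: "openin (zariski Z) V" "h \<in> regular Z V" for V h
  proof -
    let ?W = "{y \<in> points Y. g y \<in> V}"
    have "openin (zariski Y) ?W" using cg V by (auto simp: continuous_map_def)
    moreover have "h \<circ> g \<in> regular Y ?W" using g V unfolding morphism_def by blast
    ultimately have "(h \<circ> g) \<circ> f \<in> regular X {x \<in> points X. f x \<in> ?W}"
      using f unfolding morphism_def by blast
    moreover have "{x \<in> points X. f x \<in> ?W} = {x \<in> points X. g (f x) \<in> V}"
      using cf by (auto simp: continuous_map_def)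
    ultimately show ?thesis by simp
  qed
  then show ?thesis unfolding morphism_def using continuous_map_compose[OF cf cg]
    by (auto simp: o_assoc)
qed

lemma isomorphic_trans:
  assumes "isomorphic X Y" "isomorphic Y Z"
  shows "isomorphic X Z"
proof -
  from assms obtain a b c d where m: "morphism X Y a" "morphism Y X b" "morphism Y Z c" "morphism Z Y d"
    and i: "\<forall>x\<in>points X. b (a x) = x" "\<forall>x\<in>points Y. a (b x) = x"
      "\<forall>x\<in>points Y. d (c x) = x" "\<forall>x\<in>points Z. c (d x) = x" unfolding isomorphic_def by blast
  have "a x \<in> points Y" if "x \<in> points X" for x
    using m(1) that by (auto simp: morphism_def continuous_map_def)
  moreover have "d x \<in> points Y" if "x \<in> points Z" for x
    using m(4) that by (auto simp: morphism_def continuous_map_def)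
  ultimately show ?thesis unfolding isomorphic_def
    using morphism_compose[OF m(1,3)] morphism_compose[OF m(4,2)] i
    by (intro exI[of _ "c \<circ> a"] exI[of _ "b \<circ> d"]) simp
qed

lemma quasi_affine_isomorphic:
  assumes X: "quasi_affine X S" and Y: "quasi_affine Y T"
    and "\<And>x. x \<in> S \<Longrightarrow> \<phi> x \<in> T" "\<And>j. (\<lambda>x. \<phi> x j) \<in> regular X S"
    and "\<And>y. y \<in> T \<Longrightarrow> \<psi> y \<in> S" "\<And>j. (\<lambda>y. \<psi> y j) \<in> regular Y T"
    and "\<And>x. x \<in> S \<Longrightarrow> \<psi> (\<phi> x) = x" "\<And>y. y \<in> T \<Longrightarrow> \<phi> (\<psi> y) = y"
  shows "isomorphic X Y"
  unfolding isomorphic_def quasi_affine_points[OF X] quasi_affine_points[OF Y]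
  using quasi_affine_morphism[OF X Y] quasi_affine_morphism[OF Y X] assms(3-) by blast

text \<open>
  The identity map has polynomial coordinates in both directions.
\<close>

lemma quasi_affine_unique:
  assumes X: "quasi_affine X S" and Y: "quasi_affine Y S"
  shows "isomorphic X Y"
proof -
  have "openin (zariski X) S" "openin (zariski Y) S"
    by (rule quasi_affine_open_self[OF X], rule quasi_affine_open_self[OF Y])
  then show ?thesis
    by (intro quasi_affine_isomorphic[OF X Y, of "\<lambda>x. x" "\<lambda>x. x"])
      (auto intro: quasi_affine_polynomial_regular[OF X] quasi_affine_polynomial_regular[OF Y]
         poly_funs.coord)
qed

section \<open>Quasi-affine varieties\<close>

lemma poly_funs_comp:
  assumes "p \<in> poly_funs" and "\<And>j. (\<lambda>x. \<phi> x j) \<in> poly_funs"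
  shows "(\<lambda>x. p (\<phi> x)) \<in> poly_funs"
  using assms(1) by induction (auto intro: poly_funs.intros assms(2))

lemma poly_funs_prod: "(\<And>i. i \<in> I \<Longrightarrow> f i \<in> poly_funs) \<Longrightarrow> (\<lambda>x. \<Prod>i\<in>I. f i x) \<in> poly_funs"
  by (induction I rule: infinite_finite_induct) (auto intro: poly_funs.intros)

lemma poly_funs_diff:
  assumes "f \<in> poly_funs" "g \<in> poly_funs"
  shows "(\<lambda>x. f x - g x) \<in> poly_funs"
  using poly_funs.add[OF assms(1) poly_funs.mult[OF poly_funs.const[of "-1"] assms(2)]] by simp

lemma poly_funs_if_coord: "(\<lambda>x. if b then x j else c) \<in> poly_funs"
  by (cases b) (auto intro: poly_funs.intros)

text \<open>
  The graph of \<open>1 / h\<close> is closed in affine space of one dimension more, being the zero set of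
  \<open>k\<close>. The new coordinate has index \<open>n\<close>; it is set to zero inside \<open>h\<close> because \<open>h\<close> may
  mention coordinates beyond the first \<open>n\<close>.
\<close>

lemma principal_open_affine_variety:
  assumes X: "quasi_affine X {x\<in>affine_points {..<n::nat}. h x \<noteq> 0}" and h: "h \<in> poly_funs"
  shows "affine_variety X"
proof -
  let ?D = "{x\<in>affine_points {..<n}. h x \<noteq> 0}"
  define k where "k x = x n * h (x(n := 0)) - 1" for x :: "nat \<Rightarrow> complex"
  define C where "C = {x\<in>affine_points {..<Suc n}. k x = 0}"
  have drop: "(\<lambda>x. (x(n := 0)) j) \<in> poly_funs" for j :: nat
    by (cases "j = n") (auto intro: poly_funs.intros)
  have k: "k \<in> poly_funs" unfolding k_def
    by (intro poly_funs_diff poly_funs.mult poly_funs.coord poly_funs_comp[OF h] drop poly_funs.const)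
  have C: "closedin (zariski (affine_space {..<Suc n})) C"
  proof -
    have "affine_points {..<Suc n} - C = {x\<in>affine_points {..<Suc n}. k x \<noteq> 0}"
      by (auto simp: C_def)
    then show ?thesis
      using quasi_affine_principal_open[OF quasi_affine_affine_space k, of "{..<Suc n}"]
        quasi_affine_points[OF quasi_affine_affine_space, of "{..<Suc n}"]
      unfolding closedin_def by (auto simp: C_def)
  qed
  have Y: "quasi_affine (induced (affine_space {..<Suc n}) C) C"
    by (rule quasi_affine_induced_affine_space) (auto simp: C_def)
  have S: "openin (zariski X) ?D" by (rule quasi_affine_open_self[OF X])
  have T: "openin (zariski (induced (affine_space {..<Suc n}) C)) C"
    by (rule quasi_affine_open_self[OF Y])
  have "isomorphic X (induced (affine_space {..<Suc n}) C)"
  proof (rule quasi_affine_isomorphic[OF X Y, of "\<lambda>x. x(n := 1 / h x)" "\<lambda>x. x(n := 0)"])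
    fix x assume x: "x \<in> ?D"
    then have xn: "x(n := 0) = x" by (auto simp: affine_points_def)
    show "x(n := 1 / h x) \<in> C" using x xn by (auto simp: C_def k_def affine_points_def)
    show "(x(n := 1 / h x))(n := 0) = x" using xn by simp
  next
    fix x assume x: "x \<in> C"
    then have eq: "x n * h (x(n := 0)) = 1" by (simp add: C_def k_def)
    then show "x(n := 0) \<in> ?D" using x by (auto simp: C_def affine_points_def)
    show "(x(n := 0))(n := 1 / h (x(n := 0))) = x"
      using eq by (metis fun_upd_triv fun_upd_upd mult_zero_right nonzero_eq_divide_eq zero_neq_one)
  next
    fix j
    show "(\<lambda>x. (x(n := 1 / h x)) j) \<in> regular X ?D"
      using quasi_affine_quotient_regular[OF X S poly_funs.const[of 1] h]
        quasi_affine_polynomial_regular[OF X S poly_funs.coord[of j]]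
      by (cases "j = n") auto
    show "(\<lambda>x. (x(n := 0)) j) \<in> regular (induced (affine_space {..<Suc n}) C) C"
      by (rule quasi_affine_polynomial_regular[OF Y T drop])
  qed
  with C show ?thesis unfolding affine_variety_def by blast
qed

lemma openin_product_space_basic:
  assumes "openin (zariski X) U" "openin (zariski Y) V" "h \<in> tensor_funs X Y U V"
  shows "openin (zariski (product_space X Y)) {z \<in> U \<times> V. h z \<noteq> 0}"
  unfolding product_space_def using assms by (auto intro!: topology_generated_by_Basis)

lemma tensor_funsI:
  assumes "\<And>i. i < n \<Longrightarrow> f i \<in> regular X U \<and> g i \<in> regular Y V"
    and "\<And>z. p z = (\<Sum>i<n::nat. f i (fst z) * g i (snd z))"
  shows "p \<in> tensor_funs X Y U V"
  using assms unfolding tensor_funs_def by blast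

lemma tensor_funs_prod:
  assumes "f \<in> regular X U" "g \<in> regular Y V"
  shows "(\<lambda>z. f (fst z) * g (snd z)) \<in> tensor_funs X Y U V"
  unfolding tensor_funs_def using assms
  by (auto intro!: exI[of _ "1::nat"] exI[of _ "\<lambda>_. f"] exI[of _ "\<lambda>_. g"])

lemma tensor_funs_add:
  assumes "p \<in> tensor_funs X Y U V" "q \<in> tensor_funs X Y U V"
  shows "(\<lambda>z. p z + q z) \<in> tensor_funs X Y U V"
proof -
  obtain f g and n :: nat where p: "p = (\<lambda>z. \<Sum>i<n. f i (fst z) * g i (snd z))"
    and pr: "\<forall>i<n. f i \<in> regular X U \<and> g i \<in> regular Y V"
    using assms(1) unfolding tensor_funs_def by blast
  obtain f' g' and m :: nat where q: "q = (\<lambda>z. \<Sum>i<m. f' i (fst z) * g' i (snd z))"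
    and qr: "\<forall>i<m. f' i \<in> regular X U \<and> g' i \<in> regular Y V"
    using assms(2) unfolding tensor_funs_def by blast
  \<comment> \<open>the two sums are concatenated\<close>
  let ?f = "\<lambda>i. if i < n then f i else f' (i - n)" and ?g = "\<lambda>i. if i < n then g i else g' (i - n)"
  have "p z + q z = (\<Sum>i<n+m. ?f i (fst z) * ?g i (snd z))" for z
  proof -
    have "(\<Sum>i<n+k. ?f i (fst z) * ?g i (snd z)) =
      (\<Sum>i<n. f i (fst z) * g i (snd z)) + (\<Sum>i<k. f' i (fst z) * g' i (snd z))" for k
      by (induction k) auto
    then show ?thesis by (simp add: p q)
  qed
  then show ?thesis
    using pr qr by (intro tensor_funsI[of "n + m" ?f _ _ ?g]) auto
qed

lemma tensor_funs_const:
  assumes X: "quasi_affine X S" and Y: "quasi_affine Y T"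
    and U: "openin (zariski X) U" and V: "openin (zariski Y) V"
  shows "(\<lambda>z. c) \<in> tensor_funs X Y U V"
  using tensor_funs_prod[OF quasi_affine_polynomial_regular[OF X U poly_funs.const[of c]]
    quasi_affine_polynomial_regular[OF Y V poly_funs.const[of 1]]] by simp

lemma tensor_funs_mult:
  assumes X: "quasi_affine X S" and Y: "quasi_affine Y T"
    and U: "openin (zariski X) U" and V: "openin (zariski Y) V"
    and p: "p \<in> tensor_funs X Y U V" and q: "q \<in> tensor_funs X Y U V"
  shows "(\<lambda>z. p z * q z) \<in> tensor_funs X Y U V"
proof -
  have *: "(\<lambda>z. f (fst z) * g (snd z) * q z) \<in> tensor_funs X Y U V"
    if "f \<in> regular X U" "g \<in> regular Y V" for f g
  proof -
    obtain f' g' and m :: nat where q: "q = (\<lambda>z. \<Sum>i<m. f' i (fst z) * g' i (snd z))"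
      and qr: "\<forall>i<m. f' i \<in> regular X U \<and> g' i \<in> regular Y V"
      using q unfolding tensor_funs_def by blast
    show ?thesis
    proof (rule tensor_funsI)
      fix i assume "i < m"
      then show "(\<lambda>x. f x * f' i x) \<in> regular X U \<and> (\<lambda>x. g x * g' i x) \<in> regular Y V"
        using that qr quasi_affine_regular_mult[OF X U] quasi_affine_regular_mult[OF Y V] by blast
    qed (simp add: q sum_distrib_left mult_ac)
  qed
  obtain f g and n :: nat where p: "p = (\<lambda>z. \<Sum>i<n. f i (fst z) * g i (snd z))"
    and pr: "\<forall>i<n. f i \<in> regular X U \<and> g i \<in> regular Y V"
    using p unfolding tensor_funs_def by blast
  have "(\<lambda>z. (\<Sum>i<k. f i (fst z) * g i (snd z)) * q z) \<in> tensor_funs X Y U V" if "k \<le> n" for k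
    using that
  proof (induction k)
    case 0
    show ?case using tensor_funs_const[OF X Y U V, of 0] by simp
  next
    case (Suc k)
    then show ?case using tensor_funs_add[OF Suc.IH *[of "f k" "g k"]] pr
      by (simp add: distrib_right)
  qed
  then show ?thesis by (simp add: p)
qed

lemma tensor_funs_poly_comp:
  assumes X: "quasi_affine X S" and Y: "quasi_affine Y T"
    and U: "openin (zariski X) U" and V: "openin (zariski Y) V"
    and \<psi>: "\<And>j. (\<lambda>z. \<psi> z j) \<in> tensor_funs X Y U V" and p: "p \<in> poly_funs"
  shows "(\<lambda>z. p (\<psi> z)) \<in> tensor_funs X Y U V"
  using p
proof induction
  case (const c)
  show ?case by (rule tensor_funs_const[OF X Y U V])
next
  case (coord i)
  show ?case by (rule \<psi>)
next
  case (add f g)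
  show ?case by (rule tensor_funs_add[OF add.IH])
next
  case (mult f g)
  show ?case by (rule tensor_funs_mult[OF X Y U V mult.IH])
qed

lemma points_product_space:
  assumes X: "quasi_affine X S" and Y: "quasi_affine Y T"
  shows "points (product_space X Y) = S \<times> T"
proof
  have S: "openin (zariski X) S" and T: "openin (zariski Y) T"
    by (rule quasi_affine_open_self[OF X], rule quasi_affine_open_self[OF Y])
  show "points (product_space X Y) \<subseteq> S \<times> T"
    using openin_subset[of "zariski X"] openin_subset[of "zariski Y"]
    unfolding quasi_affine_points[OF X] quasi_affine_points[OF Y]
    by (fastforce simp: product_space_def)
  show "S \<times> T \<subseteq> points (product_space X Y)"
    using openin_subset[OF openin_product_space_basic[OF S T tensor_funs_const[OF X Y S T, of 1]]]
    by simp
qed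

text \<open>
  The sums \<open>\<Sum>i. f i x * g i y\<close> form a ring, so if the coordinates of a map are of this form, then so
  are all polynomials in them. Quotients and nonvanishing loci of such sums define the product.
\<close>

lemma morphism_from_product:
  assumes X: "quasi_affine X S" and Y: "quasi_affine Y T" and W: "quasi_affine W R"
    and maps: "\<And>z. z \<in> S \<times> T \<Longrightarrow> \<psi> z \<in> R"
    and coord: "\<And>j. (\<lambda>z. \<psi> z j) \<in> tensor_funs X Y S T"
  shows "morphism (product_space X Y) W \<psi>"
proof -
  have S: "openin (zariski X) S" and T: "openin (zariski Y) T"
    by (rule quasi_affine_open_self[OF X], rule quasi_affine_open_self[OF Y])
  note comp = tensor_funs_poly_comp[OF X Y S T, of \<psi>, OF coord]
  have "openin (zariski (product_space X Y)) {z \<in> S \<times> T. \<psi> z \<in> V}"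
    if V: "openin (zariski W) V" for V
  proof (subst openin_subopen, intro ballI)
    fix z assume z: "z \<in> {z \<in> S \<times> T. \<psi> z \<in> V}"
    then obtain h where h: "h\<in>poly_funs" "h (\<psi> z) \<noteq> 0" "{y\<in>R. h y \<noteq> 0} \<subseteq> V"
      using V unfolding quasi_affine_openin[OF W] by blast
    have "openin (zariski (product_space X Y)) {z \<in> S \<times> T. h (\<psi> z) \<noteq> 0}"
      by (rule openin_product_space_basic[OF S T comp[OF h(1)]])
    moreover have "{z \<in> S \<times> T. h (\<psi> z) \<noteq> 0} \<subseteq> {z \<in> S \<times> T. \<psi> z \<in> V}"
      using h(3) maps by blast
    ultimately show "\<exists>N. openin (zariski (product_space X Y)) N \<and> z \<in> N \<and> N \<subseteq> {z \<in> S \<times> T. \<psi> z \<in> V}"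
      using h(2) z by blast
  qed
  then have "continuous_map (zariski (product_space X Y)) (zariski W) \<psi>"
    unfolding continuous_map_def points_product_space[OF X Y] quasi_affine_points[OF W]
    using maps by blast
  moreover have "g \<circ> \<psi> \<in> regular (product_space X Y) {z \<in> S \<times> T. \<psi> z \<in> V}"
    if V: "openin (zariski W) V" and g: "g \<in> regular W V" for V g
  proof -
    have "\<exists>g'\<in>tensor_funs X Y S T. \<exists>h\<in>tensor_funs X Y S T. h z \<noteq> 0 \<and>
        (\<forall>w \<in> {z \<in> S \<times> T. \<psi> z \<in> V} \<inter> S \<times> T. h w \<noteq> 0 \<longrightarrow> (g \<circ> \<psi>) w = g' w / h w)"
      if z: "z \<in> {z \<in> S \<times> T. \<psi> z \<in> V}" for z
    proof -
      obtain g1 h1 where g1: "g1\<in>poly_funs" "h1\<in>poly_funs" "h1 (\<psi> z) \<noteq> 0"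
        "\<forall>y\<in>V. h1 y \<noteq> 0 \<longrightarrow> g y = g1 y / h1 y"
        using g z unfolding quasi_affine_regular[OF W V] by blast
      then show ?thesis
        by (intro bexI[OF _ comp[OF g1(1)]] bexI[OF _ comp[OF g1(2)]]) auto
    qed
    note local = this
    show ?thesis unfolding product_space_def fun_space.simps mem_Collect_eq
    proof
      fix z assume z: "z \<in> {z \<in> S \<times> T. \<psi> z \<in> V}"
      show "\<exists>U V'. openin (zariski X) U \<and> openin (zariski Y) V' \<and> z \<in> U \<times> V' \<and>
         (\<exists>g'\<in>tensor_funs X Y U V'. \<exists>h\<in>tensor_funs X Y U V'. h z \<noteq> 0 \<and>
         (\<forall>w \<in> {z \<in> S \<times> T. \<psi> z \<in> V} \<inter> U \<times> V'. h w \<noteq> 0 \<longrightarrow> (g \<circ> \<psi>) w = g' w / h w))"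
        by (rule exI[of _ S], rule exI[of _ T], intro conjI S T local[OF z]) (use z in simp)
    qed
  qed
  ultimately show ?thesis unfolding morphism_def points_product_space[OF X Y] by blast
qed

text \<open>
  Along \<open>(a, b)\<close> a sum of products \<open>f i x * g i y\<close> becomes a sum of products of regular functions.
\<close>

lemma tensor_funs_pullback:
  assumes X: "quasi_affine X S" and a: "morphism X Y a" and b: "morphism X Z b"
    and U: "openin (zariski Y) U" and V: "openin (zariski Z) V" and h: "h \<in> tensor_funs Y Z U V"
  shows "(\<lambda>x. h (a x, b x)) \<in> regular X {x \<in> S. a x \<in> U \<and> b x \<in> V}"
    and "openin (zariski X) {x \<in> S. a x \<in> U \<and> b x \<in> V}"
proof -
  let ?N = "{x \<in> S. a x \<in> U \<and> b x \<in> V}"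
  have oa: "openin (zariski X) {x \<in> S. a x \<in> U}" and ob: "openin (zariski X) {x \<in> S. b x \<in> V}"
    using a b U V unfolding morphism_def continuous_map_def quasi_affine_points[OF X] by auto
  have "?N = {x \<in> S. a x \<in> U} \<inter> {x \<in> S. b x \<in> V}" by blast
  then show O: "openin (zariski X) ?N" using openin_Int[OF oa ob] by (simp only:)
  obtain f g and n :: nat where p: "h = (\<lambda>z. \<Sum>i<n. f i (fst z) * g i (snd z))"
    and pr: "\<forall>i<n. f i \<in> regular Y U \<and> g i \<in> regular Z V"
    using h unfolding tensor_funs_def by blast
  note sh = quasi_affine_function_sheaf[OF X]
  have "(\<lambda>x. f i (a x)) \<in> regular X ?N" "(\<lambda>x. g i (b x)) \<in> regular X ?N" if "i < n" for i
  proof -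
    have "f i \<circ> a \<in> regular X {x \<in> S. a x \<in> U}" "g i \<circ> b \<in> regular X {x \<in> S. b x \<in> V}"
      using a b U V pr that unfolding morphism_def quasi_affine_points[OF X] by blast+
    then show "(\<lambda>x. f i (a x)) \<in> regular X ?N" "(\<lambda>x. g i (b x)) \<in> regular X ?N"
      using regular_restrict[OF sh oa O] regular_restrict[OF sh ob O] by (auto simp: o_def)
  qed
  then show "(\<lambda>x. h (a x, b x)) \<in> regular X ?N"
    unfolding p by (auto intro!: quasi_affine_regular_sum[OF X O] quasi_affine_regular_mult[OF X O])
qed

lemma morphism_into_product:
  assumes X: "quasi_affine X S" and Y: "quasi_affine Y T" and Z: "quasi_affine Z R"
    and a: "morphism X Y a" and b: "morphism X Z b"
  shows "morphism X (product_space Y Z) (\<lambda>x. (a x, b x))"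
proof -
  let ?\<phi> = "\<lambda>x. (a x, b x)"
  have maps: "a x \<in> T" "b x \<in> R" if "x \<in> S" for x
    using a b that unfolding morphism_def continuous_map_def quasi_affine_points[OF X]
      quasi_affine_points[OF Y] quasi_affine_points[OF Z] by auto
  note pull = tensor_funs_pullback[OF X a b]
  note sh = quasi_affine_function_sheaf[OF X]
  have pre: "openin (zariski X) {x \<in> S. ?\<phi> x \<in> W}" if "openin (zariski (product_space Y Z)) W" for W
  proof -
    from that have "generate_topology_on {{z \<in> U \<times> V. h z \<noteq> 0} |U V h.
       openin (zariski Y) U \<and> openin (zariski Z) V \<and> h \<in> tensor_funs Y Z U V} W"
      by (simp add: product_space_def openin_topology_generated_by)
    then show ?thesis
    proof induction
      case (Int P Q)
      have "{x \<in> S. ?\<phi> x \<in> P \<inter> Q} = {x \<in> S. ?\<phi> x \<in> P} \<inter> {x \<in> S. ?\<phi> x \<in> Q}" by blast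
      then show ?case using openin_Int[OF Int.IH] by simp
    next
      case (UN K)
      have "{x \<in> S. ?\<phi> x \<in> \<Union>K} = \<Union>((\<lambda>k. {x \<in> S. ?\<phi> x \<in> k}) ` K)" by blast
      moreover have "openin (zariski X) (\<Union>((\<lambda>k. {x \<in> S. ?\<phi> x \<in> k}) ` K))"
        using UN.IH by (intro openin_Union) blast
      ultimately show ?case by (simp only:)
    next
      case (Basis W)
      then obtain U V h where h: "W = {z \<in> U \<times> V. h z \<noteq> 0}"
        "openin (zariski Y) U" "openin (zariski Z) V" "h \<in> tensor_funs Y Z U V" by blast
      have "{x \<in> S. ?\<phi> x \<in> W} = {x \<in> {x \<in> S. a x \<in> U \<and> b x \<in> V}. h (a x, b x) \<noteq> 0}"
        using h(1) by auto
      then show ?case using quasi_affine_nonvanishing_open[OF X pull(2,1)[OF h(2-4)]] by simp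
    qed auto
  qed
  have "continuous_map (zariski X) (zariski (product_space Y Z)) ?\<phi>"
    unfolding continuous_map_def points_product_space[OF Y Z] quasi_affine_points[OF X]
    using maps pre by auto
  moreover have "g \<circ> ?\<phi> \<in> regular X {x \<in> S. ?\<phi> x \<in> W}"
    if W: "openin (zariski (product_space Y Z)) W" and g: "g \<in> regular (product_space Y Z) W" for W g
  proof -
    have "\<exists>N. openin (zariski X) N \<and> x \<in> N \<and> N \<subseteq> {x \<in> S. ?\<phi> x \<in> W} \<and> g \<circ> ?\<phi> \<in> regular X N"
      if x: "x \<in> {x \<in> S. ?\<phi> x \<in> W}" for x
    proof -
      obtain U V g1 h1 where U: "openin (zariski Y) U" and V: "openin (zariski Z) V"
        and xU: "?\<phi> x \<in> U \<times> V" and g1: "g1\<in>tensor_funs Y Z U V" and h1: "h1\<in>tensor_funs Y Z U V"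
        and hx: "h1 (?\<phi> x) \<noteq> 0" and eq: "\<forall>w \<in> W \<inter> U \<times> V. h1 w \<noteq> 0 \<longrightarrow> g w = g1 w / h1 w"
        using g x unfolding product_space_def by force
      let ?P = "{x \<in> S. a x \<in> U \<and> b x \<in> V}"
      let ?N = "{x \<in> ?P. h1 (?\<phi> x) \<noteq> 0} \<inter> {x \<in> S. ?\<phi> x \<in> W}"
      have O: "openin (zariski X) ?N"
        by (intro openin_Int pre[OF W] quasi_affine_nonvanishing_open[OF X pull(2,1)[OF U V h1]])
      have "(\<lambda>x. g1 (?\<phi> x)) \<in> regular X ?N" "(\<lambda>x. h1 (?\<phi> x)) \<in> regular X ?N"
        using regular_restrict[OF sh pull(2)[OF U V g1] O _ pull(1)[OF U V g1]]
          regular_restrict[OF sh pull(2)[OF U V h1] O _ pull(1)[OF U V h1]] by auto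
      from quasi_affine_regular_divide[OF X O this]
      have "(\<lambda>x. g1 (?\<phi> x) / h1 (?\<phi> x)) \<in> regular X ?N" by auto
      from regular_cong[OF sh O this, of "g \<circ> ?\<phi>"]
      have "g \<circ> ?\<phi> \<in> regular X ?N" using eq by simp
      then show ?thesis using O hx xU x by blast
    qed
    then show ?thesis by (rule regular_local[OF sh pre[OF W]])
  qed
  ultimately show ?thesis unfolding morphism_def quasi_affine_points[OF X] by blast
qed

text \<open>
  This isomorphism turns the multiplicativity relation into the evaluation of affine spaces as
  powers of the Lefschetz motive.
\<close>

lemma affine_Suc_product:
  assumes X: "quasi_affine X (affine_points {..<n})" and Y: "quasi_affine Y (affine_points {0::nat})"
    and W: "quasi_affine W (affine_points {..<Suc n})"
  shows "isomorphic W (product_space X Y)"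
proof -
  let ?S = "affine_points {..<Suc n}" and ?T = "affine_points {..<n}"
    and ?R = "affine_points {0::nat}"
  let ?a = "\<lambda>x. x(n := 0)" and ?b = "\<lambda>x i. if i = (0::nat) then x n else 0"
  let ?\<psi> = "\<lambda>z::(nat \<Rightarrow> complex) \<times> (nat \<Rightarrow> complex). (fst z)(n := snd z 0)"
  have S: "openin (zariski W) ?S" and T: "openin (zariski X) ?T" and R: "openin (zariski Y) ?R"
    by (rule quasi_affine_open_self[OF W], rule quasi_affine_open_self[OF X],
      rule quasi_affine_open_self[OF Y])
  have poly: "(\<lambda>x. (?a x) j) \<in> poly_funs" "(\<lambda>x. ?b x j) \<in> poly_funs" for j
    by (cases "j = n"; auto intro: poly_funs.intros poly_funs_if_coord)+
  have "morphism W X ?a"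
    by (rule quasi_affine_morphism[OF W X _ quasi_affine_polynomial_regular[OF W S poly(1)]])
      (auto simp: affine_points_def)
  moreover have "morphism W Y ?b"
    by (rule quasi_affine_morphism[OF W Y _ quasi_affine_polynomial_regular[OF W S poly(2)]])
      (auto simp: affine_points_def)
  ultimately have 1: "morphism W (product_space X Y) (\<lambda>x. (?a x, ?b x))"
    by (rule morphism_into_product[OF W X Y])
  have 2: "morphism (product_space X Y) W ?\<psi>"
  proof (rule morphism_from_product[OF X Y W])
    fix j
    have "(\<lambda>z. (\<lambda>x. x j) (fst z) * (\<lambda>_. 1) (snd z)) \<in> tensor_funs X Y ?T ?R"
      "(\<lambda>z. (\<lambda>_. 1) (fst z) * (\<lambda>x. x 0) (snd z)) \<in> tensor_funs X Y ?T ?R"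
      by (intro tensor_funs_prod quasi_affine_polynomial_regular[OF X T]
        quasi_affine_polynomial_regular[OF Y R] poly_funs.intros)+
    then show "(\<lambda>z. ?\<psi> z j) \<in> tensor_funs X Y ?T ?R"
      by (cases "j = n") auto
  qed (auto simp: affine_points_def)
  show ?thesis
    by (rule isomorphicI[OF 1 2])
      (auto simp: points_product_space[OF X Y] quasi_affine_points[OF W] affine_points_def fun_eq_iff)
qed

text \<open>
  The complement of the diagonal is the union of the loci where some coordinates \<open>x j\<close> and \<open>y j\<close>
  differ, and \<open>x j - y j\<close> is among the functions that define the topology of the product.
\<close>

lemma quasi_affine_separated:
  assumes X: "quasi_affine X S"
  shows "separated X"
proof -
  have S: "openin (zariski X) S" by (rule quasi_affine_open_self[OF X])
  let ?D = "\<lambda>j. {z \<in> S \<times> S. fst z j - snd z j \<noteq> 0}"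
  have "openin (zariski (product_space X X)) (?D j)" for j
  proof -
    \<comment> \<open>the difference of the coordinates as a sum of two products\<close>
    have "(\<lambda>z. (\<lambda>x. x j) (fst z) * (\<lambda>_. 1) (snd z) + (\<lambda>_. -1) (fst z) * (\<lambda>x. x j) (snd z)) \<in>
        tensor_funs X X S S"
      by (intro tensor_funs_add tensor_funs_prod quasi_affine_polynomial_regular[OF X S]
        poly_funs.intros)
    from openin_product_space_basic[OF S S this] show ?thesis by simp
  qed
  then have "openin (zariski (product_space X X)) (\<Union>(range ?D))" by blast
  moreover have "\<Union>(range ?D) = S \<times> S - {(x, x) |x. x \<in> S}" by (auto simp: fun_eq_iff)
  ultimately show ?thesis
    unfolding separated_def closedin_def points_product_space[OF X X] quasi_affine_points[OF X]
    by auto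
qed

lemma variety_union_principal_opens:
  assumes X: "quasi_affine X S" and H: "finite H" "H \<subseteq> poly_funs"
    and S: "S = (\<Union>h\<in>H. {x\<in>affine_points {..<n::nat}. h x \<noteq> 0})"
  shows "variety X"
proof -
  let ?D = "\<lambda>h. {x\<in>affine_points {..<n}. h x \<noteq> 0}"
  have D: "?D h = {x\<in>S. h x \<noteq> 0}" if "h \<in> H" for h using S that by blast
  have "openin (zariski X) (?D h)" "affine_variety (induced X (?D h))" if h: "h \<in> H" for h
  proof -
    show "openin (zariski X) (?D h)"
      unfolding D[OF h] using quasi_affine_principal_open[OF X] H(2) h by blast
    have "quasi_affine (induced X (?D h)) (?D h)"
      using D[OF h] by (intro quasi_affine_induced[OF X]) auto
    then show "affine_variety (induced X (?D h))"
      using H(2) h by (auto intro: principal_open_affine_variety)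
  qed
  then have "\<exists>\<U>. finite \<U> \<and> \<Union>\<U> = points X \<and>
        (\<forall>U\<in>\<U>. openin (zariski X) U \<and> affine_variety (induced X U))"
    using H(1) S unfolding quasi_affine_points[OF X]
    by (intro exI[of _ "?D ` H"]) auto
  then show ?thesis unfolding variety_def
    using quasi_affine_function_sheaf[OF X] quasi_affine_separated[OF X] by blast
qed

section \<open>Classes of unions of torus orbits\<close>

lemma abs_K0_eqI: "p - q \<in> K0_relations \<Longrightarrow> abs_K0 p = abs_K0 q"
  by (simp add: K0.abs_eq_iff cong_ideal_def ideal_generated_def module.span_base[OF module_times])

lemma abs_K0_plus: "abs_K0 (p + q) = abs_K0 p + abs_K0 q"
  by (simp add: plus_K0.abs_eq)

lemma abs_K0_times: "abs_K0 (p * q) = abs_K0 p * abs_K0 q"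
  by (simp add: times_K0.abs_eq)

text \<open>
  The definition of the class chooses a representative. By the isomorphism relation any other
  choice gives the same class, provided that one exists.
\<close>

lemma K0_class_eqI:
  assumes "isomorphic X (Rep_cvariety C)"
  shows "K0_class X = abs_K0 (gen C)"
proof -
  have "isomorphic X (Rep_cvariety (SOME C. isomorphic X (Rep_cvariety C)))"
    using assms by (rule someI)
  then have "isomorphic (Rep_cvariety (SOME C. isomorphic X (Rep_cvariety C))) (Rep_cvariety C)"
    using assms isomorphic_sym isomorphic_trans by blast
  then show ?thesis unfolding K0_class_def
    by (intro abs_K0_eqI) (auto simp: K0_relations_def)
qed

lemma K0_class_cong:
  assumes "isomorphic X Y" "isomorphic Y (Rep_cvariety C)"
  shows "K0_class X = K0_class Y"
  using K0_class_eqI[OF assms(2)] K0_class_eqI[OF isomorphic_trans[OF assms]] by simp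

text \<open>
  The scissor relation, transported to spaces that are isomorphic to generators.
\<close>

lemma K0_class_closed_open:
  assumes X: "isomorphic X (Rep_cvariety C)" and Y: "isomorphic Y (Rep_cvariety D)"
    and W: "isomorphic W (Rep_cvariety E)"
    and S: "closedin (zariski (Rep_cvariety C)) S"
    and YS: "isomorphic Y (induced (Rep_cvariety C) S)"
    and WS: "isomorphic W (induced (Rep_cvariety C) (points (Rep_cvariety C) - S))"
  shows "K0_class X = K0_class Y + K0_class W"
proof -
  have "isomorphic (Rep_cvariety D) (induced (Rep_cvariety C) S)"
    "isomorphic (Rep_cvariety E) (induced (Rep_cvariety C) (points (Rep_cvariety C) - S))"
    using isomorphic_trans[OF isomorphic_sym[OF Y] YS] isomorphic_trans[OF isomorphic_sym[OF W] WS] .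
  then have "gen C - (gen D + gen E) \<in> K0_relations" using S unfolding K0_relations_def by blast
  then show ?thesis
    by (simp add: K0_class_eqI[OF X] K0_class_eqI[OF Y] K0_class_eqI[OF W] abs_K0_eqI
      flip: abs_K0_plus)
qed

text \<open>
  A union of orbits of the torus that acts by rescaling coordinates. The locus lies in the affine
  space over \<open>I\<close> as soon as the members of \<open>\<U>\<close> are subsets of \<open>I\<close>.
\<close>

definition support_locus :: "'i set set \<Rightarrow> ('i \<Rightarrow> complex) set" where
  "support_locus \<U> = {x. {i. x i \<noteq> 0} \<in> \<U>}"

definition upward_closed :: "'i set \<Rightarrow> 'i set set \<Rightarrow> bool" where
  "upward_closed I \<U> \<longleftrightarrow> \<U> \<subseteq> Pow I \<and> (\<forall>T\<in>\<U>. \<forall>T'. T \<subseteq> T' \<and> T' \<subseteq> I \<longrightarrow> T' \<in> \<U>)"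

lemma support_locus_affine_points: "\<U> \<subseteq> Pow I \<Longrightarrow> support_locus \<U> \<subseteq> affine_points I"
  unfolding support_locus_def affine_points_def by blast

lemma support_locus_Pow: "support_locus (Pow I) = affine_points I"
  unfolding support_locus_def affine_points_def by blast

lemma quasi_affine_support_locus:
  "\<U> \<subseteq> Pow I \<Longrightarrow> quasi_affine (induced (affine_space I) (support_locus \<U>)) (support_locus \<U>)"
  by (rule quasi_affine_induced_affine_space[OF support_locus_affine_points])

text \<open>
  Renaming coordinates serves to replace an arbitrary finite index set by an initial segment of the
  natural numbers, as required for generators, and to identify tori of equal dimension.
\<close>

lemma support_locus_reindex:
  assumes b: "bij_betw b I J" and \<U>: "\<U> \<subseteq> Pow I"
    and X: "quasi_affine X (support_locus \<U>)" and Y: "quasi_affine Y (support_locus ((`) b ` \<U>))"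
  shows "isomorphic X Y"
proof -
  \<comment> \<open>coordinates outside the index set are zero by convention\<close>
  let ?\<phi> = "\<lambda>x j. if j \<in> J then x (inv_into I b j) else 0"
  let ?\<psi> = "\<lambda>y i. if i \<in> I then y (b i) else 0"
  have inj: "inj_on b I" and im: "b ` I = J" using b by (auto simp: bij_betw_def)
  have XO: "openin (zariski X) (support_locus \<U>)"
    and YO: "openin (zariski Y) (support_locus ((`) b ` \<U>))"
    by (rule quasi_affine_open_self[OF X], rule quasi_affine_open_self[OF Y])
  have inv1: "inv_into I b (b i) = i" if "i \<in> I" for i using inj that by simp
  have inv2: "b (inv_into I b j) = j" "inv_into I b j \<in> I" if "j \<in> J" for j
    using im that by (auto simp: f_inv_into_f inv_into_into)
  have in_I: "i \<in> I" if "x \<in> support_locus \<U>" "x i \<noteq> 0" for x i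
    using that \<U> unfolding support_locus_def by blast
  have supp: "{j. ?\<phi> x j \<noteq> 0} = b ` {i. x i \<noteq> 0}" if "x \<in> support_locus \<U>" for x
    using in_I[OF that] inv1 inv2 im by (auto simp: image_iff) metis+
  have in_J: "j \<in> J" if "y \<in> support_locus ((`) b ` \<U>)" "y j \<noteq> 0" for y j
    using that \<U> im unfolding support_locus_def by blast
  show ?thesis
  proof (rule quasi_affine_isomorphic[OF X Y, of ?\<phi> ?\<psi>])
    show "?\<phi> x \<in> support_locus ((`) b ` \<U>)" if "x \<in> support_locus \<U>" for x
      using supp[OF that] that unfolding support_locus_def by simp
    show "?\<psi> y \<in> support_locus \<U>" if y: "y \<in> support_locus ((`) b ` \<U>)" for y
    proof -
      obtain T where T: "T \<in> \<U>" "{j. y j \<noteq> 0} = b ` T" using y unfolding support_locus_def by blast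
      have "T \<subseteq> I" using T(1) \<U> by blast
      then have "b i \<in> b ` T \<longleftrightarrow> i \<in> T" if "i \<in> I" for i
        using inj that by (meson inj_on_image_mem_iff)
      moreover have "y j \<noteq> 0 \<longleftrightarrow> j \<in> b ` T" for j using T(2) by blast
      ultimately have "{i. ?\<psi> y i \<noteq> 0} = T" using \<open>T \<subseteq> I\<close> by auto
      then show ?thesis using T(1) by (simp add: support_locus_def)
    qed
    show "(\<lambda>x. ?\<phi> x j) \<in> regular X (support_locus \<U>)" for j
      by (rule quasi_affine_polynomial_regular[OF X XO poly_funs_if_coord])
    show "(\<lambda>y. ?\<psi> y i) \<in> regular Y (support_locus ((`) b ` \<U>))" for i
      by (rule quasi_affine_polynomial_regular[OF Y YO poly_funs_if_coord])
    show "?\<psi> (?\<phi> x) = x" if "x \<in> support_locus \<U>" for x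
    proof
      fix i
      show "?\<psi> (?\<phi> x) i = x i" using in_I[OF that, of i] inv1[of i] im by auto
    qed
    show "?\<phi> (?\<psi> y) = y" if "y \<in> support_locus ((`) b ` \<U>)" for y
    proof
      fix j
      show "?\<phi> (?\<psi> y) j = y j" using in_J[OF that, of j] inv2[of j] by auto
    qed
  qed
qed

definition locus_variety :: "nat \<Rightarrow> nat set set \<Rightarrow> cvariety" where
  "locus_variety n \<U> = Abs_cvariety (induced (affine_space {..<n}) (support_locus \<U>))"

text \<open>
  A point whose support contains a member of the family has its support in the family. So the locus
  is covered by the principal open sets that belong to the members.
\<close>

lemma support_locus_principal_opens:
  assumes "upward_closed I \<U>" "finite I"
  shows "support_locus \<U> = (\<Union>T\<in>\<U>. {x\<in>affine_points I. (\<Prod>i\<in>T. x i) \<noteq> 0})"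
proof -
  have sub: "\<U> \<subseteq> Pow I" using assms(1) unfolding upward_closed_def by (rule conjunct1)
  have fin: "finite T" if "T \<in> \<U>" for T
    using that sub by (intro finite_subset[OF _ assms(2)]) blast
  show ?thesis
  proof (intro equalityI subsetI)
    fix x assume x: "x \<in> support_locus \<U>"
    then have "x \<in> affine_points I" using support_locus_affine_points[OF sub] by blast
    moreover have T: "{i. x i \<noteq> 0} \<in> \<U>" using x by (simp add: support_locus_def)
    moreover have "(\<Prod>i\<in>{i. x i \<noteq> 0}. x i) \<noteq> 0" by (simp add: prod_zero_iff[OF fin[OF T]])
    ultimately show "x \<in> (\<Union>T\<in>\<U>. {x\<in>affine_points I. (\<Prod>i\<in>T. x i) \<noteq> 0})"
      by (intro UN_I[OF T]) simp
  next
    fix x assume "x \<in> (\<Union>T\<in>\<U>. {x\<in>affine_points I. (\<Prod>i\<in>T. x i) \<noteq> 0})"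
    then obtain T where T: "T \<in> \<U>" "x\<in>affine_points I" "(\<Prod>i\<in>T. x i) \<noteq> 0" by auto
    from T(3) have "T \<subseteq> {i. x i \<noteq> 0}" unfolding prod_zero_iff[OF fin[OF T(1)]] by blast
    moreover have "{i. x i \<noteq> 0} \<subseteq> I" using T(2) by (auto simp: affine_points_def)
    ultimately have "{i. x i \<noteq> 0} \<in> \<U>"
      using T(1) assms(1) unfolding upward_closed_def by simp
    then show "x \<in> support_locus \<U>" by (simp add: support_locus_def)
  qed
qed

lemma variety_support_locus:
  assumes "upward_closed {..<n::nat} \<U>"
  shows "variety (induced (affine_space {..<n}) (support_locus \<U>))"
proof -
  have sub: "\<U> \<subseteq> Pow {..<n}" using assms by (simp add: upward_closed_def)
  define H where "H = (\<lambda>T (x :: nat \<Rightarrow> complex). \<Prod>i\<in>T. x i) ` \<U>"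
  have "finite H" using sub by (simp add: H_def finite_subset)
  moreover have "H \<subseteq> poly_funs"
  proof
    fix h assume "h \<in> H"
    then obtain T where "h = (\<lambda>x. \<Prod>i\<in>T. x i)" unfolding H_def by (rule imageE)
    then show "h \<in> poly_funs" using poly_funs_prod[of T "\<lambda>i x. x i", OF poly_funs.coord] by simp
  qed
  moreover have "support_locus \<U> = (\<Union>h\<in>H. {x\<in>affine_points {..<n}. h x \<noteq> 0})"
    unfolding H_def support_locus_principal_opens[OF assms finite_lessThan] by simp
  ultimately show ?thesis
    by (rule variety_union_principal_opens[OF quasi_affine_support_locus[OF sub]])
qed

lemma Rep_locus_variety:
  assumes "upward_closed {..<n} \<U>"
  shows "Rep_cvariety (locus_variety n \<U>) = induced (affine_space {..<n}) (support_locus \<U>)"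
  unfolding locus_variety_def
  by (rule Abs_cvariety_inverse, rule CollectI, rule variety_support_locus[OF assms])

lemma quasi_affine_Rep_locus_variety:
  assumes "upward_closed {..<n} \<U>"
  shows "quasi_affine (Rep_cvariety (locus_variety n \<U>)) (support_locus \<U>)"
  unfolding Rep_locus_variety[OF assms]
  using assms by (intro quasi_affine_support_locus) (simp add: upward_closed_def)

lemma upward_closed_Pow: "upward_closed I (Pow I)"
  by (auto simp: upward_closed_def)

lemma upward_closed_top: "upward_closed I {I}"
  by (auto simp: upward_closed_def)

definition torus_class :: "nat \<Rightarrow> K0" where
  "torus_class k = K0_class (induced (affine_space {..<k}) (support_locus {{..<k}}))"

lemma K0_class_torus:
  assumes "finite T" and X: "quasi_affine X (support_locus {T})"
  shows "K0_class X = torus_class (card T)"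
    and "isomorphic X (Rep_cvariety (locus_variety (card T) {{..<card T}}))"
proof -
  obtain b where b: "bij_betw b T {..<card T}"
    using ex_bij_betw_finite_nat[OF assms(1)] by (auto simp: atLeast0LessThan)
  then have im: "(`) b ` {T} = {{..<card T}}" by (simp add: bij_betw_def)
  note rep = quasi_affine_Rep_locus_variety[OF upward_closed_top[of "{..<card T}"]]
  show iso: "isomorphic X (Rep_cvariety (locus_variety (card T) {{..<card T}}))"
    by (rule support_locus_reindex[OF b _ X]) (use rep im in auto)
  show "K0_class X = torus_class (card T)"
    unfolding torus_class_def Rep_locus_variety[OF upward_closed_top, symmetric]
      K0_class_eqI[OF iso]
    by (rule K0_class_eqI[symmetric], rule quasi_affine_unique[OF rep rep])
qed

text \<open>
  Induction on the number of orbits: the orbit of a minimal support \<open>T\<close> is closed, because a point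
  of the locus that does not lie on it has a nonzero coordinate outside \<open>T\<close>. The remaining family is
  still upward closed. In the base case the scissor relation for the empty variety, decomposed into
  two copies of itself, shows that its class is zero.
\<close>

lemma K0_class_support_locus_nat:
  assumes "finite \<U>" "upward_closed {..<n::nat} \<U>" "quasi_affine X (support_locus \<U>)"
  shows "K0_class X = (\<Sum>T\<in>\<U>. torus_class (card T))"
  using assms
proof (induction "card \<U>" arbitrary: \<U> X)
  case 0
  then have E: "\<U> = {}" by simp
  let ?C = "locus_variety n {}"
  have up: "upward_closed {..<n} {}" by (simp add: upward_closed_def)
  have R: "quasi_affine (Rep_cvariety ?C) {}"
    using quasi_affine_Rep_locus_variety[OF up] by (simp add: support_locus_def)
  have X: "quasi_affine X {}" using 0(4) E by (simp add: support_locus_def)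
  have I: "isomorphic X (induced (Rep_cvariety ?C) {})"
    by (rule quasi_affine_unique[OF X quasi_affine_induced[OF R]]) simp
  have "K0_class X = K0_class X + K0_class X"
    by (rule K0_class_closed_open[where S = "{}" and C = ?C and D = ?C and E = ?C])
      (use I in \<open>simp_all add: quasi_affine_points[OF R] quasi_affine_unique[OF X R]\<close>)
  then show ?case using E by simp
next
  case (Suc m)
  then have "\<U> \<noteq> {}" by auto
  then obtain T where T: "T \<in> \<U>" and min: "\<And>T'. T' \<in> \<U> \<Longrightarrow> \<not> T' \<subset> T"
    using finite_has_minimal[OF Suc.prems(1)] by (metis psubset_eq)
  let ?V = "\<U> - {T}"
  have sub: "\<U> \<subseteq> Pow {..<n}" using Suc.prems by (simp add: upward_closed_def)
  have finT: "finite T" using T sub finite_subset by blast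
  have upV: "upward_closed {..<n} ?V"
    unfolding upward_closed_def
  proof (intro conjI ballI allI impI)
    fix A B assume A: "A \<in> ?V" and B: "A \<subseteq> B \<and> B \<subseteq> {..<n}"
    have "B \<in> \<U>" using A B Suc.prems(2) unfolding upward_closed_def by blast
    moreover have "B \<noteq> T" using A B min by blast
    ultimately show "B \<in> ?V" by simp
  qed (use sub in auto)
  let ?C = "locus_variety n \<U>" and ?W = "locus_variety n ?V"
  note R = quasi_affine_Rep_locus_variety[OF Suc.prems(2)]
  note RV = quasi_affine_Rep_locus_variety[OF upV]
  let ?S = "support_locus {T} :: (nat \<Rightarrow> complex) set"
  have SV: "support_locus \<U> - ?S = support_locus ?V"
    and SU: "?S \<subseteq> support_locus \<U>" using T by (auto simp: support_locus_def)
  let ?H = "{..<n} - T"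
  have eq: "support_locus ?V = (\<Union>i\<in>?H. {x\<in>support_locus \<U>. x i \<noteq> 0})"
  proof (intro equalityI subsetI)
    fix x :: "nat \<Rightarrow> complex" assume x: "x \<in> support_locus ?V"
    then have "{i. x i \<noteq> 0} \<in> \<U>" "{i. x i \<noteq> 0} \<noteq> T" by (auto simp: support_locus_def)
    with min have "\<not> {i. x i \<noteq> 0} \<subseteq> T" by blast
    then obtain i where "x i \<noteq> 0" "i \<notin> T" by blast
    moreover then have "i < n" using \<open>{i. x i \<noteq> 0} \<in> \<U>\<close> sub by blast
    ultimately show "x \<in> (\<Union>i\<in>?H. {x\<in>support_locus \<U>. x i \<noteq> 0})"
      using \<open>{i. x i \<noteq> 0} \<in> \<U>\<close> by (auto simp: support_locus_def)
  qed (auto simp: support_locus_def)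
  have "openin (zariski (Rep_cvariety ?C)) (support_locus ?V)"
    unfolding eq
    by (intro openin_Union ballI) (auto intro: quasi_affine_principal_open[OF R] poly_funs.coord)
  then have closed: "closedin (zariski (Rep_cvariety ?C)) ?S"
    unfolding closedin_def quasi_affine_points[OF R] SV using SU by simp
  have IS: "quasi_affine (induced (Rep_cvariety ?C) ?S) ?S" by (rule quasi_affine_induced[OF R SU])
  have IV: "quasi_affine (induced (Rep_cvariety ?C) (support_locus ?V)) (support_locus ?V)"
    by (rule quasi_affine_induced[OF R]) (auto simp: support_locus_def)
  have "K0_class X = K0_class (induced (Rep_cvariety ?C) ?S) +
      K0_class (induced (Rep_cvariety ?C) (support_locus ?V))"
  proof (rule K0_class_closed_open[OF quasi_affine_unique[OF Suc.prems(3) R] _ _ closed])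
    show "isomorphic (induced (Rep_cvariety ?C) ?S)
        (Rep_cvariety (locus_variety (card T) {{..<card T}}))"
      by (rule K0_class_torus(2)[OF finT IS])
    show "isomorphic (induced (Rep_cvariety ?C) (support_locus ?V)) (Rep_cvariety ?W)"
      by (rule quasi_affine_unique[OF IV RV])
    show "isomorphic (induced (Rep_cvariety ?C) ?S) (induced (Rep_cvariety ?C) ?S)"
      by (rule quasi_affine_unique[OF IS IS])
    show "isomorphic (induced (Rep_cvariety ?C) (support_locus ?V))
        (induced (Rep_cvariety ?C) (points (Rep_cvariety ?C) - ?S))"
      unfolding quasi_affine_points[OF R] SV by (rule quasi_affine_unique[OF IV IV])
  qed
  also have "K0_class (induced (Rep_cvariety ?C) (support_locus ?V)) =
      (\<Sum>T\<in>?V. torus_class (card T))"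
    by (rule Suc.hyps(1)[OF _ _ upV IV]) (use Suc.hyps(2) Suc.prems(1) T in auto)
  also have "K0_class (induced (Rep_cvariety ?C) ?S) = torus_class (card T)"
    by (rule K0_class_torus(1)[OF finT IS])
  finally show ?case using T Suc.prems(1) by (simp add: sum.remove)
qed

text \<open>
  The binomial theorem in the form used for sets of arrows, without assuming \<open>0 \<noteq> 1\<close> so that it
  applies to the Grothendieck ring as well as to rational functions.
\<close>

lemma sum_Pow_power_card:
  fixes y :: "'r :: {comm_ring, comm_monoid_mult}"
  assumes "finite A"
  shows "(\<Sum>T\<in>Pow A. y ^ card T) = (y + 1) ^ card A"
  using assms
proof induction
  case empty
  show ?case by simp
next
  case (insert a A)
  have "(\<Sum>T\<in>Pow (insert a A). y ^ card T) =
      (\<Sum>T\<in>Pow A. y ^ card T) + (\<Sum>T\<in>insert a ` Pow A. y ^ card T)"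
    unfolding Pow_insert using insert.hyps by (intro sum.union_disjoint) auto
  also have "(\<Sum>T\<in>insert a ` Pow A. y ^ card T) = (\<Sum>T\<in>Pow A. y ^ card (insert a T))"
    using insert.hyps by (intro sum.reindex_cong[of "insert a"]) (auto simp: inj_on_def)
  also have "\<dots> = (\<Sum>T\<in>Pow A. y * y ^ card T)"
    using insert.hyps by (intro sum.cong refl) (auto simp: card_insert_if finite_subset)
  finally show ?case using insert by (simp add: distrib_right add.commute flip: sum_distrib_left)
qed

lemma affine_space_representable:
  "isomorphic (affine_space {..<n}) (Rep_cvariety (locus_variety n (Pow {..<n})))"
  using quasi_affine_unique[OF quasi_affine_affine_space[of "{..<n}", folded support_locus_Pow]
    quasi_affine_Rep_locus_variety[OF upward_closed_Pow]] .

lemma affine_line_iso: "isomorphic (affine_space {0::nat}) (affine_space {..<1::nat})"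
  using quasi_affine_unique[OF quasi_affine_affine_space[of "{0::nat}"]
    quasi_affine_affine_space[of "{0::nat}"]] by (simp add: lessThan_Suc)

lemma K0_class_affine_space: "K0_class (affine_space {..<n::nat}) = K0_L ^ n"
proof (induction n)
  case 0
  have "isomorphic (Rep_cvariety (locus_variety 0 (Pow {..<0}))) (affine_space ({} :: nat set))"
    using isomorphic_sym[OF affine_space_representable[of 0]] by simp
  then have "gen (locus_variety 0 (Pow {..<0})) - 1 \<in> K0_relations"
    unfolding K0_relations_def by blast
  then show ?case
    unfolding K0_class_eqI[OF affine_space_representable] by (simp add: abs_K0_eqI one_K0.abs_eq)
next
  case (Suc n)
  let ?C = "\<lambda>n. locus_variety n (Pow {..<n})"
  note Q = quasi_affine_Rep_locus_variety[OF upward_closed_Pow, unfolded support_locus_Pow]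
  have "isomorphic (Rep_cvariety (?C (Suc n)))
      (product_space (Rep_cvariety (?C n)) (Rep_cvariety (?C 1)))"
    by (rule affine_Suc_product[OF Q _ Q]) (use Q[of 1] in \<open>simp add: lessThan_Suc\<close>)
  then have "gen (?C (Suc n)) - gen (?C n) * gen (?C 1) \<in> K0_relations"
    unfolding K0_relations_def by blast
  then have "K0_class (affine_space {..<Suc n}) = K0_class (affine_space {..<n}) * abs_K0 (gen (?C 1))"
    by (simp add: K0_class_eqI[OF affine_space_representable] abs_K0_eqI flip: abs_K0_times)
  moreover have "K0_L = abs_K0 (gen (?C 1))"
    unfolding K0_L_def
    by (rule K0_class_eqI, rule isomorphic_trans[OF affine_line_iso affine_space_representable])
  ultimately show ?case using Suc by (simp add: mult.commute)
qed

text \<open>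
  Affine space is the union of the orbits for all supports. This expresses \<open>L ^ n\<close> by tori, the one of
  dimension \<open>n\<close> occurring once, and the binomial theorem gives the same expression for \<open>(L - 1) ^ n\<close>.
\<close>

lemma torus_class_power: "torus_class n = (K0_L - 1) ^ n"
proof (induction n rule: less_induct)
  case (less n)
  have fin: "finite (Pow {..<n})" by simp
  have "K0_L ^ n = (\<Sum>T\<in>Pow {..<n}. torus_class (card T))"
    using K0_class_support_locus_nat[OF fin upward_closed_Pow, of "affine_space {..<n}"]
    by (simp add: support_locus_Pow quasi_affine_affine_space K0_class_affine_space)
  also have "\<dots> = torus_class n + (\<Sum>T\<in>Pow {..<n} - {{..<n}}. torus_class (card T))"
    by (subst sum.remove[OF fin, of "{..<n}"]) simp_all
  also have "(\<Sum>T\<in>Pow {..<n} - {{..<n}}. torus_class (card T)) =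
      (\<Sum>T\<in>Pow {..<n} - {{..<n}}. (K0_L - 1) ^ card T)"
  proof (rule sum.cong[OF refl])
    fix T assume "T \<in> Pow {..<n} - {{..<n}}"
    then have "card T < card {..<n}" by (intro psubset_card_mono) auto
    then show "torus_class (card T) = (K0_L - 1) ^ card T" using less by simp
  qed
  finally have A: "K0_L ^ n = torus_class n + (\<Sum>T\<in>Pow {..<n} - {{..<n}}. (K0_L - 1) ^ card T)" .
  have "K0_L ^ n = (\<Sum>T\<in>Pow {..<n}. (K0_L - 1) ^ card T)"
    by (simp add: sum_Pow_power_card)
  also have "\<dots> = (K0_L - 1) ^ n + (\<Sum>T\<in>Pow {..<n} - {{..<n}}. (K0_L - 1) ^ card T)"
    by (subst sum.remove[OF fin, of "{..<n}"]) simp_all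
  finally show ?case using A by simp
qed

lemma K0_class_support_locus:
  assumes I: "finite I" and \<U>: "upward_closed I \<U>" and X: "quasi_affine X (support_locus \<U>)"
  shows "K0_class X = (\<Sum>T\<in>\<U>. (K0_L - 1) ^ card T)"
proof -
  obtain b where b: "bij_betw b I {..<card I}"
    using ex_bij_betw_finite_nat[OF I] by (auto simp: atLeast0LessThan)
  then have inj: "inj_on b I" and im: "b ` I = {..<card I}" by (auto simp: bij_betw_def)
  have sub: "\<U> \<subseteq> Pow I" using \<U> by (simp add: upward_closed_def)
  let ?V = "(`) b ` \<U>"
  have up: "upward_closed {..<card I} ?V"
    unfolding upward_closed_def
  proof (intro conjI ballI allI impI)
    fix A B assume "A \<in> ?V" and B: "A \<subseteq> B \<and> B \<subseteq> {..<card I}"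
    then obtain T where T: "T \<in> \<U>" "A = b ` T" by blast
    let ?T = "{i\<in>I. b i \<in> B}"
    have "T \<subseteq> ?T" using T B sub by blast
    then have "?T \<in> \<U>" using T(1) \<U> unfolding upward_closed_def by blast
    moreover have "B = b ` ?T" using B by (auto simp flip: im)
    ultimately show "B \<in> ?V" by (rule image_eqI[rotated])
  next
    show "?V \<subseteq> Pow {..<card I}"
    proof
      fix A assume "A \<in> ?V"
      then obtain T where "T \<in> \<U>" "A = b ` T" by (rule imageE)
      then show "A \<in> Pow {..<card I}" using sub unfolding im[symmetric] by auto
    qed
  qed
  note R = quasi_affine_Rep_locus_variety[OF up]
  have fin: "finite ?V" using I by (intro finite_imageI finite_subset[OF sub]) simp
  have "K0_class X = K0_class (Rep_cvariety (locus_variety (card I) ?V))"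
    by (rule K0_class_cong[OF support_locus_reindex[OF b sub X R] quasi_affine_unique[OF R R]])
  also have "\<dots> = (\<Sum>T\<in>?V. torus_class (card T))"
    by (rule K0_class_support_locus_nat[OF fin up R])
  also have "\<dots> = (\<Sum>T\<in>\<U>. (K0_L - 1) ^ card T)"
  proof (rule sum.reindex_cong[of "(`) b"])
    show "inj_on ((`) b) \<U>" by (rule inj_on_subset[OF inj_on_image_Pow[OF inj] sub])
    fix T assume "T \<in> \<U>"
    then have "inj_on b T" using sub by (intro inj_on_subset[OF inj]) auto
    then show "torus_class (card (b ` T)) = (K0_L - 1) ^ card T"
      by (simp add: card_image torus_class_power)
  qed simp
  finally show ?thesis .
qed

section \<open>Scalars in the coefficient ring\<close>

lemma abs_mot_eqI: "p - q \<in> tensor_relations \<Longrightarrow> abs_mot p = abs_mot q"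
  by (simp add: mot.abs_eq_iff cong_ideal_def ideal_generated_def module.span_base[OF module_times])

lemma mot_tensor_add_left: "mot_tensor (a + a') b = mot_tensor a b + mot_tensor a' b"
  unfolding mot_tensor_def plus_mot.abs_eq
  by (rule abs_mot_eqI, unfold tensor_relations_def, blast)

lemma mot_tensor_add_right: "mot_tensor a (b + b') = mot_tensor a b + mot_tensor a b'"
  unfolding mot_tensor_def plus_mot.abs_eq
  by (rule abs_mot_eqI, unfold tensor_relations_def, blast)

lemma mot_tensor_mult: "mot_tensor (a * a') (b * b') = mot_tensor a b * mot_tensor a' b'"
  unfolding mot_tensor_def times_mot.abs_eq
  by (rule abs_mot_eqI, unfold tensor_relations_def, blast)

lemma mot_tensor_balanced: "mot_tensor (K0_L * a) b = mot_tensor a (sqrt_L ^ 2 * b)"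
  unfolding mot_tensor_def
  by (rule abs_mot_eqI, unfold tensor_relations_def, blast)

lemma mot_scalar_one: "mot_scalar 1 = 1"
  unfolding mot_scalar_def mot_tensor_def one_mot.abs_eq
  by (rule abs_mot_eqI, unfold tensor_relations_def, blast)

lemma mot_scalar_add: "mot_scalar (b + b') = mot_scalar b + mot_scalar b'"
  unfolding mot_scalar_def by (rule mot_tensor_add_right)

lemma mot_scalar_mult: "mot_scalar (b * b') = mot_scalar b * mot_scalar b'"
  unfolding mot_scalar_def using mot_tensor_mult[of 1 1 b b'] by simp

lemma mot_scalar_zero: "mot_scalar 0 = 0"
  using mot_scalar_add[of 0 0] by simp

lemma mot_scalar_sum: "mot_scalar (\<Sum>i\<in>I. f i) = (\<Sum>i\<in>I. mot_scalar (f i))"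
  by (induction I rule: infinite_finite_induct) (simp_all add: mot_scalar_zero mot_scalar_add)

text \<open>
  The tensor product is balanced over the Lefschetz motive, which therefore moves to the scalar side
  as the square of \<open>sqrt_L\<close>.
\<close>

lemma mot_tensor_torus: "mot_tensor ((K0_L - 1) ^ n) 1 = mot_scalar ((sqrt_L ^ 2 - 1) ^ n)"
proof (induction n)
  case (Suc n)
  have "mot_tensor (K0_L - 1) 1 + mot_tensor 1 1 = mot_tensor K0_L 1"
    by (simp flip: mot_tensor_add_left)
  also have "\<dots> = mot_scalar (sqrt_L ^ 2)"
    using mot_tensor_balanced[of 1 1] by (simp add: mot_scalar_def)
  also have "\<dots> = mot_scalar (sqrt_L ^ 2 - 1) + mot_tensor 1 1"
    using mot_scalar_add[of "sqrt_L ^ 2 - 1" 1] by (simp add: mot_scalar_def)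
  finally have "mot_tensor (K0_L - 1) 1 = mot_scalar (sqrt_L ^ 2 - 1)" by simp
  then show ?case
    using mot_tensor_mult[of "K0_L - 1" "(K0_L - 1) ^ n" 1 1] Suc
    by (simp add: mot_scalar_mult)
qed (simp add: mot_scalar_def)

text \<open>
  So the motives in the theorem are scalars, and the identity to be proved is one between rational
  functions.
\<close>

lemma mot_class_support_locus:
  assumes "finite I" "upward_closed I \<U>"
  shows "mot_class (induced (affine_space I) (support_locus \<U>)) =
    mot_scalar (\<Sum>T\<in>\<U>. (sqrt_L ^ 2 - 1) ^ card T)"
proof -
  have sub: "\<U> \<subseteq> Pow I" using assms(2) unfolding upward_closed_def by (rule conjunct1)
  have zero: "mot_tensor 0 1 = 0"
    using mot_tensor_add_left[of 0 0 1] by simp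
  have sum: "mot_tensor (\<Sum>T\<in>A. f T) 1 = (\<Sum>T\<in>A. mot_tensor (f T) 1)" for f and A :: "'a set set"
    by (induction A rule: infinite_finite_induct) (simp_all add: zero mot_tensor_add_left)
  show ?thesis
    unfolding mot_class_def
      K0_class_support_locus[OF assms quasi_affine_support_locus[OF sub]] sum mot_scalar_sum
      mot_tensor_torus ..
qed

section \<open>Phases\<close>

lemma upper_half_plane_iff: "u \<in> upper_half_plane \<longleftrightarrow> u \<noteq> 0 \<and> 0 < Arg u"
proof
  assume "u \<in> upper_half_plane"
  then obtain r \<phi> where u: "u = complex_of_real r * cis (pi * \<phi>)" "0 < r" "0 < \<phi>" "\<phi> \<le> 1"
    unfolding upper_half_plane_def by blast
  have "0 < pi * \<phi>" "pi * \<phi> \<le> pi" using u by simp_all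
  moreover from this have "- pi < pi * \<phi>" using pi_gt_zero by linarith
  ultimately have "Arg u = pi * \<phi>"
    using u(1,2) by (intro Arg_unique[of r]) (auto simp: cis_conv_exp)
  then show "u \<noteq> 0 \<and> 0 < Arg u" using u by simp
next
  assume u: "u \<noteq> 0 \<and> 0 < Arg u"
  then have "u = complex_of_real (cmod u) * cis (pi * (Arg u / pi))"
    using rcis_cmod_Arg[of u] by (simp add: rcis_def)
  moreover have "0 < cmod u" "0 < Arg u / pi" "Arg u / pi \<le> 1" using u Arg_bounded[of u] by auto
  ultimately show "u \<in> upper_half_plane" unfolding upper_half_plane_def by blast
qed

text \<open>
  The determinant of two vectors of the plane. Its sign compares arguments in the upper half plane,
  and its bilinearity makes the position of the argument of a sum evident.
\<close>

definition cross :: "complex \<Rightarrow> complex \<Rightarrow> real" where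
  "cross u v = Re u * Im v - Im u * Re v"

lemma cross_add_left: "cross (u + u') v = cross u v + cross u' v"
  by (simp add: cross_def algebra_simps)

lemma cross_add_right: "cross u (v + v') = cross u v + cross u v'"
  by (simp add: cross_def algebra_simps)

lemma cross_self: "cross u u = 0" by (simp add: cross_def)

lemma cross_swap: "cross u v = - cross v u" by (simp add: cross_def)

lemma cross_sin: "cross u v = cmod u * cmod v * sin (Arg v - Arg u)"
proof -
  have "Re w = cmod w * cos (Arg w)" "Im w = cmod w * sin (Arg w)" for w
    using rcis_cmod_Arg[of w] by (metis Re_rcis, metis Im_rcis)
  then show ?thesis by (simp add: cross_def sin_diff algebra_simps)
qed

lemma Arg_less_iff:
  assumes "u \<in> upper_half_plane" "v \<in> upper_half_plane"
  shows "Arg u < Arg v \<longleftrightarrow> 0 < cross u v"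
proof -
  have *: "0 < cross u v" if "u \<in> upper_half_plane" "v \<in> upper_half_plane" "Arg u < Arg v" for u v
  proof -
    have "0 < sin (Arg v - Arg u)"
      using that Arg_bounded[of v] by (intro sin_gt_zero) (auto simp: upper_half_plane_iff)
    then show ?thesis using that by (simp add: cross_sin upper_half_plane_iff)
  qed
  show ?thesis
  proof
    assume c: "0 < cross u v"
    show "Arg u < Arg v"
    proof (rule ccontr)
      assume "\<not> Arg u < Arg v"
      then consider "Arg u = Arg v" | "Arg v < Arg u" by linarith
      then show False
        using c *[OF assms(2,1)] cross_swap[of u v] by cases (auto simp: cross_sin)
    qed
  qed (rule *[OF assms])
qed

lemma Arg_le_iff:
  assumes "u \<in> upper_half_plane" "v \<in> upper_half_plane"
  shows "Arg u \<le> Arg v \<longleftrightarrow> 0 \<le> cross u v"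
  using Arg_less_iff[OF assms(2,1)] cross_swap[of u v] by linarith

lemma upper_half_plane_Im: "u \<in> upper_half_plane \<longleftrightarrow> 0 < Im u \<or> (Im u = 0 \<and> Re u < 0)"
  by (auto simp: upper_half_plane_iff Arg_pos_iff)

lemma upper_half_plane_add:
  "u \<in> upper_half_plane \<Longrightarrow> v \<in> upper_half_plane \<Longrightarrow> u + v \<in> upper_half_plane"
  by (auto simp: upper_half_plane_Im)

text \<open>
  The determinant of \<open>u\<close> and \<open>u + v\<close> equals that of \<open>u\<close> and \<open>v\<close>.
\<close>

lemma Arg_le_seesaw:
  assumes "u \<in> upper_half_plane" "v \<in> upper_half_plane" "Arg u \<le> Arg v"
  shows "Arg u \<le> Arg (u + v)" "Arg (u + v) \<le> Arg v"
  using assms upper_half_plane_add[OF assms(1,2)]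
  by (simp_all add: Arg_le_iff cross_add_left cross_add_right cross_self)

lemma Arg_less_seesaw:
  assumes "u \<in> upper_half_plane" "v \<in> upper_half_plane" "Arg u < Arg v"
  shows "Arg u < Arg (u + v)" "Arg (u + v) < Arg v"
  using assms upper_half_plane_add[OF assms(1,2)]
  by (simp_all add: Arg_less_iff cross_add_left cross_add_right cross_self)

definition phase :: "('p \<Rightarrow> complex) \<Rightarrow> 'p set \<Rightarrow> real" where
  "phase z N = Arg (\<Sum>p\<in>N. z p)"

lemma sum_upper_half_plane:
  assumes "finite N" "N \<noteq> {}" "\<And>p. p \<in> N \<Longrightarrow> z p \<in> upper_half_plane"
  shows "(\<Sum>p\<in>N. z p) \<in> upper_half_plane"
  using assms
proof (induction rule: finite_ne_induct)
  case (insert p N)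
  then show ?case by (simp add: upper_half_plane_add)
qed simp

lemma phase_Un_le:
  assumes fin: "finite A" "finite B" "A \<inter> B = {}"
    and z: "\<And>p. p \<in> A \<union> B \<Longrightarrow> z p \<in> upper_half_plane"
    and "A \<noteq> {}" "B \<noteq> {}" "phase z A \<le> phase z B"
  shows "phase z A \<le> phase z (A \<union> B)" "phase z (A \<union> B) \<le> phase z B"
  using Arg_le_seesaw[of "sum z A" "sum z B"] assms sum_upper_half_plane[of A z]
    sum_upper_half_plane[of B z]
  by (simp_all add: phase_def sum.union_disjoint)

lemma phase_Un_less:
  assumes fin: "finite A" "finite B" "A \<inter> B = {}"
    and z: "\<And>p. p \<in> A \<union> B \<Longrightarrow> z p \<in> upper_half_plane"
    and "A \<noteq> {}" "B \<noteq> {}" "phase z A < phase z B"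
  shows "phase z A < phase z (A \<union> B)" "phase z (A \<union> B) < phase z B"
  using Arg_less_seesaw[of "sum z A" "sum z B"] assms sum_upper_half_plane[of A z]
    sum_upper_half_plane[of B z]
  by (simp_all add: phase_def sum.union_disjoint)

text \<open>
  The mixed form of the seesaw property: one strict inequality suffices for a strict conclusion.
\<close>

lemma phase_Un_bounded:
  assumes fin: "finite A" "finite B" "A \<inter> B = {}"
    and z: "\<And>p. p \<in> A \<union> B \<Longrightarrow> z p \<in> upper_half_plane"
    and B: "B \<noteq> {}" "phase z B < \<kappa>" and A: "A \<noteq> {} \<Longrightarrow> phase z A \<le> \<kappa>"
  shows "phase z (A \<union> B) < \<kappa>"
proof (cases "A = {}")
  case False
  show ?thesis
  proof (cases "phase z A \<le> phase z B")
    case True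
    then show ?thesis using phase_Un_le(2)[where z = z, OF fin z \<open>A \<noteq> {}\<close> B(1)] B(2) by simp
  next
    case False
    then have "phase z (B \<union> A) < phase z A"
      using fin z \<open>A \<noteq> {}\<close> B(1) by (intro phase_Un_less(2)) auto
    then show ?thesis using A[OF \<open>A \<noteq> {}\<close>] by (simp add: Un_commute)
  qed
qed (use B in simp)

section \<open>Harder-Narasimhan filtrations of supports\<close>

definition arcs_between :: "('p, 'a) pre_digraph \<Rightarrow> 'p set \<Rightarrow> 'p set \<Rightarrow> 'a set" where
  "arcs_between G A B = {a \<in> arcs G. tail G a \<in> A \<and> head G a \<in> B}"

text \<open>
  The vertex sets of subrepresentations of an abelian representation on \<open>V\<close> with support \<open>T\<close>. Arrows
  of \<open>T\<close> that leave \<open>V\<close> are ignored, so \<open>T\<close> does not have to be restricted when \<open>V\<close> shrinks.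
\<close>

definition closed_in :: "('p, 'a) pre_digraph \<Rightarrow> 'a set \<Rightarrow> 'p set \<Rightarrow> 'p set \<Rightarrow> bool" where
  "closed_in G T V M \<longleftrightarrow> M \<subseteq> V \<and> (\<forall>a\<in>T. tail G a \<in> M \<longrightarrow> head G a \<in> V \<longrightarrow> head G a \<in> M)"

definition phase_semistable ::
    "('p, 'a) pre_digraph \<Rightarrow> ('p \<Rightarrow> complex) \<Rightarrow> 'p set \<Rightarrow> 'a set \<Rightarrow> bool" where
  "phase_semistable G z V T \<longleftrightarrow> (\<forall>M. closed_in G T V M \<and> M \<noteq> {} \<longrightarrow> phase z M \<le> phase z V)"

text \<open>
  The empty set is admitted: it stands for a phase of the list that does not occur in the filtration.
\<close>

definition hn_piece ::
    "('p, 'a) pre_digraph \<Rightarrow> ('p \<Rightarrow> complex) \<Rightarrow> real \<Rightarrow> 'p set \<Rightarrow> 'a set \<Rightarrow> 'p set \<Rightarrow> bool" where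
  "hn_piece G z \<theta> V T N \<longleftrightarrow>
     closed_in G T V N \<and> (N = {} \<or> phase z N = \<theta>) \<and> phase_semistable G z N T"

text \<open>
  The filtration has its subquotients at some of the phases in the list, in the order of the list.
\<close>

fun hn_type ::
    "('p, 'a) pre_digraph \<Rightarrow> ('p \<Rightarrow> complex) \<Rightarrow> real list \<Rightarrow> 'p set \<Rightarrow> 'a set \<Rightarrow> bool" where
  "hn_type G z [] V T \<longleftrightarrow> V = {}"
| "hn_type G z (\<theta> # \<theta>s) V T \<longleftrightarrow> (\<exists>N. hn_piece G z \<theta> V T N \<and> hn_type G z \<theta>s (V - N) T)"

lemma closed_in_subset: "closed_in G T V M \<Longrightarrow> M \<subseteq> V"
  by (simp add: closed_in_def)

lemma closed_in_self: "closed_in G T V V"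
  by (simp add: closed_in_def)

lemma closed_in_Int: "closed_in G T V M \<Longrightarrow> closed_in G T V N \<Longrightarrow> closed_in G T N (M \<inter> N)"
  unfolding closed_in_def by blast

lemma closed_in_Diff: "closed_in G T V M \<Longrightarrow> closed_in G T (V - N) (M - N)"
  unfolding closed_in_def by blast

lemma closed_in_trans: "closed_in G T V N \<Longrightarrow> closed_in G T N M \<Longrightarrow> closed_in G T V M"
  unfolding closed_in_def by blast

lemma closed_in_Un_Diff:
  "closed_in G T V N \<Longrightarrow> closed_in G T (V - N) M \<Longrightarrow> closed_in G T V (N \<union> M)"
  unfolding closed_in_def by blast

text \<open>
  A subrepresentation \<open>M\<close> meets the first piece \<open>N\<close> in a subrepresentation of \<open>N\<close>, whose phase is bounded
  by semistability, and the rest \<open>M - N\<close> is a subrepresentation of the quotient, which is bounded by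
  induction.
\<close>

lemma phase_closed_less:
  assumes "finite V" "\<And>p. p \<in> V \<Longrightarrow> z p \<in> upper_half_plane"
    and "hn_type G z \<theta>s V T" "\<And>\<theta>. \<theta> \<in> set \<theta>s \<Longrightarrow> \<theta> < \<kappa>"
    and "closed_in G T V M" "M \<noteq> {}"
  shows "phase z M < \<kappa>"
  using assms
proof (induction \<theta>s arbitrary: V M)
  case Nil
  show ?case using Nil.prems(3,5,6) by (simp add: closed_in_def)
next
  case (Cons \<theta> \<theta>s)
  from Cons.prems(3) obtain N where N: "hn_piece G z \<theta> V T N" and rest: "hn_type G z \<theta>s (V - N) T"
    by auto
  have MV: "M \<subseteq> V" using Cons.prems(5) by (rule closed_in_subset)
  then have fin: "finite (M \<inter> N)" "finite (M - N)" using Cons.prems(1) by (auto intro: finite_subset)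
  have sub: "phase z (M \<inter> N) < \<kappa>" if "M \<inter> N \<noteq> {}"
  proof -
    have "closed_in G T N (M \<inter> N)"
      using N Cons.prems(5) closed_in_Int unfolding hn_piece_def by blast
    then have "phase z (M \<inter> N) \<le> phase z N"
      using N that unfolding hn_piece_def phase_semistable_def by blast
    also have "\<dots> = \<theta>" using N that unfolding hn_piece_def by blast
    finally show ?thesis using Cons.prems(4)[of \<theta>] by simp
  qed
  show ?case
  proof (cases "M - N = {}")
    case True
    then have "M \<inter> N = M" by blast
    then show ?thesis using sub Cons.prems(6) by simp
  next
    case False
    have "phase z (M - N) < \<kappa>"
      using Cons.prems False
      by (intro Cons.IH[of "V - N"] rest closed_in_Diff) auto
    then have "phase z ((M \<inter> N) \<union> (M - N)) < \<kappa>"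
      using fin MV Cons.prems(2) False sub by (intro phase_Un_bounded) (auto intro: less_imp_le)
    then show ?thesis by (simp add: Int_Diff_Un)
  qed
qed

text \<open>
  If \<open>N'\<close> were not contained in \<open>N\<close>, its part outside \<open>N\<close> would be a subrepresentation of the quotient
  by \<open>N\<close>, hence of phase less than \<open>\<theta>\<close>. Its part inside \<open>N\<close> has phase at most \<open>\<theta>\<close> because \<open>N'\<close> is
  semistable. Then \<open>N'\<close> would have phase less than \<open>\<theta>\<close>.
\<close>

lemma hn_piece_subset:
  assumes fin: "finite V" and z: "\<And>p. p \<in> V \<Longrightarrow> z p \<in> upper_half_plane"
    and small: "\<And>\<theta>'. \<theta>' \<in> set \<theta>s \<Longrightarrow> \<theta>' < \<theta>"
    and N: "hn_piece G z \<theta> V T N" "hn_type G z \<theta>s (V - N) T" and N': "hn_piece G z \<theta> V T N'"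
  shows "N' \<subseteq> N"
proof (rule ccontr)
  assume "\<not> N' \<subseteq> N"
  then have ne: "N' - N \<noteq> {}" by blast
  have cl: "closed_in G T V N" "closed_in G T V N'" and ss: "phase_semistable G z N' T"
    using N(1) N' unfolding hn_piece_def by blast+
  have ph: "phase z N' = \<theta>" using N' ne unfolding hn_piece_def by blast
  have NV: "N' \<subseteq> V" using cl(2) by (rule closed_in_subset)
  have less: "phase z (N' - N) < \<theta>"
    using fin z by (intro phase_closed_less[OF _ _ N(2) small closed_in_Diff[OF cl(2)] ne]) auto
  have "closed_in G T N' (N \<inter> N')" by (rule closed_in_Int[OF cl])
  then have le: "phase z (N \<inter> N') \<le> \<theta>" if "N \<inter> N' \<noteq> {}"
    using ss that ph unfolding phase_semistable_def by blast
  have "phase z ((N \<inter> N') \<union> (N' - N)) < \<theta>"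
    using fin z NV ne less le by (intro phase_Un_bounded) (auto intro: finite_subset)
  moreover have "(N \<inter> N') \<union> (N' - N) = N'" by blast
  ultimately show False using ph by simp
qed

lemma hn_piece_unique:
  assumes "finite V" "\<And>p. p \<in> V \<Longrightarrow> z p \<in> upper_half_plane"
    and "\<And>\<theta>'. \<theta>' \<in> set \<theta>s \<Longrightarrow> \<theta>' < \<theta>"
    and "hn_piece G z \<theta> V T N" "hn_type G z \<theta>s (V - N) T"
    and "hn_piece G z \<theta> V T N'" "hn_type G z \<theta>s (V - N') T"
  shows "N = N'"
  using hn_piece_subset[OF assms(1-3,4,5,6)] hn_piece_subset[OF assms(1-3,6,7,4)] by blast

text \<open>
  The first piece is a largest subrepresentation of phase \<open>\<theta>\<close>, or empty if there is none. By maximality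
  all subrepresentations of the quotient have phase less than \<open>\<theta>\<close>. The last two hypotheses are the
  invariant of the induction: phases missing from the rest of the list are larger than all of it,
  and they do not occur among subrepresentations.
\<close>

lemma hn_type_exists:
  assumes "finite V" "\<And>p. p \<in> V \<Longrightarrow> z p \<in> upper_half_plane"
    and "sorted_wrt (>) \<theta>s"
    and "\<And>M. M \<subseteq> V \<Longrightarrow> M \<noteq> {} \<Longrightarrow> phase z M \<in> set \<theta>s \<or> (\<forall>\<theta>\<in>set \<theta>s. \<theta> < phase z M)"
    and "\<And>M. closed_in G T V M \<Longrightarrow> M \<noteq> {} \<Longrightarrow> phase z M \<in> set \<theta>s"
  shows "hn_type G z \<theta>s V T"
  using assms
proof (induction \<theta>s arbitrary: V)
  case Nil
  then show ?case using Nil.prems(5)[OF closed_in_self] by auto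
next
  case (Cons \<theta> \<theta>s)
  let ?P = "\<lambda>N. closed_in G T V N \<and> (N = {} \<or> phase z N = \<theta>)"
  have le: "phase z M \<le> \<theta>" if "closed_in G T V M" "M \<noteq> {}" for M
    using Cons.prems(5)[OF that] Cons.prems(3) by auto
  have "?P {}" by (simp add: closed_in_def)
  moreover have "\<forall>N. ?P N \<longrightarrow> card N < Suc (card V)"
    using Cons.prems(1) by (auto simp: closed_in_def less_Suc_eq_le intro: card_mono)
  ultimately have "\<exists>N. ?P N \<and> (\<forall>N'. ?P N' \<longrightarrow> card N' \<le> card N)"
    by (rule ex_has_greatest_nat)
  then obtain N where "?P N \<and> (\<forall>N'. ?P N' \<longrightarrow> card N' \<le> card N)" by (rule exE)
  then have N: "?P N" and greatest: "\<forall>N'. ?P N' \<longrightarrow> card N' \<le> card N"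
    by (rule conjunct1, rule conjunct2)
  have NV: "N \<subseteq> V" using N closed_in_subset by blast
  have finN: "finite N" using NV Cons.prems(1) finite_subset by blast
  have piece: "hn_piece G z \<theta> V T N"
    unfolding hn_piece_def phase_semistable_def
  proof (intro conjI allI impI)
    fix M assume M: "closed_in G T N M \<and> M \<noteq> {}"
    then have "N \<noteq> {}" using closed_in_subset[of G T N M] by auto
    then show "phase z M \<le> phase z N"
      using N M le[of M] closed_in_trans[of G T V N M] by auto
  qed (use N in auto)
  have small: "phase z M < \<theta>" if M: "closed_in G T (V - N) M" "M \<noteq> {}" for M
  proof -
    have cl: "closed_in G T V (N \<union> M)" using N M(1) closed_in_Un_Diff by blast
    have MV: "M \<subseteq> V - N" using M(1) by (rule closed_in_subset)
    then have finM: "finite M" using Cons.prems(1) finite_subset by blast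
    have card: "card N < card (N \<union> M)" using MV M(2) finN finM
      by (intro psubset_card_mono) auto
    have "phase z (N \<union> M) \<noteq> \<theta>"
      using greatest[rule_format, of "N \<union> M"] cl card by auto
    moreover have "phase z (N \<union> M) \<le> \<theta>" using le[OF cl] M(2) by simp
    ultimately have lt: "phase z (N \<union> M) < \<theta>" by simp
    show ?thesis
    proof (rule ccontr)
      assume "\<not> phase z M < \<theta>"
      moreover from this lt have "N \<noteq> {}" by auto
      moreover have "phase z N = \<theta>" using N \<open>N \<noteq> {}\<close> by blast
      ultimately have "\<theta> \<le> phase z (N \<union> M)"
        using phase_Un_le(1)[OF finN finM, of z] MV NV Cons.prems(2) M(2) by auto
      then show False using lt by simp
    qed
  qed
  have "hn_type G z \<theta>s (V - N) T"
  proof (rule Cons.IH)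
    fix M assume M: "M \<subseteq> V - N" "M \<noteq> {}"
    show "phase z M \<in> set \<theta>s \<or> (\<forall>\<theta>\<in>set \<theta>s. \<theta> < phase z M)"
      using Cons.prems(4)[of M] M Cons.prems(3) by auto
  next
    fix M assume M: "closed_in G T (V - N) M" "M \<noteq> {}"
    then have "M \<subseteq> V" using closed_in_subset by blast
    then show "phase z M \<in> set \<theta>s"
      using Cons.prems(4)[of M] M(2) small[OF M] by auto
  qed (use Cons.prems in auto)
  then show ?case using piece by auto
qed

text \<open>
  Only arrows inside \<open>V\<close> matter, which separates the conditions on the parts of a filtered support.
\<close>

lemma closed_in_cong:
  assumes "T \<inter> arcs_between G V V = T' \<inter> arcs_between G V V" "T \<subseteq> arcs G" "T' \<subseteq> arcs G"
  shows "closed_in G T V M \<longleftrightarrow> closed_in G T' V M"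
proof -
  have "a \<in> T \<longleftrightarrow> a \<in> T'" if "tail G a \<in> V" "head G a \<in> V" for a
    using assms that unfolding arcs_between_def by blast
  then show ?thesis unfolding closed_in_def by blast
qed

lemma Int_arcs_between_mono:
  assumes "T \<inter> arcs_between G V V = T' \<inter> arcs_between G V V" "N \<subseteq> V"
  shows "T \<inter> arcs_between G N N = T' \<inter> arcs_between G N N"
  using assms unfolding arcs_between_def by blast

lemma phase_semistable_cong:
  assumes "T \<inter> arcs_between G V V = T' \<inter> arcs_between G V V" "T \<subseteq> arcs G" "T' \<subseteq> arcs G"
  shows "phase_semistable G z V T \<longleftrightarrow> phase_semistable G z V T'"
  unfolding phase_semistable_def closed_in_cong[OF assms] ..

lemma hn_type_cong:
  assumes "T \<inter> arcs_between G V V = T' \<inter> arcs_between G V V" "T \<subseteq> arcs G" "T' \<subseteq> arcs G"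
  shows "hn_type G z \<theta>s V T \<longleftrightarrow> hn_type G z \<theta>s V T'"
  using assms(1)
proof (induction \<theta>s arbitrary: V)
  case (Cons \<theta> \<theta>s)
  have "hn_piece G z \<theta> V T N \<and> hn_type G z \<theta>s (V - N) T \<longleftrightarrow>
      hn_piece G z \<theta> V T' N \<and> hn_type G z \<theta>s (V - N) T'" for N
  proof (cases "N \<subseteq> V")
    case True
    show ?thesis
      unfolding hn_piece_def closed_in_cong[OF Cons.prems assms(2,3)]
        phase_semistable_cong[OF Int_arcs_between_mono[OF Cons.prems True] assms(2,3)]
        Cons.IH[OF Int_arcs_between_mono[OF Cons.prems Diff_subset]] ..
  qed (auto simp: hn_piece_def closed_in_def)
  then show ?case by simp
qed simp

section \<open>Weighted sums over supports\<close>

definition semistable_sum ::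
    "('p, 'a) pre_digraph \<Rightarrow> ('p \<Rightarrow> complex) \<Rightarrow> 'r::comm_ring_1 \<Rightarrow> 'p set \<Rightarrow> 'r" where
  "semistable_sum G z y V = (\<Sum>T | T \<subseteq> arcs_between G V V \<and> phase_semistable G z V T. y ^ card T)"

definition hn_sum ::
    "('p, 'a) pre_digraph \<Rightarrow> ('p \<Rightarrow> complex) \<Rightarrow> 'r::comm_ring_1 \<Rightarrow> real list \<Rightarrow> 'p set \<Rightarrow> 'r" where
  "hn_sum G z y \<theta>s V = (\<Sum>T | T \<subseteq> arcs_between G V V \<and> hn_type G z \<theta>s V T. y ^ card T)"

text \<open>
  A support with first piece \<open>N\<close> consists of a semistable support on \<open>N\<close>, a support on \<open>V - N\<close> of the
  remaining type, and any arrows from \<open>V - N\<close> to \<open>N\<close>; arrows from \<open>N\<close> to \<open>V - N\<close> are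
  excluded since \<open>N\<close> is closed.
\<close>

lemma hn_stratum_sum:
  assumes fin: "finite (arcs_between G V V)" and NV: "N \<subseteq> V" and ph: "N = {} \<or> phase z N = \<theta>"
  shows "(\<Sum>T | T \<subseteq> arcs_between G V V \<and> hn_piece G z \<theta> V T N \<and> hn_type G z \<theta>s (V - N) T. y ^ card T)
    = semistable_sum G z y N * hn_sum G z y \<theta>s (V - N) *
      (y + 1 :: 'r::comm_ring_1) ^ card (arcs_between G (V - N) N)"
    (is "?lhs = ?rhs")
proof -
  let ?E = "arcs_between G V V" and ?E1 = "arcs_between G N N"
    and ?E2 = "arcs_between G (V - N) (V - N)" and ?E3 = "arcs_between G (V - N) N"
  let ?A = "{T. T \<subseteq> ?E1 \<and> phase_semistable G z N T}"
    and ?B = "{T. T \<subseteq> ?E2 \<and> hn_type G z \<theta>s (V - N) T}"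
  let ?S = "{T. T \<subseteq> ?E \<and> hn_piece G z \<theta> V T N \<and> hn_type G z \<theta>s (V - N) T}"
  have sub: "?E1 \<subseteq> ?E" "?E2 \<subseteq> ?E" "?E3 \<subseteq> ?E" using NV by (auto simp: arcs_between_def)
  then have finE: "finite ?E1" "finite ?E2" "finite ?E3" using fin finite_subset by blast+
  have disj: "?E1 \<inter> ?E2 = {}" "?E1 \<inter> ?E3 = {}" "?E2 \<inter> ?E3 = {}" by (auto simp: arcs_between_def)
  have arcs: "?E \<subseteq> arcs G" by (auto simp: arcs_between_def)
  have closed: "closed_in G T V N \<longleftrightarrow> T \<subseteq> ?E1 \<union> ?E2 \<union> ?E3" if "T \<subseteq> ?E" for T
  proof
    assume c: "closed_in G T V N"
    show "T \<subseteq> ?E1 \<union> ?E2 \<union> ?E3"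
    proof
      fix a assume a: "a \<in> T"
      then have "a \<in> arcs G" "tail G a \<in> V" "head G a \<in> V" using that by (auto simp: arcs_between_def)
      moreover have "tail G a \<in> N \<Longrightarrow> head G a \<in> N" using c a calculation unfolding closed_in_def by blast
      ultimately show "a \<in> ?E1 \<union> ?E2 \<union> ?E3" unfolding arcs_between_def by blast
    qed
  next
    assume "T \<subseteq> ?E1 \<union> ?E2 \<union> ?E3"
    then show "closed_in G T V N" using NV unfolding closed_in_def arcs_between_def by blast
  qed
  have decomp: "T1 = (T1 \<union> T2 \<union> T3) \<inter> ?E1" "T2 = (T1 \<union> T2 \<union> T3) \<inter> ?E2" "T3 = (T1 \<union> T2 \<union> T3) \<inter> ?E3"
    if "T1 \<subseteq> ?E1" "T2 \<subseteq> ?E2" "T3 \<subseteq> ?E3" for T1 T2 T3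
    using that disj by blast+
  have ss: "phase_semistable G z N T \<longleftrightarrow> phase_semistable G z N (T \<inter> ?E1)"
    and hn: "hn_type G z \<theta>s (V - N) T \<longleftrightarrow> hn_type G z \<theta>s (V - N) (T \<inter> ?E2)" if "T \<subseteq> ?E" for T
    using that arcs by (intro phase_semistable_cong hn_type_cong; blast)+
  have "?lhs = (\<Sum>(T1, T2, T3)\<in>?A \<times> ?B \<times> Pow ?E3. y ^ (card T1 + card T2 + card T3))"
  proof (rule sum.reindex_bij_witness[where j = "\<lambda>T. (T \<inter> ?E1, T \<inter> ?E2, T \<inter> ?E3)"
        and i = "\<lambda>(T1, T2, T3). T1 \<union> T2 \<union> T3"])
    fix T assume T: "T \<in> ?S"
    then have TE: "T \<subseteq> ?E" and cl: "T \<subseteq> ?E1 \<union> ?E2 \<union> ?E3"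
      using closed[of T] unfolding hn_piece_def by blast+
    then have eq: "T = T \<inter> ?E1 \<union> T \<inter> ?E2 \<union> T \<inter> ?E3" by blast
    then show "(case (T \<inter> ?E1, T \<inter> ?E2, T \<inter> ?E3) of (T1, T2, T3) \<Rightarrow> T1 \<union> T2 \<union> T3) = T" by simp
    show "(T \<inter> ?E1, T \<inter> ?E2, T \<inter> ?E3) \<in> ?A \<times> ?B \<times> Pow ?E3"
      using T ss[OF TE] hn[OF TE] by (simp add: hn_piece_def)
    have "card T = card (T \<inter> ?E1 \<union> T \<inter> ?E2 \<union> T \<inter> ?E3)" using eq by simp
    also have "\<dots> = card (T \<inter> ?E1 \<union> T \<inter> ?E2) + card (T \<inter> ?E3)"
      using finE disj by (intro card_Un_disjoint) auto
    also have "card (T \<inter> ?E1 \<union> T \<inter> ?E2) = card (T \<inter> ?E1) + card (T \<inter> ?E2)"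
      using finE disj by (intro card_Un_disjoint) auto
    finally show "(case (T \<inter> ?E1, T \<inter> ?E2, T \<inter> ?E3) of (T1, T2, T3) \<Rightarrow>
        y ^ (card T1 + card T2 + card T3)) = y ^ card T" by simp
  next
    fix w assume "w \<in> ?A \<times> ?B \<times> Pow ?E3"
    then obtain T1 T2 T3 where w: "w = (T1, T2, T3)" and A: "T1 \<in> ?A" and B: "T2 \<in> ?B"
      and C: "T3 \<subseteq> ?E3" by blast
    have s: "T1 \<subseteq> ?E1" "T2 \<subseteq> ?E2" using A B by blast+
    note d = decomp[OF s C]
    show "(case (case w of (T1, T2, T3) \<Rightarrow> T1 \<union> T2 \<union> T3) of T \<Rightarrow> (T \<inter> ?E1, T \<inter> ?E2, T \<inter> ?E3)) = w"
      using d w by simp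
    let ?T = "T1 \<union> T2 \<union> T3"
    have TE: "?T \<subseteq> ?E" using s C sub by blast
    have "closed_in G ?T V N" unfolding closed[OF TE] using s C by blast
    moreover have "phase_semistable G z N ?T" using ss[OF TE] d(1) A by simp
    moreover have "hn_type G z \<theta>s (V - N) ?T" using hn[OF TE] d(2) B by simp
    ultimately show "(case w of (T1, T2, T3) \<Rightarrow> T1 \<union> T2 \<union> T3) \<in> ?S"
      using TE ph w by (simp add: hn_piece_def)
  qed
  also have "\<dots> = (\<Sum>T1\<in>?A. \<Sum>T2\<in>?B. \<Sum>T3\<in>Pow ?E3. y ^ card T1 * y ^ card T2 * y ^ card T3)"
    by (simp add: sum.cartesian_product power_add case_prod_unfold)
  also have "\<dots> = semistable_sum G z y N * hn_sum G z y \<theta>s (V - N) * (\<Sum>T3\<in>Pow ?E3. y ^ card T3)"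
    unfolding semistable_sum_def hn_sum_def
    by (simp flip: sum_distrib_left sum_distrib_right)
  finally show ?thesis using sum_Pow_power_card[OF finE(3), of y] by simp
qed

lemma hn_sum_Nil: "hn_sum G z y [] V = (if V = {} then 1 else 0)"
proof -
  have "{T. T \<subseteq> arcs_between G V V \<and> V = {}} = (if V = {} then {{}} else {})"
    by (auto simp: arcs_between_def)
  then show ?thesis by (simp add: hn_sum_def)
qed

text \<open>
  Uniqueness of the first piece makes the strata for different \<open>N\<close> disjoint.
\<close>

lemma hn_sum_Cons:
  assumes fin: "finite V" "finite (arcs_between G V V)"
    and z: "\<And>p. p \<in> V \<Longrightarrow> z p \<in> upper_half_plane"
    and small: "\<And>\<theta>'. \<theta>' \<in> set \<theta>s \<Longrightarrow> \<theta>' < \<theta>"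
  shows "hn_sum G z y (\<theta> # \<theta>s) V =
    (\<Sum>N | N \<subseteq> V \<and> (N = {} \<or> phase z N = \<theta>). semistable_sum G z y N * hn_sum G z y \<theta>s (V - N) *
      (y + 1) ^ card (arcs_between G (V - N) N))"
proof -
  let ?\<N> = "{N. N \<subseteq> V \<and> (N = {} \<or> phase z N = \<theta>)}"
  let ?S = "\<lambda>N. {T. T \<subseteq> arcs_between G V V \<and> hn_piece G z \<theta> V T N \<and> hn_type G z \<theta>s (V - N) T}"
  have "{T. T \<subseteq> arcs_between G V V \<and> hn_type G z (\<theta> # \<theta>s) V T} = (\<Union>N\<in>?\<N>. ?S N)"
    by (auto simp: hn_piece_def closed_in_def)
  then have "hn_sum G z y (\<theta> # \<theta>s) V = (\<Sum>T\<in>(\<Union>N\<in>?\<N>. ?S N). y ^ card T)"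
    by (simp add: hn_sum_def)
  also have "\<dots> = (\<Sum>N\<in>?\<N>. \<Sum>T\<in>?S N. y ^ card T)"
  proof (rule sum.UNION_disjoint)
    show "finite ?\<N>" using fin(1) by simp
    show "\<forall>N\<in>?\<N>. finite (?S N)" using fin(2) by simp
    show "\<forall>N\<in>?\<N>. \<forall>N'\<in>?\<N>. N \<noteq> N' \<longrightarrow> ?S N \<inter> ?S N' = {}"
      using hn_piece_unique[where z = z and \<theta> = \<theta> and \<theta>s = \<theta>s, OF fin(1) z small] by blast
  qed
  also have "\<dots> = (\<Sum>N\<in>?\<N>. semistable_sum G z y N * hn_sum G z y \<theta>s (V - N) *
      (y + 1) ^ card (arcs_between G (V - N) N))"
    by (intro sum.cong refl hn_stratum_sum[OF fin(2)]) auto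
  finally show ?thesis .
qed

lemma hn_sum_total:
  assumes "finite V" "finite (arcs_between G V V)" "\<And>p. p \<in> V \<Longrightarrow> z p \<in> upper_half_plane"
    and "sorted_wrt (>) \<theta>s" and "\<And>M. M \<subseteq> V \<Longrightarrow> M \<noteq> {} \<Longrightarrow> phase z M \<in> set \<theta>s"
  shows "hn_sum G z y \<theta>s V = (y + 1) ^ card (arcs_between G V V)"
proof -
  have "hn_type G z \<theta>s V T" for T
    using assms by (intro hn_type_exists) (auto simp: closed_in_def)
  then have "hn_sum G z y \<theta>s V = (\<Sum>T\<in>Pow (arcs_between G V V). y ^ card T)"
    by (simp add: hn_sum_def Pow_def)
  then show ?thesis by (simp add: sum_Pow_power_card[OF assms(2)])
qed

section \<open>Dimension vectors as vertex sets\<close>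

text \<open>
  Infinitely many copies of every vertex, so that the quivers \<open>Q(\<alpha>)\<close> for all \<open>\<alpha>\<close>, and their parts,
  are full subquivers of a single one and are given by vertex sets.
\<close>

definition blowup :: "('v, 'e) pre_digraph \<Rightarrow> ('v \<times> nat, 'e \<times> nat \<times> nat) pre_digraph" where
  "blowup Q = \<lparr>
     verts = verts Q \<times> UNIV,
     arcs = arcs Q \<times> UNIV,
     tail = (\<lambda>(a, k, k'). (tail Q a, k)),
     head = (\<lambda>(a, k, k'). (head Q a, k')) \<rparr>"

definition vertex_set :: "('v \<Rightarrow>\<^sub>0 nat) \<Rightarrow> ('v \<times> nat) set" where
  "vertex_set \<alpha> = {(i, k). 1 \<le> k \<and> k \<le> Poly_Mapping.lookup \<alpha> i}"

definition dimv :: "('v \<times> nat) set \<Rightarrow> 'v \<Rightarrow>\<^sub>0 nat" where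
  "dimv N = (\<Sum>p\<in>N. Poly_Mapping.single (fst p) 1)"

lemma lookup_dimv:
  assumes "finite N"
  shows "Poly_Mapping.lookup (dimv N) i = card (N `` {i})"
proof -
  have "Poly_Mapping.lookup (dimv N) i = (\<Sum>p\<in>N. if fst p = i then 1 else 0)"
    by (auto simp: dimv_def lookup_sum lookup_single when_def intro!: sum.cong)
  also have "\<dots> = card (N \<inter> {p. fst p = i})" using assms by (simp add: sum.If_cases)
  also have "N \<inter> {p. fst p = i} = Pair i ` (N `` {i})" by auto
  finally show ?thesis by (simp add: card_image inj_on_def)
qed

lemma finite_slice: "finite N \<Longrightarrow> finite (N `` {i})"
  by (rule finite_Image)

lemma keys_dimv: "finite N \<Longrightarrow> Poly_Mapping.keys (dimv N) = fst ` N"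
  by (force simp: in_keys_iff lookup_dimv finite_slice card_eq_0_iff)

lemma dimv_empty: "dimv {} = 0"
  by (simp add: dimv_def)

lemma dimv_eq_0_iff: "finite N \<Longrightarrow> dimv N = 0 \<longleftrightarrow> N = {}"
  using keys_dimv[of N] by (auto simp: dimv_empty)

lemma dimv_Diff: "finite V \<Longrightarrow> N \<subseteq> V \<Longrightarrow> dimv N + dimv (V - N) = dimv V"
  unfolding dimv_def by (metis add.commute sum.subset_diff)

lemma finite_vertex_set: "finite (vertex_set \<alpha>)"
proof (rule finite_subset)
  show "vertex_set \<alpha> \<subseteq> Sigma (Poly_Mapping.keys \<alpha>) (\<lambda>i. {..Poly_Mapping.lookup \<alpha> i})"
    by (auto simp: vertex_set_def in_keys_iff)
qed simp

lemma vertex_set_subset: "\<alpha> \<in> Gamma_plus Q \<Longrightarrow> vertex_set \<alpha> \<subseteq> verts Q \<times> UNIV"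
  by (auto simp: vertex_set_def Gamma_plus_def in_keys_iff)

lemma dimv_vertex_set: "dimv (vertex_set \<alpha>) = \<alpha>"
proof (rule poly_mapping_eqI)
  fix i
  have "vertex_set \<alpha> `` {i} = {1..Poly_Mapping.lookup \<alpha> i}" by (auto simp: vertex_set_def)
  then show "Poly_Mapping.lookup (dimv (vertex_set \<alpha>)) i = Poly_Mapping.lookup \<alpha> i"
    by (simp add: lookup_dimv finite_vertex_set)
qed

lemma weight_dimv:
  assumes "finite N"
  shows "weight (dimv N) = card N"
proof -
  have "weight (dimv N) = (\<Sum>i\<in>fst ` N. card (N `` {i}))"
    by (simp add: weight_def keys_dimv lookup_dimv assms)
  also have "\<dots> = card (Sigma (fst ` N) (\<lambda>i. N `` {i}))" using assms by (simp add: finite_slice)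
  also have "Sigma (fst ` N) (\<lambda>i. N `` {i}) = N" by force
  finally show ?thesis .
qed

lemma Gamma_plus_dimv: "finite N \<Longrightarrow> dimv N \<in> Gamma_plus Q \<longleftrightarrow> N \<subseteq> verts Q \<times> UNIV"
  by (force simp: Gamma_plus_def keys_dimv)

lemma arcs_between_blowup:
  "arcs_between (blowup Q) A B =
    Sigma (arcs Q) (\<lambda>a. (A `` {tail Q a}) \<times> (B `` {head Q a}))"
  by (auto simp: arcs_between_def blowup_def)

lemma finite_arcs_from_to:
  assumes "quiver Q" "finite I" "finite J" "I \<subseteq> verts Q" "J \<subseteq> verts Q"
  shows "finite {a \<in> arcs Q. tail Q a \<in> I \<and> head Q a \<in> J}"
proof -
  have "{a \<in> arcs Q. tail Q a \<in> I \<and> head Q a \<in> J} =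
      (\<Union>i\<in>I. \<Union>j\<in>J. {a \<in> arcs Q. tail Q a = i \<and> head Q a = j})" by blast
  moreover have "finite {a \<in> arcs Q. tail Q a = i \<and> head Q a = j}" if "i \<in> I" "j \<in> J" for i j
    using assms that unfolding quiver_def by blast
  ultimately show ?thesis using assms(2,3) by simp
qed

lemma arcs_between_blowup_support:
  "arcs_between (blowup Q) A B =
    Sigma {a \<in> arcs Q. tail Q a \<in> fst ` A \<and> head Q a \<in> fst ` B}
      (\<lambda>a. (A `` {tail Q a}) \<times> (B `` {head Q a}))"
  unfolding arcs_between_blowup by force

lemma finite_arcs_between_blowup:
  assumes "quiver Q" "finite A" "finite B" "A \<subseteq> verts Q \<times> UNIV" "B \<subseteq> verts Q \<times> UNIV"
  shows "finite (arcs_between (blowup Q) A B)"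
  unfolding arcs_between_blowup_support using assms
  by (intro finite_SigmaI finite_arcs_from_to finite_cartesian_product finite_slice) auto

text \<open>
  Arrows of \<open>Q\<close> between fixed vertices are finite in number, so the sum in the form is finite and
  each arrow is counted once for every pair of copies of its ends.
\<close>

lemma rform_dimv:
  assumes "quiver Q" "finite A" "finite B" "A \<subseteq> verts Q \<times> UNIV" "B \<subseteq> verts Q \<times> UNIV"
  shows "rform Q (dimv A) (dimv B) = card (arcs_between (blowup Q) A B)"
proof -
  have "finite {a \<in> arcs Q. tail Q a \<in> fst ` A \<and> head Q a \<in> fst ` B}"
    using assms by (intro finite_arcs_from_to) auto
  then show ?thesis
    unfolding arcs_between_blowup_support rform_def keys_dimv[OF assms(2)] keys_dimv[OF assms(3)]
    using assms by (simp add: card_cartesian_product lookup_dimv finite_slice)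
qed

text \<open>
  Sums of these numbers over a vertex set are the values of \<open>Z\<close> and of the induced stability function.
\<close>

definition vertex_charge :: "(('v \<Rightarrow>\<^sub>0 int) \<Rightarrow> complex) \<Rightarrow> 'v \<times> nat \<Rightarrow> complex" where
  "vertex_charge Z p = Z (Poly_Mapping.single (fst p) 1)"

lemma vertex_charge_upper_half_plane:
  "stability Q Z \<Longrightarrow> p \<in> verts Q \<times> UNIV \<Longrightarrow> vertex_charge Z p \<in> upper_half_plane"
  by (auto simp: stability_def vertex_charge_def)

lemma to_Gamma_int_add: "to_Gamma_int (\<alpha> + \<beta>) = to_Gamma_int \<alpha> + to_Gamma_int \<beta>"
  by (rule poly_mapping_eqI) (simp add: map.rep_eq lookup_add when_def)

lemma to_Gamma_int_single: "to_Gamma_int (Poly_Mapping.single i 1) = Poly_Mapping.single i 1"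
  by (rule poly_mapping_eqI) (simp add: map.rep_eq lookup_single when_def)

lemma to_Gamma_int_mem: "\<alpha> \<in> Gamma_plus Q \<Longrightarrow> to_Gamma_int \<alpha> \<in> Gamma_int Q"
  by (auto simp: Gamma_plus_def Gamma_int_def in_keys_iff map.rep_eq when_def split: if_splits)

lemma stability_dimv:
  assumes Z: "stability Q Z" and "finite N" "N \<subseteq> verts Q \<times> UNIV"
  shows "Z (to_Gamma_int (dimv N)) = (\<Sum>p\<in>N. vertex_charge Z p)"
  using assms(2,3)
proof (induction N rule: finite_induct)
  case empty
  have "Z (0 + 0) = Z 0 + Z 0"
    using Z unfolding stability_def Gamma_int_def by (metis (no_types, lifting) empty_subsetI keys_zero mem_Collect_eq)
  moreover have "to_Gamma_int (dimv {}) = (0 :: 'a \<Rightarrow>\<^sub>0 int)"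
    by (rule poly_mapping_eqI) (simp add: dimv_empty map.rep_eq)
  ultimately show ?case by simp
next
  case (insert p N)
  have "Poly_Mapping.single (fst p) 1 \<in> Gamma_int Q" using insert.prems by (auto simp: Gamma_int_def)
  moreover have "to_Gamma_int (dimv N) \<in> Gamma_int Q"
    using insert by (intro to_Gamma_int_mem) (simp add: Gamma_plus_dimv)
  moreover have "dimv (insert p N) = Poly_Mapping.single (fst p) 1 + dimv N"
    using insert.hyps by (simp add: dimv_def)
  ultimately show ?case
    using Z insert unfolding stability_def
    by (simp add: to_Gamma_int_add to_Gamma_int_single vertex_charge_def)
qed

text \<open>
  Slopes are negative cotangents of arguments; after clearing denominators both comparisons are the
  sign of the determinant. Vanishing imaginary parts correspond to infinite slope and argument \<open>pi\<close>.
\<close>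

lemma slope_le_iff:
  assumes "Y (to_Gamma_int \<alpha>) \<in> upper_half_plane" "Y (to_Gamma_int \<beta>) \<in> upper_half_plane"
  shows "slope Y \<alpha> \<le> slope Y \<beta> \<longleftrightarrow> Arg (Y (to_Gamma_int \<alpha>)) \<le> Arg (Y (to_Gamma_int \<beta>))"
proof -
  let ?u = "Y (to_Gamma_int \<alpha>)" and ?v = "Y (to_Gamma_int \<beta>)"
  have "slope Y \<alpha> \<le> slope Y \<beta> \<longleftrightarrow> 0 \<le> cross ?u ?v"
  proof (cases "Im ?u = 0 \<or> Im ?v = 0")
    case True
    then show ?thesis
      using assms unfolding upper_half_plane_Im
      by (auto simp: slope_def Let_def cross_def mult_nonpos_nonneg mult_nonneg_nonpos mult_le_0_iff
        zero_le_mult_iff)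
  next
    case False
    then have "0 < Im ?u" "0 < Im ?v" using assms unfolding upper_half_plane_Im by auto
    then show ?thesis by (auto simp: slope_def Let_def cross_def field_simps)
  qed
  then show ?thesis using Arg_le_iff[OF assms] by simp
qed

section \<open>Semistable loci of abelian representations\<close>

lemma verts_abelian_quiver:
  "\<alpha> \<in> Gamma_plus Q \<Longrightarrow> verts (abelian_quiver Q \<alpha>) = vertex_set \<alpha>"
  by (auto simp: abelian_quiver_def vertex_set_def Gamma_plus_def in_keys_iff)

lemma arcs_abelian_quiver:
  "arcs (abelian_quiver Q \<alpha>) = arcs_between (blowup Q) (vertex_set \<alpha>) (vertex_set \<alpha>)"
  by (auto simp: abelian_quiver_def arcs_between_def blowup_def vertex_set_def)

lemma tail_abelian_quiver: "tail (abelian_quiver Q \<alpha>) = tail (blowup Q)"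
  and head_abelian_quiver: "head (abelian_quiver Q \<alpha>) = head (blowup Q)"
  by (simp_all add: abelian_quiver_def blowup_def)

lemma complex_line_span_1: "module.span (*) {1 :: complex} = UNIV"
  by (auto simp: vector_space_over_itself.span_singleton image_iff)

lemma complex_line_dim_UNIV: "vector_space.dim (*) (UNIV :: complex set) = 1"
  by (rule vector_space_over_itself.dim_unique[of "{1}"]) (simp_all add: complex_line_span_1)

lemma complex_line_dim_0: "vector_space.dim (*) {0 :: complex} = 0"
  by (simp add: vector_space_over_itself.dim_singleton)

lemma complex_line_subspace_cases:
  assumes "module.subspace (*) (S :: complex set)"
  shows "S = {0} \<or> S = UNIV"
proof (cases "S \<subseteq> {0}")
  case True
  then show ?thesis using vector_space_over_itself.subspace_0[OF assms] by blast
next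
  case False
  then obtain x where x: "x \<in> S" "x \<noteq> 0" by blast
  have "y \<in> S" for y using vector_space_over_itself.subspace_scale[OF assms x(1), of "y / x"] x(2) by simp
  then show ?thesis by blast
qed

lemma complex_line_linear: "Vector_Spaces.linear (*) (*) (\<lambda>v :: complex. c * v)"
  by unfold_locales (simp_all add: algebra_simps)

lemma lookup_dim_vector_complex_line:
  assumes fin: "finite (verts G)"
    and N: "\<And>i. i \<in> verts G \<Longrightarrow> N i = {0} \<or> N i = UNIV"
  shows "Poly_Mapping.lookup (dim_vector (*) G N :: 'p \<Rightarrow>\<^sub>0 nat) i =
    (if i \<in> verts G \<and> N i = (UNIV :: complex set) then 1 else 0)"
proof -
  have "finite {i. (if i \<in> verts G then vector_space.dim (*) (N i) else 0) \<noteq> 0}"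
    by (rule finite_subset[OF _ fin]) auto
  moreover have "(UNIV :: complex set) \<noteq> {0}" using zero_neq_one by blast
  ultimately show ?thesis
    using N[of i] unfolding dim_vector_def
    by (auto simp: complex_line_dim_UNIV complex_line_dim_0)
qed

lemma induced_stability_dim_vector:
  assumes fin: "finite (verts G)"
    and N: "\<And>i. i \<in> verts G \<Longrightarrow> N i = {0} \<or> N i = UNIV"
  shows "induced_stability Z (to_Gamma_int (dim_vector (*) G N)) =
    (\<Sum>p | p \<in> verts G \<and> N p = (UNIV :: complex set). vertex_charge Z p)"
proof -
  let ?d = "to_Gamma_int (dim_vector (*) G N)"
  have l: "Poly_Mapping.lookup ?d p = (if p \<in> verts G \<and> N p = UNIV then 1 else 0)" for p
    by (simp add: map.rep_eq lookup_dim_vector_complex_line[OF fin N])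
  then have "Poly_Mapping.keys ?d = {p. p \<in> verts G \<and> N p = UNIV}"
    by (intro set_eqI) (simp add: in_keys_iff)
  then show ?thesis unfolding induced_stability_def vertex_charge_def by (simp add: l)
qed

text \<open>
  The only subspaces of a line are zero and everything, so a subrepresentation is the set of vertices
  where it is everything. The case of the whole vertex set, excluded among proper subrepresentations,
  is trivial for phases.
\<close>

lemma semistable_iff_phase_semistable:
  assumes Z: "stability Q Z" and \<alpha>: "\<alpha> \<in> Gamma_plus Q"
    and m: "{a. m a \<noteq> 0} \<subseteq> arcs (abelian_quiver Q \<alpha>)"
  shows "semistable (*) (abelian_quiver Q \<alpha>) (induced_stability Z) (\<lambda>_. UNIV) (\<lambda>a v. m a * v) \<longleftrightarrow>
    phase_semistable (blowup Q) (vertex_charge Z) (vertex_set \<alpha>) {a. m a \<noteq> 0}"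
proof -
  let ?G = "abelian_quiver Q \<alpha>" and ?V = "vertex_set \<alpha>" and ?T = "{a. m a \<noteq> 0}"
    and ?M = "\<lambda>a v. m a * v"
  have V: "verts ?G = ?V" by (rule verts_abelian_quiver[OF \<alpha>])
  have fin: "finite (verts ?G)" by (simp add: V finite_vertex_set)
  have nontriv: "(UNIV :: complex set) \<noteq> {0}" using zero_neq_one by blast
  have VQ: "?V \<subseteq> verts Q \<times> UNIV" by (rule vertex_set_subset[OF \<alpha>])
  have uhp: "(\<Sum>p\<in>M. vertex_charge Z p) \<in> upper_half_plane" if "M \<subseteq> ?V" "M \<noteq> {}" for M
    using that VQ finite_subset[OF that(1) finite_vertex_set]
    by (intro sum_upper_half_plane vertex_charge_upper_half_plane[OF Z]) auto
  have rep: "quiver_representation (*) ?G (\<lambda>_. UNIV) ?M"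
    unfolding quiver_representation_def
    using complex_line_linear complex_line_span_1
    by (auto intro!: exI[of _ "{1}"] simp: vector_space_over_itself.subspace_UNIV)
  define supp where "supp N = {p \<in> ?V. N p = UNIV}" for N :: "'a \<times> nat \<Rightarrow> complex set"
  have slope: "slope (induced_stability Z) (dim_vector (*) ?G N) \<le>
      slope (induced_stability Z) (dim_vector (*) ?G (\<lambda>_. UNIV)) \<longleftrightarrow>
      phase (vertex_charge Z) (supp N) \<le> phase (vertex_charge Z) ?V"
    if N: "\<And>p. p \<in> ?V \<Longrightarrow> N p = {0} \<or> N p = UNIV" and ne: "supp N \<noteq> {}" for N
  proof -
    have 1: "induced_stability Z (to_Gamma_int (dim_vector (*) ?G N)) = (\<Sum>p\<in>supp N. vertex_charge Z p)"
      using induced_stability_dim_vector[OF fin, of N Z] N by (simp add: V supp_def)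
    have 2: "induced_stability Z (to_Gamma_int (dim_vector (*) ?G (\<lambda>_. UNIV))) =
        (\<Sum>p\<in>?V. vertex_charge Z p)"
      using induced_stability_dim_vector[OF fin, of "\<lambda>_. UNIV" Z] by (simp add: V)
    have "supp N \<subseteq> ?V" "?V \<noteq> {}" using ne by (auto simp: supp_def)
    then show ?thesis
      using slope_le_iff[of "induced_stability Z"] uhp ne by (simp add: 1 2 phase_def)
  qed
  show ?thesis
  proof
    assume ss: "semistable (*) ?G (induced_stability Z) (\<lambda>_. UNIV) ?M"
    show "phase_semistable (blowup Q) (vertex_charge Z) ?V ?T"
      unfolding phase_semistable_def
    proof (intro allI impI, elim conjE)
      fix M assume M: "closed_in (blowup Q) ?T ?V M" and ne: "M \<noteq> {}"
      show "phase (vertex_charge Z) M \<le> phase (vertex_charge Z) ?V"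
      proof (cases "M = ?V")
        case False
        let ?N = "\<lambda>p. if p \<in> M then UNIV else {0} :: complex set"
        have MV: "M \<subseteq> ?V" using M by (rule closed_in_subset)
        have supp: "supp ?N = M" using MV nontriv by (auto simp: supp_def)
        have "subrepresentation (*) ?G ?N (\<lambda>_. UNIV) ?M"
          unfolding subrepresentation_def
        proof (intro conjI ballI)
          fix a assume a: "a \<in> arcs ?G"
          have "head ?G a \<in> ?V"
            using a unfolding arcs_abelian_quiver head_abelian_quiver arcs_between_def by blast
          then have "m a = 0" if "tail ?G a \<in> M" "head ?G a \<notin> M"
            using M that unfolding closed_in_def tail_abelian_quiver head_abelian_quiver by blast
          then show "?M a ` ?N (tail ?G a) \<subseteq> ?N (head ?G a)" by auto
        qed (auto simp: vector_space_over_itself.subspace_UNIV vector_space_over_itself.subspace_single_0)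
        moreover have "\<exists>p\<in>verts ?G. ?N p \<noteq> {0}" using ne MV nontriv unfolding V by auto
        moreover have "\<exists>p\<in>verts ?G. ?N p \<noteq> UNIV" using False MV nontriv unfolding V by auto
        ultimately have "slope (induced_stability Z) (dim_vector (*) ?G ?N) \<le>
            slope (induced_stability Z) (dim_vector (*) ?G (\<lambda>_. UNIV))"
          using ss unfolding semistable_def by blast
        then show ?thesis using slope[of ?N] supp ne by auto
      qed simp
    qed
  next
    assume ss: "phase_semistable (blowup Q) (vertex_charge Z) ?V ?T"
    show "semistable (*) ?G (induced_stability Z) (\<lambda>_. UNIV) ?M"
      unfolding semistable_def
    proof (intro conjI rep allI impI, elim conjE)
      fix N assume sub: "subrepresentation (*) ?G N (\<lambda>_. UNIV) ?M"
        and ne: "\<exists>i\<in>verts ?G. N i \<noteq> {0}"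
      have N: "N p = {0} \<or> N p = UNIV" if "p \<in> ?V" for p
        using sub that complex_line_subspace_cases unfolding subrepresentation_def V by blast
      have ne': "supp N \<noteq> {}" using ne N unfolding V supp_def by blast
      have "closed_in (blowup Q) ?T ?V (supp N)"
        unfolding closed_in_def
      proof (intro conjI ballI impI)
        fix a assume a: "a \<in> ?T" "tail (blowup Q) a \<in> supp N" "head (blowup Q) a \<in> ?V"
        then have "m a * 1 \<in> N (head ?G a)"
          using sub m unfolding subrepresentation_def tail_abelian_quiver supp_def by blast
        then have "N (head ?G a) \<noteq> {0}" using a(1) by auto
        then show "head (blowup Q) a \<in> supp N"
          using N[OF a(3)] a(3) by (simp add: head_abelian_quiver supp_def)
      qed (auto simp: supp_def)
      then show "slope (induced_stability Z) (dim_vector (*) ?G N) \<le>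
            slope (induced_stability Z) (dim_vector (*) ?G (\<lambda>_. UNIV))"
        using ss ne' slope[OF N ne'] unfolding phase_semistable_def by blast
    qed
  qed
qed

lemma semistable_locus_support_locus:
  assumes Z: "stability Q Z" and \<alpha>: "\<alpha> \<in> Gamma_plus Q"
  shows "semistable_locus Q Z \<alpha> = support_locus {T. T \<subseteq> arcs (abelian_quiver Q \<alpha>) \<and>
    phase_semistable (blowup Q) (vertex_charge Z) (vertex_set \<alpha>) T}"
proof -
  have "m \<in> affine_points I \<longleftrightarrow> {a. m a \<noteq> 0} \<subseteq> I" for m and I :: "('b \<times> nat \<times> nat) set"
    by (auto simp: affine_points_def)
  then show ?thesis
    unfolding semistable_locus_def support_locus_def
    using semistable_iff_phase_semistable[OF Z \<alpha>] by blast
qed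

lemma phase_semistable_mono:
  assumes "phase_semistable G z V T" "T \<subseteq> T'"
  shows "phase_semistable G z V T'"
proof -
  have "closed_in G T V M" if "closed_in G T' V M" for M
    using that assms(2) unfolding closed_in_def by blast
  then show ?thesis using assms(1) unfolding phase_semistable_def by simp
qed

text \<open>
  More arrows in the support mean fewer closed sets, so the semistable supports are upward closed.
\<close>

lemma mot_class_R_Z:
  assumes Q: "quiver Q" and Z: "stability Q Z" and \<alpha>: "\<alpha> \<in> Gamma_plus Q"
  shows "mot_class (R_Z Q Z \<alpha>) =
    mot_scalar (semistable_sum (blowup Q) (vertex_charge Z) (sqrt_L ^ 2 - 1) (vertex_set \<alpha>))"
proof -
  let ?E = "arcs (abelian_quiver Q \<alpha>)"
  let ?U = "{T. T \<subseteq> ?E \<and> phase_semistable (blowup Q) (vertex_charge Z) (vertex_set \<alpha>) T}"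
  have VQ: "vertex_set \<alpha> \<subseteq> verts Q \<times> UNIV" by (rule vertex_set_subset[OF \<alpha>])
  have fin: "finite ?E"
    unfolding arcs_abelian_quiver
    by (rule finite_arcs_between_blowup[OF Q finite_vertex_set finite_vertex_set VQ VQ])
  have "upward_closed ?E ?U"
    unfolding upward_closed_def using phase_semistable_mono by fastforce
  from mot_class_support_locus[OF fin this] show ?thesis
    unfolding R_Z_def semistable_locus_support_locus[OF Z \<alpha>] semistable_sum_def arcs_abelian_quiver .
qed

section \<open>Relabelling and counting\<close>

lemma semistable_sum_bij:
  assumes f: "bij_betw f V V'" and F: "bij_betw F (arcs_between G V V) (arcs_between G V' V')"
    and tl: "\<And>a. a \<in> arcs_between G V V \<Longrightarrow> tail G (F a) = f (tail G a)"
    and hd: "\<And>a. a \<in> arcs_between G V V \<Longrightarrow> head G (F a) = f (head G a)"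
    and z: "\<And>p. p \<in> V \<Longrightarrow> z (f p) = z p"
  shows "semistable_sum G z y V = semistable_sum G z y V'"
proof -
  let ?E = "arcs_between G V V" and ?E' = "arcs_between G V' V'"
  have inj: "inj_on f V" and im: "f ` V = V'" using f by (auto simp: bij_betw_def)
  have injF: "inj_on F ?E" and imF: "F ` ?E = ?E'" using F by (auto simp: bij_betw_def)
  have ph: "phase z (f ` M) = phase z M" if "M \<subseteq> V" for M
  proof -
    have "(\<Sum>p\<in>f ` M. z p) = (\<Sum>p\<in>M. z (f p))"
      using inj_on_subset[OF inj that] by (simp add: sum.reindex)
    also have "\<dots> = (\<Sum>p\<in>M. z p)" using z that by (intro sum.cong) auto
    finally show ?thesis by (simp add: phase_def)
  qed
  have closed: "closed_in G (F ` T) V' (f ` M) \<longleftrightarrow> closed_in G T V M" if T: "T \<subseteq> ?E" and M: "M \<subseteq> V" for T M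
  proof -
    have ends: "tail G a \<in> V" "head G a \<in> V" if "a \<in> T" for a
      using that T unfolding arcs_between_def by blast+
    have mem: "f p \<in> f ` M \<longleftrightarrow> p \<in> M" if "p \<in> V" for p
      using inj_on_image_mem_iff[OF inj that M] .
    have "(tail G (F a) \<in> f ` M \<longrightarrow> head G (F a) \<in> V' \<longrightarrow> head G (F a) \<in> f ` M) \<longleftrightarrow>
        (tail G a \<in> M \<longrightarrow> head G a \<in> V \<longrightarrow> head G a \<in> M)" if "a \<in> T" for a
      using that T ends[OF that] mem im by (auto simp: tl hd subset_iff)
    then show ?thesis unfolding closed_in_def using M im by auto
  qed
  have ss: "phase_semistable G z V' (F ` T) \<longleftrightarrow> phase_semistable G z V T" if T: "T \<subseteq> ?E" for T
  proof
    assume s: "phase_semistable G z V' (F ` T)"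
    show "phase_semistable G z V T" unfolding phase_semistable_def
    proof (intro allI impI, elim conjE)
      fix M assume M: "closed_in G T V M" "M \<noteq> {}"
      then have MV: "M \<subseteq> V" by (simp add: closed_in_def)
      have "phase z (f ` M) \<le> phase z V'"
        using s M closed[OF T MV] unfolding phase_semistable_def by simp
      then show "phase z M \<le> phase z V" using ph[OF MV] ph[of V] im by simp
    qed
  next
    assume s: "phase_semistable G z V T"
    show "phase_semistable G z V' (F ` T)" unfolding phase_semistable_def
    proof (intro allI impI, elim conjE)
      fix M' assume M': "closed_in G (F ` T) V' M'" "M' \<noteq> {}"
      then have "M' \<subseteq> f ` V" by (simp add: closed_in_def im)
      then obtain M where M: "M \<subseteq> V" "M' = f ` M" by (rule subset_imageE)
      then have "phase z M \<le> phase z V"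
        using s M' closed[OF T M(1)] unfolding phase_semistable_def by simp
      then show "phase z M' \<le> phase z V'" using ph[OF M(1)] ph[of V] im M(2) by simp
    qed
  qed
  show ?thesis unfolding semistable_sum_def
  proof (rule sum.reindex_cong[of "(`) F", symmetric])
    have "inj_on ((`) F) (Pow ?E)" by (rule inj_on_image_Pow[OF injF])
    then show "inj_on ((`) F) {T. T \<subseteq> ?E \<and> phase_semistable G z V T}"
      by (rule inj_on_subset) auto
    show "{T. T \<subseteq> ?E' \<and> phase_semistable G z V' T} =
        (`) F ` {T. T \<subseteq> ?E \<and> phase_semistable G z V T}"
    proof (intro equalityI subsetI)
      fix T' assume T': "T' \<in> {T. T \<subseteq> ?E' \<and> phase_semistable G z V' T}"
      then have "T' \<subseteq> F ` ?E" by (simp add: imF)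
      then obtain T where "T \<subseteq> ?E" "T' = F ` T" by (rule subset_imageE)
      then show "T' \<in> (`) F ` {T. T \<subseteq> ?E \<and> phase_semistable G z V T}" using T' ss by auto
    qed (use ss imF in auto)
    fix T assume "T \<in> {T. T \<subseteq> ?E \<and> phase_semistable G z V T}"
    then have "inj_on F T" using inj_on_subset[OF injF] by blast
    then show "y ^ card (F ` T) = y ^ card T" by (simp add: card_image)
  qed
qed

text \<open>
  Vertex sets with the same dimension vector differ by a permutation of the copies of each vertex,
  which carries arrows to arrows and preserves charges.
\<close>

lemma semistable_sum_dimv:
  assumes fin: "finite N" "finite N'" and eq: "dimv N = dimv N'"
  shows "semistable_sum (blowup Q) (vertex_charge Z) y N =
    semistable_sum (blowup Q) (vertex_charge Z) y N'"
proof -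
  have "card (N `` {i}) = card (N' `` {i})" for i
    using lookup_dimv[OF fin(1), of i] lookup_dimv[OF fin(2), of i] eq by simp
  then have "\<exists>h. bij_betw h (N `` {i}) (N' `` {i})" for i
    by (intro finite_same_card_bij finite_slice fin)
  then obtain h where h: "\<And>i. bij_betw (h i) (N `` {i}) (N' `` {i})" by metis
  have maps: "h i k \<in> N' `` {i}" if "k \<in> N `` {i}" for i k
    using h[of i] that by (rule bij_betw_apply)
  have inj: "k = k'" if "k \<in> N `` {i}" "k' \<in> N `` {i}" "h i k = h i k'" for i k k'
    using h[of i] that by (auto simp: bij_betw_def inj_on_def)
  have surj: "\<exists>k\<in>N `` {i}. h i k = k'" if "k' \<in> N' `` {i}" for i k'
  proof -
    have "k' \<in> h i ` (N `` {i})" using h[of i] that by (simp only: bij_betw_def)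
    then show ?thesis by blast
  qed
  let ?f = "\<lambda>(i, k). (i, h i k)" and ?F = "\<lambda>(a, k, k'). (a, h (tail Q a) k, h (head Q a) k')"
  show ?thesis
  proof (rule semistable_sum_bij[of ?f _ _ ?F])
    show "bij_betw ?f N N'"
      unfolding bij_betw_def inj_on_def
    proof (intro conjI equalityI subsetI)
      show "\<forall>p\<in>N. \<forall>q\<in>N. ?f p = ?f q \<longrightarrow> p = q" using inj by auto
      show "p \<in> N'" if "p \<in> ?f ` N" for p using maps that by auto
      fix p assume "p \<in> N'"
      then show "p \<in> ?f ` N" using surj[of "snd p" "fst p"] by (force simp: image_iff)
    qed
    show "bij_betw ?F (arcs_between (blowup Q) N N) (arcs_between (blowup Q) N' N')"
      unfolding bij_betw_def inj_on_def arcs_between_blowup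
    proof (intro conjI equalityI subsetI)
      show "\<forall>a\<in>Sigma (arcs Q) (\<lambda>a. N `` {tail Q a} \<times> N `` {head Q a}).
          \<forall>b\<in>Sigma (arcs Q) (\<lambda>a. N `` {tail Q a} \<times> N `` {head Q a}). ?F a = ?F b \<longrightarrow> a = b"
        using inj by auto
      show "b \<in> Sigma (arcs Q) (\<lambda>a. N' `` {tail Q a} \<times> N' `` {head Q a})"
        if "b \<in> ?F ` Sigma (arcs Q) (\<lambda>a. N `` {tail Q a} \<times> N `` {head Q a})" for b
        using maps that by auto
      fix b assume "b \<in> Sigma (arcs Q) (\<lambda>a. N' `` {tail Q a} \<times> N' `` {head Q a})"
      then obtain a k k' where b: "b = (a, k, k')" "a \<in> arcs Q" "k \<in> N' `` {tail Q a}"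
        "k' \<in> N' `` {head Q a}" by blast
      from surj[OF b(3)] obtain l where l: "l \<in> N `` {tail Q a}" "h (tail Q a) l = k" by blast
      from surj[OF b(4)] obtain l' where l': "l' \<in> N `` {head Q a}" "h (head Q a) l' = k'" by blast
      show "b \<in> ?F ` Sigma (arcs Q) (\<lambda>a. N `` {tail Q a} \<times> N `` {head Q a})"
        by (rule image_eqI[of _ _ "(a, l, l')"]) (use b l l' in auto)
    qed
  qed (auto simp: blowup_def vertex_charge_def)
qed

text \<open>
  A vertex subset is a choice of \<open>\<beta> i\<close> of the copies of \<open>i\<close> for every \<open>i\<close>.
\<close>

lemma card_subsets_dimv:
  assumes fin: "finite V" and eq: "\<beta> + \<gamma> = dimv V"
  shows "card {N. N \<subseteq> V \<and> dimv N = \<beta>} * (vfact \<beta> * vfact \<gamma>) = vfact (dimv V)"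
proof -
  let ?I = "fst ` V" and ?b = "Poly_Mapping.lookup \<beta>" and ?c = "Poly_Mapping.lookup \<gamma>"
  have finI: "finite ?I" using fin by simp
  have add: "?b i + ?c i = card (V `` {i})" for i
    using lookup_dimv[OF fin, of i] by (simp add: lookup_add flip: eq)
  have keys: "Poly_Mapping.keys \<beta> \<subseteq> ?I" "Poly_Mapping.keys \<gamma> \<subseteq> ?I"
  proof -
    have "V `` {i} = {}" if "i \<notin> ?I" for i using that by force
    then have zero: "?b i = 0 \<and> ?c i = 0" if "i \<notin> ?I" for i using add[of i] that by simp
    show "Poly_Mapping.keys \<beta> \<subseteq> ?I"
      by (rule subsetI, rule ccontr) (use zero in \<open>simp add: in_keys_iff\<close>)
    show "Poly_Mapping.keys \<gamma> \<subseteq> ?I"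
      by (rule subsetI, rule ccontr) (use zero in \<open>simp add: in_keys_iff\<close>)
  qed
  have vf: "vfact \<delta> = (\<Prod>i\<in>?I. fact (Poly_Mapping.lookup \<delta> i))" if "Poly_Mapping.keys \<delta> \<subseteq> ?I" for \<delta>
    unfolding vfact_def using that finI
    by (intro prod.mono_neutral_left) (auto simp: in_keys_iff)
  let ?P = "PiE ?I (\<lambda>i. {K. K \<subseteq> V `` {i} \<and> card K = ?b i})"
  have "bij_betw (Sigma ?I) ?P {N. N \<subseteq> V \<and> dimv N = \<beta>}"
  proof (rule bij_betwI[where g = "\<lambda>N. \<lambda>i\<in>?I. N `` {i}"])
    show "Sigma ?I \<in> ?P \<rightarrow> {N. N \<subseteq> V \<and> dimv N = \<beta>}"
    proof
      fix K assume K: "K \<in> ?P"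
      have sub: "Sigma ?I K \<subseteq> V" using K by (fastforce simp: PiE_iff)
      have "dimv (Sigma ?I K) = \<beta>"
      proof (rule poly_mapping_eqI)
        fix i
        have "Sigma ?I K `` {i} = (if i \<in> ?I then K i else {})" by auto
        then show "Poly_Mapping.lookup (dimv (Sigma ?I K)) i = ?b i"
          using K keys(1) by (auto simp: lookup_dimv[OF finite_subset[OF sub fin]] PiE_iff in_keys_iff)
      qed
      with sub show "Sigma ?I K \<in> {N. N \<subseteq> V \<and> dimv N = \<beta>}" by simp
    qed
    show "(\<lambda>N. \<lambda>i\<in>?I. N `` {i}) \<in> {N. N \<subseteq> V \<and> dimv N = \<beta>} \<rightarrow> ?P"
    proof
      fix N assume N: "N \<in> {N. N \<subseteq> V \<and> dimv N = \<beta>}"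
      then have finN: "finite N" using fin by (auto intro: finite_subset)
      have "N `` {i} \<subseteq> V `` {i}" "card (N `` {i}) = ?b i" for i
        using N lookup_dimv[OF finN, of i] by auto
      then show "(\<lambda>i\<in>?I. N `` {i}) \<in> ?P" by (simp add: PiE_iff)
    qed
    show "(\<lambda>i\<in>?I. Sigma ?I K `` {i}) = K" if "K \<in> ?P" for K
    proof
      fix i
      show "(\<lambda>i\<in>?I. Sigma ?I K `` {i}) i = K i"
      proof (cases "i \<in> ?I")
        case True
        then have "Sigma ?I K `` {i} = K i" by blast
        then show ?thesis using True by simp
      next
        case False
        then show ?thesis using PiE_arb[OF that False] by simp
      qed
    qed
    show "Sigma ?I (\<lambda>i\<in>?I. N `` {i}) = N" if "N \<in> {N. N \<subseteq> V \<and> dimv N = \<beta>}" for N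
    proof (intro equalityI subsetI)
      fix p assume p: "p \<in> N"
      then have "fst p \<in> ?I" using that by blast
      then show "p \<in> Sigma ?I (\<lambda>i\<in>?I. N `` {i})" using p by (cases p) simp
    next
      fix p assume "p \<in> Sigma ?I (\<lambda>i\<in>?I. N `` {i})"
      then show "p \<in> N" by (cases p) (simp split: if_splits)
    qed
  qed
  then have "card {N. N \<subseteq> V \<and> dimv N = \<beta>} = card ?P" by (rule bij_betw_same_card[symmetric])
  also have "\<dots> = (\<Prod>i\<in>?I. card (V `` {i}) choose ?b i)"
    using finI by (simp add: card_PiE n_subsets finite_slice fin)
  finally have "card {N. N \<subseteq> V \<and> dimv N = \<beta>} * (vfact \<beta> * vfact \<gamma>) =
      (\<Prod>i\<in>?I. (card (V `` {i}) choose ?b i) * (fact (?b i) * fact (?c i)))"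
    by (simp add: vf keys prod.distrib)
  also have "\<dots> = (\<Prod>i\<in>?I. fact (card (V `` {i})))"
  proof (rule prod.cong[OF refl])
    fix i
    have "?c i = card (V `` {i}) - ?b i" "?b i \<le> card (V `` {i})" using add[of i] by simp_all
    then show "(card (V `` {i}) choose ?b i) * (fact (?b i) * fact (?c i)) = fact (card (V `` {i}))"
      using binomial_fact_lemma[of "?b i" "card (V `` {i})"] by (simp add: mult.commute)
  qed
  also have "\<dots> = vfact (dimv V)"
    by (simp add: vfact_def keys_dimv[OF fin] lookup_dimv[OF fin])
  finally show ?thesis .
qed

lemma vfact_pos: "0 < vfact \<alpha>"
  by (simp add: vfact_def prod_pos)

text \<open>
  Splittings of a dimension vector are replaced by splittings of a vertex set, each weighted by the
  inverse of the number of splittings with the same dimension vectors.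
\<close>

lemma qt_times_dimv:
  assumes fin: "finite V"
  shows "qt_times Q F G (dimv V) = (\<Sum>N\<in>Pow V.
    mot_scalar (sqrt_L powi skew_form Q (dimv N) (dimv (V - N)) /
      of_nat (card {N'. N' \<subseteq> V \<and> dimv N' = dimv N})) * F (dimv N) * G (dimv (V - N)))"
proof -
  let ?D = "\<lambda>N. (dimv N, dimv (V - N))" and ?T = "{(\<beta>, \<gamma>). \<beta> + \<gamma> = dimv V}"
  let ?C = "\<lambda>\<beta>. {N. N \<subseteq> V \<and> dimv N = \<beta>}"
  let ?h = "\<lambda>\<beta> \<gamma>. mot_scalar (sqrt_L powi skew_form Q \<beta> \<gamma> / of_nat (card (?C \<beta>))) * F \<beta> * G \<gamma>"
  have fiber: "{N \<in> Pow V. ?D N = (\<beta>, \<gamma>)} = ?C \<beta>" if "\<beta> + \<gamma> = dimv V" for \<beta> \<gamma>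
  proof -
    have "dimv (V - N) = \<gamma>" if "N \<subseteq> V" "dimv N = \<beta>" for N
      using dimv_Diff[OF fin that(1)] that(2) \<open>\<beta> + \<gamma> = dimv V\<close> by (metis add_left_cancel)
    then show ?thesis by auto
  qed
  have pos: "card (?C \<beta>) \<noteq> 0" if "\<beta> + \<gamma> = dimv V" for \<beta> \<gamma>
    using card_subsets_dimv[OF fin that] vfact_pos[of "dimv V"] by (intro notI) simp
  have sub: "?D ` Pow V \<subseteq> ?T" using dimv_Diff[OF fin] by auto
  moreover have "?T \<subseteq> ?D ` Pow V"
  proof
    fix w assume "w \<in> ?T"
    then obtain \<beta> \<gamma> where w: "w = (\<beta>, \<gamma>)" "\<beta> + \<gamma> = dimv V" by blast
    from pos[OF w(2)] have "?C \<beta> \<noteq> {}" by (intro notI) simp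
    then obtain N where "N \<in> {N \<in> Pow V. ?D N = (\<beta>, \<gamma>)}" unfolding fiber[OF w(2), symmetric] by blast
    then show "w \<in> ?D ` Pow V" unfolding w(1) by (intro image_eqI[of _ _ N]) auto
  qed
  ultimately have T: "finite ?T"
    by (intro finite_subset[of ?T "?D ` Pow V"] finite_imageI) (simp_all add: fin)
  have "(\<Sum>N\<in>Pow V. case ?D N of (\<beta>, \<gamma>) \<Rightarrow> ?h \<beta> \<gamma>) =
      (\<Sum>w\<in>?T. \<Sum>N\<in>{N \<in> Pow V. ?D N = w}. case ?D N of (\<beta>, \<gamma>) \<Rightarrow> ?h \<beta> \<gamma>)"
    using fin T sub by (intro sum.group[symmetric]) simp_all
  also have "\<dots> = (\<Sum>(\<beta>, \<gamma>)\<in>?T. mot_scalar (sqrt_L powi skew_form Q \<beta> \<gamma>) * F \<beta> * G \<gamma>)"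
  proof (rule sum.cong[OF refl])
    fix w assume "w \<in> ?T"
    then obtain \<beta> \<gamma> where w: "w = (\<beta>, \<gamma>)" "\<beta> + \<gamma> = dimv V" by blast
    have "(\<Sum>N\<in>{N \<in> Pow V. ?D N = w}. case ?D N of (\<beta>, \<gamma>) \<Rightarrow> ?h \<beta> \<gamma>) =
        (\<Sum>N\<in>{N \<in> Pow V. ?D N = w}. ?h \<beta> \<gamma>)"
      by (rule sum.cong[OF refl]) (simp add: w(1))
    also have "\<dots> = (\<Sum>N\<in>?C \<beta>. ?h \<beta> \<gamma>)" unfolding w(1) fiber[OF w(2)] ..
    also have "\<dots> = mot_scalar (\<Sum>N\<in>?C \<beta>. sqrt_L powi skew_form Q \<beta> \<gamma> / of_nat (card (?C \<beta>))) * F \<beta> * G \<gamma>"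
      unfolding mot_scalar_sum by (simp add: sum_distrib_right)
    also have "(\<Sum>N\<in>?C \<beta>. sqrt_L powi skew_form Q \<beta> \<gamma> / of_nat (card (?C \<beta>))) =
        sqrt_L powi skew_form Q \<beta> \<gamma>"
      using pos[OF w(2)] by simp
    finally show "(\<Sum>N\<in>{N \<in> Pow V. ?D N = w}. case ?D N of (\<beta>, \<gamma>) \<Rightarrow> ?h \<beta> \<gamma>) =
        (case w of (\<beta>, \<gamma>) \<Rightarrow> mot_scalar (sqrt_L powi skew_form Q \<beta> \<gamma>) * F \<beta> * G \<gamma>)"
      by (simp add: w(1))
  qed
  finally show ?thesis unfolding qt_times_def by simp
qed

section \<open>Products over rays\<close>

lemma sqrt_L_nonzero: "sqrt_L \<noteq> 0"
  by (simp add: sqrt_L_def Zero_fract_def eq_fract)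

text \<open>
  The factor of \<open>f_Z\<close> in front of the class, together with the factorial from the generating series.
\<close>

definition normalization_factor :: "('v, 'e) pre_digraph \<Rightarrow> ('v \<Rightarrow>\<^sub>0 nat) \<Rightarrow> ratfun" where
  "normalization_factor Q \<alpha> =
     sqrt_L powi (int (weight \<alpha>) - int (rform Q \<alpha> \<alpha>)) / (sqrt_L ^ 2 - 1) ^ weight \<alpha> / of_nat (vfact \<alpha>)"

lemma normalization_factor_zero: "normalization_factor Q 0 = 1"
  by (simp add: normalization_factor_def weight_def rform_def vfact_def)

lemma card_arcs_between_Diff:
  assumes "finite (arcs_between G V V)" "N \<subseteq> V"
  shows "card (arcs_between G V V) = card (arcs_between G N N) + card (arcs_between G (V - N) (V - N))
    + card (arcs_between G N (V - N)) + card (arcs_between G (V - N) N)"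
proof -
  let ?M = "V - N"
  have V: "arcs_between G V V = arcs_between G N N \<union> (arcs_between G ?M ?M \<union>
      (arcs_between G N ?M \<union> arcs_between G ?M N))"
    using assms(2) by (auto simp: arcs_between_def)
  have fin: "finite (arcs_between G N N)" "finite (arcs_between G ?M ?M)"
    "finite (arcs_between G N ?M)" "finite (arcs_between G ?M N)"
    using assms(1) unfolding V by simp_all
  show ?thesis
    unfolding V using fin by (subst card_Un_disjoint; auto simp: arcs_between_def)+
qed

text \<open>
  The weights add up, and the arrows inside \<open>V\<close> are those inside the two parts together with those
  from \<open>N\<close> to \<open>V - N\<close> and back. The exponent of \<open>sqrt_L\<close> on the right contains minus all of them; on the
  left the connecting arrows come from the twist, with sign minus from \<open>N\<close> to \<open>V - N\<close> and plus back.
  The difference is twice the number of arrows from \<open>V - N\<close> to \<open>N\<close>.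
\<close>

lemma normalization_factor_Diff:
  assumes Q: "quiver Q" and V: "finite V" "V \<subseteq> verts Q \<times> UNIV" and N: "N \<subseteq> V"
  shows "sqrt_L powi skew_form Q (dimv N) (dimv (V - N)) /
      of_nat (card {N'. N' \<subseteq> V \<and> dimv N' = dimv N}) *
      normalization_factor Q (dimv N) * normalization_factor Q (dimv (V - N)) =
    normalization_factor Q (dimv V) * (sqrt_L ^ 2) ^ card (arcs_between (blowup Q) (V - N) N)"
proof -
  let ?M = "V - N" and ?C = "card {N'. N' \<subseteq> V \<and> dimv N' = dimv N}" and ?y = "sqrt_L ^ 2 - 1"
  let ?e = "\<lambda>A B. int (card (arcs_between (blowup Q) A B))"
  have fin: "finite N" "finite ?M" using V(1) N by (auto intro: finite_subset)
  have sub: "N \<subseteq> verts Q \<times> UNIV" "?M \<subseteq> verts Q \<times> UNIV" using V(2) N by auto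
  note rf = rform_dimv[OF Q]
  have card: "card V = card N + card ?M" using V(1) N fin by (simp add: card_Diff_subset card_mono)
  have vf: "of_nat (vfact (dimv V)) =
      of_nat ?C * (of_nat (vfact (dimv N)) * of_nat (vfact (dimv ?M)) :: ratfun)"
    by (simp only: card_subsets_dimv[OF V(1) dimv_Diff[OF V(1) N], symmetric] of_nat_mult)
  have "(sqrt_L ^ 2) ^ card (arcs_between (blowup Q) ?M N) = sqrt_L powi (2 * ?e ?M N)"
    by (simp add: power_int_mult power_int_of_nat flip: power_int_numeral)
  then have R: "normalization_factor Q (dimv V) * (sqrt_L ^ 2) ^ card (arcs_between (blowup Q) ?M N) =
      sqrt_L powi (int (card V) - ?e V V + 2 * ?e ?M N) / ?y ^ card V / of_nat (vfact (dimv V))"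
    using sqrt_L_nonzero V
    by (simp add: normalization_factor_def power_int_add weight_dimv rf)
  have "sqrt_L powi skew_form Q (dimv N) (dimv ?M) / of_nat ?C *
      normalization_factor Q (dimv N) * normalization_factor Q (dimv ?M) =
      sqrt_L powi (?e ?M N - ?e N ?M + ((int (card N) - ?e N N) + (int (card ?M) - ?e ?M ?M))) /
      ?y ^ card V / of_nat (vfact (dimv V))"
    using sqrt_L_nonzero fin sub
    unfolding vf card normalization_factor_def skew_form_def
    by (simp add: power_int_add weight_dimv rf power_add mult.assoc mult.left_commute)
  also have "?e ?M N - ?e N ?M + ((int (card N) - ?e N N) + (int (card ?M) - ?e ?M ?M)) =
      int (card V) - ?e V V + 2 * ?e ?M N"
    using card_arcs_between_Diff[OF finite_arcs_between_blowup[OF Q V(1,1,2,2)] N] card by simp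
  finally show ?thesis unfolding R .
qed

text \<open>
  All points of a ray have the same argument, so the choice does not matter.
\<close>

definition ray_phase :: "complex set \<Rightarrow> real" where
  "ray_phase l = Arg (SOME v. v \<in> l)"

definition ray_through :: "complex \<Rightarrow> complex set" where
  "ray_through v = {complex_of_real t * v |t. 0 < t}"

lemma ray_through_self: "v \<in> ray_through v"
  unfolding ray_through_def by (auto intro: exI[of _ 1])

lemma ray_through_rays: "v \<in> upper_half_plane \<Longrightarrow> ray_through v \<in> rays"
  unfolding ray_through_def rays_def by blast

lemma raysE:
  assumes "l \<in> rays"
  obtains v where "v \<in> upper_half_plane" "l = ray_through v"
  using assms unfolding rays_def ray_through_def by blast

lemma ray_phase_eq:
  assumes "l \<in> rays" "w \<in> l"
  shows "ray_phase l = Arg w"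
proof -
  obtain v where v: "v \<in> upper_half_plane" "l = ray_through v" using assms(1) by (rule raysE)
  have "Arg u = Arg v" if "u \<in> l" for u
    using that unfolding v(2) ray_through_def by auto
  moreover have "(SOME v. v \<in> l) \<in> l" using assms(2) by (rule someI)
  ultimately show ?thesis using assms(2) unfolding ray_phase_def by metis
qed

lemma mem_ray_iff:
  assumes l: "l \<in> rays" and w: "w \<in> upper_half_plane"
  shows "w \<in> l \<longleftrightarrow> Arg w = ray_phase l"
proof
  assume "w \<in> l"
  then show "Arg w = ray_phase l" using ray_phase_eq[OF l] by simp
next
  assume ph: "Arg w = ray_phase l"
  obtain v where v: "v \<in> upper_half_plane" "l = ray_through v" using l by (rule raysE)
  have "Arg w = Arg v" using ph ray_phase_eq[OF l] ray_through_self v(2) by simp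
  then have "complex_of_real (cmod v) * w = complex_of_real (cmod w) * v"
    using rcis_cmod_Arg[of v] rcis_cmod_Arg[of w] by (metis mult.left_commute rcis_def)
  moreover have "cmod v > 0" "cmod w > 0" using v(1) w by (auto simp: upper_half_plane_iff)
  ultimately have "w = complex_of_real (cmod w / cmod v) * v" "0 < cmod w / cmod v"
    by (auto simp: field_simps)
  then show "w \<in> l" unfolding v(2) ray_through_def by blast
qed

lemma ray_nonempty: "l \<in> rays \<Longrightarrow> \<exists>v. v \<in> l"
  using ray_through_self by (metis raysE)

lemma clockwise_phases:
  assumes "clockwise ls" "set ls \<subseteq> rays"
  shows "sorted_wrt (>) (map ray_phase ls)"
  unfolding sorted_wrt_map
proof (rule sorted_wrt_mono_rel[OF _ assms(1)[unfolded clockwise_def]])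
  fix l l' assume "l \<in> set ls" "l' \<in> set ls" and less: "\<forall>v\<in>l. \<forall>v'\<in>l'. Arg v > Arg v'"
  then have l: "l \<in> rays" "l' \<in> rays" using assms(2) by auto
  then obtain v v' where "v \<in> l" "v' \<in> l'" using ray_nonempty by blast
  then show "ray_phase l > ray_phase l'" using less ray_phase_eq[OF l(1)] ray_phase_eq[OF l(2)] by simp
qed

text \<open>
  The constant term \<open>1\<close> of a factor is the term for \<open>N = {}\<close>.
\<close>

lemma ray_factor_dimv:
  assumes Q: "quiver Q" and Z: "stability Q Z" and l: "l \<in> rays"
    and N: "finite N" "N \<subseteq> verts Q \<times> UNIV"
  shows "ray_factor Q Z l (dimv N) =
    (if N = {} \<or> phase (vertex_charge Z) N = ray_phase l
     then mot_scalar (normalization_factor Q (dimv N) *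
       semistable_sum (blowup Q) (vertex_charge Z) (sqrt_L ^ 2 - 1) N) else 0)"
proof (cases "N = {}")
  case True
  have "{T. T \<subseteq> arcs_between (blowup Q) {} {} \<and>
      phase_semistable (blowup Q) (vertex_charge Z) {} T} = {{}}"
    by (auto simp: arcs_between_def phase_semistable_def closed_in_def)
  then have "semistable_sum (blowup Q) (vertex_charge Z) (sqrt_L ^ 2 - 1 :: ratfun) {} = 1"
    by (simp add: semistable_sum_def)
  then show ?thesis
    using True by (simp add: ray_factor_def dimv_empty mot_scalar_one normalization_factor_zero)
next
  case False
  have G: "dimv N \<in> Gamma_plus Q" using N by (simp add: Gamma_plus_dimv)
  have uhp: "(\<Sum>p\<in>N. vertex_charge Z p) \<in> upper_half_plane"
    using N False by (intro sum_upper_half_plane vertex_charge_upper_half_plane[OF Z]) auto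
  have "Z (to_Gamma_int (dimv N)) \<in> l \<longleftrightarrow> phase (vertex_charge Z) N = ray_phase l"
    unfolding stability_dimv[OF Z N] phase_def by (rule mem_ray_iff[OF l uhp])
  moreover have "mot_scalar (1 / of_nat (vfact (dimv N))) * f_Z Q Z (dimv N) =
      mot_scalar (normalization_factor Q (dimv N) *
        semistable_sum (blowup Q) (vertex_charge Z) (sqrt_L ^ 2 - 1) N)"
    unfolding f_Z_def mot_class_R_Z[OF Q Z G]
      semistable_sum_dimv[OF finite_vertex_set N(1) dimv_vertex_set]
    by (simp add: normalization_factor_def mult.assoc mult.commute flip: mot_scalar_mult)
  ultimately show ?thesis
    using False G by (simp add: ray_factor_def dimv_eq_0_iff[OF N(1)])
qed

text \<open>
  The product over a list of rays is the generating series of the supports whose filtration has its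
  phases on these rays. One more ray on the left is one more step of the recursion, the arrows from
  the later part \<open>V - N\<close> back to the first piece \<open>N\<close> accounting for the twist.
\<close>

lemma qt_prod_list_hn_sum:
  assumes Q: "quiver Q" and Z: "stability Q Z"
    and ls: "clockwise ls" "set ls \<subseteq> rays" and V: "finite V" "V \<subseteq> verts Q \<times> UNIV"
  shows "qt_prod_list Q (map (ray_factor Q Z) ls) (dimv V) =
    mot_scalar (normalization_factor Q (dimv V) *
      hn_sum (blowup Q) (vertex_charge Z) (sqrt_L ^ 2 - 1) (map ray_phase ls) V)"
  using ls V
proof (induction ls arbitrary: V)
  case Nil
  show ?case
    using dimv_eq_0_iff[OF Nil.prems(3)]
    by (simp add: qt_prod_list_def qt_one_def hn_sum_Nil mot_scalar_one mot_scalar_zero dimv_empty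
      normalization_factor_zero)
next
  case (Cons l ls)
  let ?G = "blowup Q" and ?z = "vertex_charge Z" and ?y = "sqrt_L ^ 2 - 1 :: ratfun"
  let ?S = "semistable_sum ?G ?z ?y" and ?H = "hn_sum ?G ?z ?y (map ray_phase ls)"
  let ?cond = "\<lambda>N. N = {} \<or> phase ?z N = ray_phase l"
  have l: "l \<in> rays" and lsr: "set ls \<subseteq> rays" using Cons.prems(2) by auto
  have cw: "clockwise ls" using Cons.prems(1) by (simp add: clockwise_def)
  have small: "\<theta> < ray_phase l" if "\<theta> \<in> set (map ray_phase ls)" for \<theta>
    using clockwise_phases[OF Cons.prems(1,2)] that by auto
  have summand: "mot_scalar (sqrt_L powi skew_form Q (dimv N) (dimv (V - N)) /
      of_nat (card {N'. N' \<subseteq> V \<and> dimv N' = dimv N})) * ray_factor Q Z l (dimv N) *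
      qt_prod_list Q (map (ray_factor Q Z) ls) (dimv (V - N)) =
      (if ?cond N then mot_scalar (normalization_factor Q (dimv V) *
        (?S N * ?H (V - N) * (?y + 1) ^ card (arcs_between ?G (V - N) N))) else 0)"
    if N: "N \<in> Pow V" for N
  proof -
    have fin: "finite N" "finite (V - N)" using Cons.prems(3) N by (auto intro: finite_subset)
    have sub: "N \<subseteq> verts Q \<times> UNIV" "V - N \<subseteq> verts Q \<times> UNIV" using Cons.prems(4) N by auto
    note IH = Cons.IH[OF cw lsr fin(2) sub(2)]
    show ?thesis
    proof (cases "?cond N")
      case True
      have "sqrt_L powi skew_form Q (dimv N) (dimv (V - N)) /
          of_nat (card {N'. N' \<subseteq> V \<and> dimv N' = dimv N}) *
          (normalization_factor Q (dimv N) * ?S N) *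
          (normalization_factor Q (dimv (V - N)) * ?H (V - N)) =
          normalization_factor Q (dimv V) *
          (?S N * ?H (V - N) * (?y + 1) ^ card (arcs_between ?G (V - N) N))"
        (is "?c * (?n1 * _) * (?n2 * _) = _")
      proof -
        have "?c * (?n1 * ?S N) * (?n2 * ?H (V - N)) = ?c * ?n1 * ?n2 * (?S N * ?H (V - N))"
          by (simp only: mult_ac)
        also have "?c * ?n1 * ?n2 =
            normalization_factor Q (dimv V) * (sqrt_L ^ 2) ^ card (arcs_between ?G (V - N) N)"
          using N by (intro normalization_factor_Diff[OF Q Cons.prems(3,4)]) simp
        finally show ?thesis by (simp only: mult_ac diff_add_cancel)
      qed
      then show ?thesis
        unfolding ray_factor_dimv[OF Q Z l fin(1) sub(1)] IH
        using True by (simp flip: mot_scalar_mult)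
    next
      case False
      then show ?thesis unfolding ray_factor_dimv[OF Q Z l fin(1) sub(1)] by simp
    qed
  qed
  have "qt_prod_list Q (map (ray_factor Q Z) (l # ls)) (dimv V) =
      qt_times Q (ray_factor Q Z l) (qt_prod_list Q (map (ray_factor Q Z) ls)) (dimv V)"
    by (simp add: qt_prod_list_def)
  also have "\<dots> = (\<Sum>N\<in>Pow V. if ?cond N then mot_scalar (normalization_factor Q (dimv V) *
        (?S N * ?H (V - N) * (?y + 1) ^ card (arcs_between ?G (V - N) N))) else 0)"
    unfolding qt_times_dimv[OF Cons.prems(3)] by (rule sum.cong[OF refl summand])
  also have "\<dots> = mot_scalar (normalization_factor Q (dimv V) *
      (\<Sum>N | N \<subseteq> V \<and> ?cond N. ?S N * ?H (V - N) * (?y + 1) ^ card (arcs_between ?G (V - N) N)))"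
    using Cons.prems(3)
    by (simp add: sum_distrib_left mot_scalar_sum Pow_def Collect_conj_eq flip: sum.inter_filter)
  also have "(\<Sum>N | N \<subseteq> V \<and> ?cond N. ?S N * ?H (V - N) * (?y + 1) ^ card (arcs_between ?G (V - N) N)) =
      hn_sum ?G ?z ?y (ray_phase l # map ray_phase ls) V"
    using Cons.prems(4) small
    by (intro hn_sum_Cons[symmetric] Cons.prems(3) finite_arcs_between_blowup[OF Q]
      vertex_charge_upper_half_plane[OF Z]) auto
  finally show ?case by simp
qed

text \<open>
  For the coefficient at \<open>\<alpha>\<close> it suffices that the list contains the rays of all nonempty subsets of the
  vertices of \<open>Q(\<alpha>)\<close>: then every support has its filtration along the list.
\<close>

theorem theorem1p2:
  fixes Q :: "('v, 'e) pre_digraph"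
  assumes "quiver Q"
  shows "\<exists>P. \<forall>Z. stability Q Z \<longrightarrow> has_clockwise_product Q (ray_factor Q Z) P"
proof (intro exI allI impI)
  fix Z assume Z: "stability Q Z"
  let ?P = "\<lambda>\<alpha>. mot_scalar (normalization_factor Q \<alpha> * (sqrt_L ^ 2) ^ rform Q \<alpha> \<alpha>)"
  show "has_clockwise_product Q (ray_factor Q Z) ?P"
    unfolding has_clockwise_product_def
  proof
    fix \<alpha> assume \<alpha>: "\<alpha> \<in> Gamma_plus Q"
    let ?V = "vertex_set \<alpha>" and ?z = "vertex_charge Z"
    define L0 where "L0 = (\<lambda>N. ray_through (\<Sum>p\<in>N. ?z p)) ` (Pow ?V - {{}})"
    have fin: "finite ?V" by (rule finite_vertex_set)
    have VQ: "?V \<subseteq> verts Q \<times> UNIV" by (rule vertex_set_subset[OF \<alpha>])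
    have uhp: "(\<Sum>p\<in>N. ?z p) \<in> upper_half_plane" if "N \<subseteq> ?V" "N \<noteq> {}" for N
      using that VQ finite_subset[OF that(1) fin]
      by (intro sum_upper_half_plane vertex_charge_upper_half_plane[OF Z]) auto
    have "finite L0" using fin by (simp add: L0_def)
    moreover have "L0 \<subseteq> rays" using uhp ray_through_rays by (auto simp: L0_def)
    moreover have "qt_prod_list Q (map (ray_factor Q Z) ls) \<alpha> = ?P \<alpha>"
      if ls: "clockwise ls" "L0 \<subseteq> set ls" "set ls \<subseteq> rays" for ls
    proof -
      have "phase ?z N \<in> set (map ray_phase ls)" if "N \<subseteq> ?V" "N \<noteq> {}" for N
      proof -
        have "ray_through (\<Sum>p\<in>N. ?z p) \<in> set ls" using that ls(2) by (auto simp: L0_def)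
        moreover have "ray_phase (ray_through (\<Sum>p\<in>N. ?z p)) = phase ?z N"
          unfolding phase_def
          by (rule ray_phase_eq[OF ray_through_rays[OF uhp[OF that]] ray_through_self])
        ultimately show ?thesis by force
      qed
      then have "hn_sum (blowup Q) ?z (sqrt_L ^ 2 - 1) (map ray_phase ls) ?V =
          (sqrt_L ^ 2 - 1 + 1) ^ card (arcs_between (blowup Q) ?V ?V)"
        using VQ by (intro hn_sum_total fin finite_arcs_between_blowup assms
          vertex_charge_upper_half_plane[OF Z] clockwise_phases ls) auto
      moreover have "rform Q \<alpha> \<alpha> = card (arcs_between (blowup Q) ?V ?V)"
        using rform_dimv[OF assms fin fin VQ VQ] by (simp add: dimv_vertex_set)
      ultimately show ?thesis
        using qt_prod_list_hn_sum[OF assms Z ls(1,3) fin VQ] by (simp add: dimv_vertex_set)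
    qed
    ultimately show "\<exists>L0. finite L0 \<and> L0 \<subseteq> rays \<and>
        (\<forall>ls. clockwise ls \<and> L0 \<subseteq> set ls \<and> set ls \<subseteq> rays
           \<longrightarrow> qt_prod_list Q (map (ray_factor Q Z) ls) \<alpha> = ?P \<alpha>)" by blast
  qed
qed

end
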